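(* Let $(B_n)_{n\ge1}$ be a decreasing sequence of measurable subsets of $[0,1]$ with $m(B_n)>0$ for all $n$ and $\sum_{n=1}^\infty m(B_n)=\infty$. Then there is a dense $G_\delta$ subset of $\mathcal M$ consisting of ergodic maps $\tau$ such that, up to a null set, $$\bigcap_{N=1}^\infty\bigcup_{n=N}^\infty\tau^{-n}(B_n)=[0,1],$$ i.e. for a.e. $x$ one has $\tau^n(x)\in B_n$ for infinitely many $n$.
   Context: $m$ is Lebesgue measure on $[0,1]$. $\mathcal M$ denotes the group of invertible measure-preserving transformations of $([0,1],m)$ (modulo null sets), equipped with the weak topology: $\tau_j\to\tau$ iff $m(\tau_j(A)\,\triangle\,\tau(A))\to0$ for every measurable $A$. *)

theory Defs
  imports "HOL-Analysis.Analysis"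
begin

text \<open>Representatives of the group of invertible measure-preserving transformations of
  ([0,1], Lebesgue measure): bijections of [0,1] such that both the map and its inverse are
  measurable and measure preserving (the inverse condition is phrased via images).\<close>
definition MPT :: "(real \<Rightarrow> real) set" where
  "MPT = {\<tau>. bij_betw \<tau> {0..1} {0..1} \<and>
     (\<forall>A \<in> sets (lebesgue_on {0..1}).
        \<tau> -` A \<inter> {0..1} \<in> sets lebesgue \<and>
        measure lebesgue (\<tau> -` A \<inter> {0..1}) = measure lebesgue A \<and>
        \<tau> ` A \<in> sets lebesgue \<and>
        measure lebesgue (\<tau> ` A) = measure lebesgue A)}"

definition weak_top :: "(real \<Rightarrow> real) topology" where
  "weak_top = topology_generated_by
     {{\<sigma> \<in> MPT. measure lebesgue ((\<sigma> ` A - \<tau> ` A) \<union> (\<tau> ` A - \<sigma> ` A)) < \<epsilon>} | \<tau> A \<epsilon>.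
        \<tau> \<in> MPT \<and> A \<in> sets (lebesgue_on {0..1}) \<and> \<epsilon> > 0}"

definition ergodic :: "(real \<Rightarrow> real) \<Rightarrow> bool" where
  "ergodic \<tau> \<longleftrightarrow>
     (\<forall>A \<in> sets (lebesgue_on {0..1}).
        measure lebesgue (((\<tau> -` A \<inter> {0..1}) - A) \<union> (A - (\<tau> -` A \<inter> {0..1}))) = 0
        \<longrightarrow> measure lebesgue A = 0 \<or> measure lebesgue A = 1)"

end

(* Cut [0,1) into q cells of length 1/q and let a cyclic permutation of them approximate a map.
   The dense G_delta set consists of the maps that are, for arbitrarily large q, extremely close
   to such a cyclic permutation which moreover carries most cells into some B_n with
   N <= n <= M.  Closeness gives ergodicity (an invariant set has nearly the same measure in
   every cell) and, letting N grow, visits to B_n for infinitely many n.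

   Density needs no Baire category theorem: its members are built by hand.  A given map is first
   approximated weakly by one cyclic permutation.  A cyclic permutation is then refined by
   subdividing each cell into L letters and letting the new cycle run through all words of
   length K over these letters.  Along a random word the visits to the sets B_n are independent,
   so a word misses all of them with probability at most exp (- sum of m(B_n)), and divergence
   makes this small.  Infinitely many refinements define a limit map on addresses, which is a
   bijection off a countable set. *)

theory Submission
  imports Defs
begin

text \<open>\<open>MPT\<close> consists of actual bijections of [0,1], not of classes modulo null
  sets, so \<open>weak_top\<close> does not separate maps that agree almost everywhere, and a limit
  map has to be repaired pointwise. Two demands compete: a refined cycle must shadow the coarser one
  at every time (\<open>refines\<close>), so that a limit exists, yet it must reach parts of the
  sets \<open>B n\<close> that the coarse cells do not resolve. The only freedom left is the choice
  of a subcell in each visited cell, and the words spend exactly this freedom. A word revisits its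
  letters while a cycle enters each cell once per period; hence a further subdivision gives every
  occurrence of a letter a piece of its own. Divergence has to survive restriction to the cells met
  along the cycle, where \<open>B n\<close> is seen only in the cell visited n steps after the
  start; this is where monotonicity of the sets enters. The limit map follows every cycle of the
  sequence exactly up to null sets, so the tolerance in \<open>stage\<close> may depend on the cycle
  and on the time bound without harming density.\<close>

abbreviation (input) unit_sets :: "real set set" where
  "unit_sets \<equiv> sets (lebesgue_on {0..1})"

abbreviation (input) sdm :: "real set \<Rightarrow> real set \<Rightarrow> real" where
  "sdm A B \<equiv> measure lebesgue ((A - B) \<union> (B - A))"

section \<open>Lebesgue measure on subsets of the unit interval\<close>

lemma unit_sets_iff: "A \<in> unit_sets \<longleftrightarrow> A \<in> sets lebesgue \<and> A \<subseteq> {0..1}"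
  by (auto simp: sets_restrict_space_iff)

lemma unit_setsI: "A \<in> sets lebesgue \<Longrightarrow> A \<subseteq> {0..1} \<Longrightarrow> A \<in> unit_sets"
  by (simp add: unit_sets_iff)

lemma unit_sets_lmeasurable: "A \<in> unit_sets \<Longrightarrow> A \<in> lmeasurable"
  unfolding unit_sets_iff using bounded_set_imp_lmeasurable bounded_subset[OF bounded_closed_interval] by blast

lemma unit_sets_Un: "A \<in> unit_sets \<Longrightarrow> B \<in> unit_sets \<Longrightarrow> A \<union> B \<in> unit_sets"
  by (rule sets.Un)

lemma unit_sets_sd: "A \<in> unit_sets \<Longrightarrow> B \<in> unit_sets \<Longrightarrow> (A - B) \<union> (B - A) \<in> unit_sets"
  by (intro sets.Un sets.Diff)

lemma measure_unit_mono:
  "A \<in> unit_sets \<Longrightarrow> B \<in> unit_sets \<Longrightarrow> A \<subseteq> B \<Longrightarrow> measure lebesgue A \<le> measure lebesgue B"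
  by (simp add: measure_mono_fmeasurable unit_sets_iff unit_sets_lmeasurable)

lemma measure_unit_le_1: "A \<in> unit_sets \<Longrightarrow> measure lebesgue A \<le> 1"
  using measure_unit_mono[of A "{0..1}"] by (auto simp: unit_sets_iff)

lemma measure_unit_Un_le:
  "A \<in> unit_sets \<Longrightarrow> B \<in> unit_sets \<Longrightarrow>
   measure lebesgue (A \<union> B) \<le> measure lebesgue A + measure lebesgue B"
  by (intro measure_Un_le) (auto simp: unit_sets_iff)

lemma measure_unit_Un_disjoint:
  assumes "A \<in> unit_sets" "B \<in> unit_sets" "A \<inter> B = {}"
  shows "measure lebesgue (A \<union> B) = measure lebesgue A + measure lebesgue B"
  using measure_Un3[of A lebesgue B] assms by (simp add: unit_sets_lmeasurable)

lemma measure_unit_Diff_Int: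
  assumes "A \<in> unit_sets" "B \<in> unit_sets"
  shows "measure lebesgue A = measure lebesgue (A \<inter> B) + measure lebesgue (A - B)"
proof -
  have "A = (A \<inter> B) \<union> (A - B)" by auto
  moreover have "measure lebesgue ((A \<inter> B) \<union> (A - B)) = measure lebesgue (A \<inter> B) + measure lebesgue (A - B)"
    using assms by (intro measure_unit_Un_disjoint sets.Int sets.Diff) auto
  ultimately show ?thesis by simp
qed

lemma sdm_triangle:
  assumes "A \<in> unit_sets" "B \<in> unit_sets" "C \<in> unit_sets"
  shows "sdm A C \<le> sdm A B + sdm B C"
proof -
  have "sdm A C \<le> measure lebesgue (((A - B) \<union> (B - A)) \<union> ((B - C) \<union> (C - B)))"
    using assms by (intro measure_unit_mono unit_sets_sd unit_sets_Un) auto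
  also have "\<dots> \<le> sdm A B + sdm B C"
    using assms by (intro measure_unit_Un_le unit_sets_sd)
  finally show ?thesis .
qed

lemma sdm_commute: "sdm A B = sdm B A"
  by (simp add: Un_commute)

lemma sdm_eq_measure_Diff:
  assumes "A \<in> unit_sets" "B \<in> unit_sets"
  shows "sdm A B = measure lebesgue A + measure lebesgue B - 2 * measure lebesgue (A \<inter> B)"
proof -
  have "sdm A B = measure lebesgue (A - B) + measure lebesgue (B - A)"
    using assms by (intro measure_unit_Un_disjoint sets.Diff) auto
  then show ?thesis
    using measure_unit_Diff_Int[OF assms] measure_unit_Diff_Int[OF assms(2,1)]
    by (simp add: Int_commute)
qed

lemma measure_Diff_le_sdm:
  assumes "A \<in> unit_sets" "B \<in> unit_sets"
  shows "measure lebesgue (A - B) \<le> sdm A B"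
  using assms by (intro measure_unit_mono unit_sets_sd) auto

section \<open>Cells and approximation by unions of cells\<close>

text \<open>Half-open, so that the cells of one rank partition [0,1) exactly and the index of the
  cell of a point is a floor. The point 1 is lost, which explains the recurring exceptional set
  {1}.\<close>

definition cell :: "nat \<Rightarrow> nat \<Rightarrow> real set" where
  "cell q a = {real a / real q ..< real (Suc a) / real q}"

lemma mem_cell_iff:
  assumes "q > 0" "x \<ge> 0"
  shows "x \<in> cell q a \<longleftrightarrow> nat \<lfloor>real q * x\<rfloor> = a"
proof -
  have "x \<in> cell q a \<longleftrightarrow> real a \<le> real q * x \<and> real q * x < real a + 1"
    using assms by (auto simp: cell_def field_simps)
  also have "\<dots> \<longleftrightarrow> \<lfloor>real q * x\<rfloor> = int a"
    by (simp add: floor_eq_iff)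
  also have "\<dots> \<longleftrightarrow> nat \<lfloor>real q * x\<rfloor> = a"
    using assms by auto
  finally show ?thesis .
qed

lemma cell_nonneg: "x \<in> cell q a \<Longrightarrow> x \<ge> 0"
  unfolding cell_def by (meson atLeastLessThan_iff divide_nonneg_nonneg of_nat_0_le_iff order_trans)

lemma cell_subset_unit:
  assumes "a < q"
  shows "cell q a \<subseteq> {0..<1}"
proof
  fix x assume x: "x \<in> cell q a"
  have "x < real (Suc a) / real q" using x by (simp add: cell_def)
  also have "\<dots> \<le> 1" using assms by (simp del: of_nat_Suc)
  finally show "x \<in> {0..<1}" using cell_nonneg[OF x] by simp
qed

lemma cell_unit_sets: "a < q \<Longrightarrow> cell q a \<in> unit_sets"
  using cell_subset_unit[of a q] by (intro unit_setsI) (simp add: cell_def, force)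

lemma cell_disjoint: "a \<noteq> b \<Longrightarrow> cell q a \<inter> cell q b = {}"
proof (cases "q = 0")
  case False
  then show "a \<noteq> b \<Longrightarrow> cell q a \<inter> cell q b = {}"
    by (metis disjoint_iff cell_nonneg mem_cell_iff neq0_conv)
qed (auto simp: cell_def)

lemma measure_cell: "q > 0 \<Longrightarrow> measure lebesgue (cell q a) = 1 / real q"
  by (simp add: cell_def field_simps)

text \<open>The floor of q x is the floor of (q k x) / k. This makes \<open>div k\<close> the
  passage from a fine cell to the coarse cell around it, the device behind every refinement
  below.\<close>

lemma cell_mult_subset:
  assumes "q > 0" "k > 0"
  shows "cell (q * k) a \<subseteq> cell q (a div k)"
proof
  fix x assume x: "x \<in> cell (q * k) a"
  have "x \<ge> 0" using x by (rule cell_nonneg)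
  have "nat \<lfloor>real q * x\<rfloor> = nat \<lfloor>real (q * k) * x / real k\<rfloor>" using assms by simp
  also have "\<dots> = nat \<lfloor>real (q * k) * x\<rfloor> div k"
    using floor_divide_real_eq_div[of "int k" "real (q * k) * x"] assms \<open>x \<ge> 0\<close>
    by (simp add: nat_div_distrib)
  also have "\<dots> = a div k" using x mem_cell_iff[of "q * k" x a] assms \<open>x \<ge> 0\<close> by simp
  finally show "x \<in> cell q (a div k)" using mem_cell_iff[of q x] assms \<open>x \<ge> 0\<close> by simp
qed

lemma UN_cell: "q > 0 \<Longrightarrow> (\<Union>a<q. cell q a) = {0..<1}"
proof (intro equalityI subsetI)
  fix x :: real assume q: "q > 0" and x: "x \<in> {0..<1}"
  have "real q * x < real q" using x q by simp
  then have "nat \<lfloor>real q * x\<rfloor> < q" using x by (simp add: nat_less_iff floor_less_iff)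
  then show "x \<in> (\<Union>a<q. cell q a)" using mem_cell_iff[OF q, of x] x by auto
qed (metis UN_E cell_subset_unit lessThan_iff subset_iff)

lemma UN_cell_unit_sets: "S \<subseteq> {..<q} \<Longrightarrow> (\<Union>a\<in>S. cell q a) \<in> unit_sets"
  by (intro sets.finite_UN) (auto intro: finite_subset cell_unit_sets)

lemma measure_UN_disjoint_unit:
  assumes "finite S" "\<And>a. a \<in> S \<Longrightarrow> F a \<in> unit_sets" "disjoint_family_on F S"
  shows "measure lebesgue (\<Union>a\<in>S. F a) = (\<Sum>a\<in>S. measure lebesgue (F a))"
  using assms unit_sets_lmeasurable
  by (intro measure_finite_Union) (auto simp: fmeasurable_def unit_sets_iff image_subset_iff less_top[symmetric])

lemma disjoint_family_cell: "disjoint_family_on (cell q) S"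
  using cell_disjoint by (auto simp: disjoint_family_on_def)

lemma measure_UN_cell:
  assumes "S \<subseteq> {..<q}" "q > 0"
  shows "measure lebesgue (\<Union>a\<in>S. cell q a) = real (card S) / real q"
proof -
  have "measure lebesgue (\<Union>a\<in>S. cell q a) = (\<Sum>a\<in>S. measure lebesgue (cell q a))"
    using assms by (intro measure_UN_disjoint_unit disjoint_family_cell) (auto intro: finite_subset cell_unit_sets)
  then show ?thesis using assms by (simp add: measure_cell)
qed

lemma measure_unit_eq_sum_cells:
  assumes "A \<in> unit_sets" "q > 0"
  shows "measure lebesgue A = (\<Sum>a<q. measure lebesgue (A \<inter> cell q a))"
proof -
  have "measure lebesgue A = measure lebesgue (A \<inter> {0..<1})"
  proof (rule measure_negligible_symdiff[symmetric])
    have "(A - A \<inter> {0..<1}) \<union> (A \<inter> {0..<1} - A) \<subseteq> {1}"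
      using assms(1) by (auto simp: unit_sets_iff)
    then show "negligible ((A - A \<inter> {0..<1}) \<union> (A \<inter> {0..<1} - A))"
      by (rule negligible_subset[OF negligible_sing])
  qed (rule unit_sets_lmeasurable[OF assms(1)])
  also have "A \<inter> {0..<1} = (\<Union>a<q. A \<inter> cell q a)" using UN_cell[OF assms(2)] by auto
  also have "measure lebesgue \<dots> = (\<Sum>a<q. measure lebesgue (A \<inter> cell q a))"
    using assms cell_disjoint
    by (intro measure_UN_disjoint_unit) (auto simp: disjoint_family_on_def intro!: sets.Int cell_unit_sets)
  finally show ?thesis .
qed

text \<open>Squeeze \<open>A\<close> between a compact \<open>K\<close> and an open \<open>T\<close>
  of nearly the same measure. \<open>K\<close> has a positive distance from the complement of
  \<open>T\<close>, so sufficiently short cells that meet \<open>K\<close> stay in \<open>T\<close>.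
  Every large \<open>q\<close> works, so that several sets can be approximated at one common
  rank.\<close>

lemma cell_approximation:
  assumes A: "A \<in> unit_sets" and "\<epsilon> > 0"
  shows "\<exists>q0. \<forall>q\<ge>q0. \<exists>S\<subseteq>{..<q}. sdm A (\<Union>a\<in>S. cell q a) < \<epsilon>"
proof -
  have AL: "A \<in> sets lebesgue" "A \<in> lmeasurable" using A by (auto simp: unit_sets_iff unit_sets_lmeasurable[OF A])
  obtain T where T: "open T" "A \<subseteq> T" "T - A \<in> lmeasurable" "emeasure lebesgue (T - A) < ennreal (\<epsilon> / 2)"
    using sets_lebesgue_outer_open[OF AL(1), of "\<epsilon> / 2"] assms by auto
  obtain K where K: "closed K" "K \<subseteq> A" "A - K \<in> lmeasurable" "emeasure lebesgue (A - K) < ennreal (\<epsilon> / 2)"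
    using sets_lebesgue_inner_closed[OF AL(1), of "\<epsilon> / 2"] assms by auto
  have "K \<subseteq> {0..1}" using K A by (auto simp: unit_sets_iff)
  then have "compact K" using K(1) by (meson bounded_closed_interval bounded_subset compact_eq_bounded_closed)
  then obtain d where d: "d > 0" "\<And>x y. x \<in> K \<Longrightarrow> y \<in> - T \<Longrightarrow> d \<le> dist x y"
    using separate_compact_closed[of K "- T"] T(1,2) K(2) by (metis Compl_disjoint2 closed_Compl disjoint_eq_subset_Compl double_compl subset_trans)
  obtain q0 :: nat where q0: "1 / d < real q0" using reals_Archimedean2 by blast
  have "\<exists>S\<subseteq>{..<q}. sdm A (\<Union>a\<in>S. cell q a) < \<epsilon>" if q: "q \<ge> q0" for q
  proof -
    have "real q > 1 / d" using q q0 by linarith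
    then have qd1: "1 < d * real q" using d(1) by (simp add: field_simps)
    then have "q > 0" by (auto intro!: Nat.gr0I)
    then have qd: "1 / real q < d" "q > 0" using qd1 by (auto simp: field_simps)
    define S where "S = {a. a < q \<and> cell q a \<inter> K \<noteq> {}}"
    let ?C = "\<Union>a\<in>S. cell q a"
    have S: "S \<subseteq> {..<q}" by (auto simp: S_def)
    have CT: "?C \<subseteq> T"
    proof
      fix x assume "x \<in> ?C"
      then obtain a y where *: "x \<in> cell q a" "y \<in> cell q a" "y \<in> K" by (auto simp: S_def)
      then have "dist y x < 1 / real q"
        by (auto simp: cell_def dist_real_def add_divide_distrib)
      then show "x \<in> T" using d(2)[OF *(3), of x] qd by force
    qed
    \<comment> \<open>The point 1 lies in no cell; as a null set it is added to the bound
      below.\<close>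
    have KC: "K - {1} \<subseteq> ?C"
    proof
      fix x assume x: "x \<in> K - {1}"
      then have "x \<in> {0..<1}" using \<open>K \<subseteq> {0..1}\<close> by force
      then show "x \<in> ?C" using UN_cell[OF qd(2)] x unfolding S_def by blast
    qed
    have 1: "measure lebesgue (T - A) < \<epsilon> / 2" "measure lebesgue (A - K) < \<epsilon> / 2"
      using T K assms by (auto simp: emeasure_eq_measure2 ennreal_less_iff)
    have "sdm A ?C \<le> measure lebesgue ((A - K) \<union> (T - A) \<union> {1})"
    proof (rule measure_mono_fmeasurable)
      show "(A - ?C) \<union> (?C - A) \<subseteq> (A - K) \<union> (T - A) \<union> {1}" using T(2) K(2) CT KC by auto
      show "(A - ?C) \<union> (?C - A) \<in> sets lebesgue"
        using unit_sets_sd[OF A UN_cell_unit_sets[OF S]] by (simp only: unit_sets_iff)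
      show "(A - K) \<union> (T - A) \<union> {1} \<in> lmeasurable"
        using T(3) K(3) by (intro fmeasurable.Un) (auto intro: bounded_set_imp_lmeasurable)
    qed
    also have "\<dots> \<le> measure lebesgue ((A - K) \<union> (T - A)) + measure lebesgue {1::real}"
      using T K by (intro measure_Un_le) auto
    also have "\<dots> \<le> measure lebesgue (A - K) + measure lebesgue (T - A)"
      using T K by (simp add: measure_Un_le fmeasurableD)
    finally show ?thesis using 1 S by auto
  qed
  then show ?thesis by blast
qed

subsection \<open>Maps close to a cyclic permutation of cells\<close>

lemma MPT_bij: "\<tau> \<in> MPT \<Longrightarrow> bij_betw \<tau> {0..1} {0..1}"
  by (simp add: MPT_def)

lemma MPT_inj: "\<tau> \<in> MPT \<Longrightarrow> inj_on \<tau> {0..1}"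
  using MPT_bij bij_betw_imp_inj_on by blast

lemma MPT_maps_to: "\<tau> \<in> MPT \<Longrightarrow> x \<in> {0..1} \<Longrightarrow> \<tau> x \<in> {0..1}"
  using MPT_bij bij_betwE by blast

lemma MPT_image:
  assumes "\<tau> \<in> MPT" "A \<in> unit_sets"
  shows "\<tau> ` A \<in> unit_sets" "measure lebesgue (\<tau> ` A) = measure lebesgue A"
proof -
  have "\<tau> ` A \<in> sets lebesgue \<and> measure lebesgue (\<tau> ` A) = measure lebesgue A"
    using assms by (simp add: MPT_def)
  moreover have "\<tau> ` A \<subseteq> {0..1}"
    using MPT_maps_to[OF assms(1)] assms(2) unfolding unit_sets_iff by blast
  ultimately show "\<tau> ` A \<in> unit_sets" "measure lebesgue (\<tau> ` A) = measure lebesgue A"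
    by (simp_all only: unit_sets_iff)
qed

lemma MPT_vimage:
  assumes "\<tau> \<in> MPT" "A \<in> unit_sets"
  shows "\<tau> -` A \<inter> {0..1} \<in> unit_sets" "measure lebesgue (\<tau> -` A \<inter> {0..1}) = measure lebesgue A"
proof -
  have "\<tau> -` A \<inter> {0..1} \<in> sets lebesgue \<and> measure lebesgue (\<tau> -` A \<inter> {0..1}) = measure lebesgue A"
    using assms by (simp add: MPT_def)
  then show "\<tau> -` A \<inter> {0..1} \<in> unit_sets" "measure lebesgue (\<tau> -` A \<inter> {0..1}) = measure lebesgue A"
    by (simp_all only: unit_sets_iff) blast
qed

lemma MPT_image_vimage:
  assumes "\<tau> \<in> MPT" "A \<subseteq> {0..1}"
  shows "\<tau> ` (\<tau> -` A \<inter> {0..1}) = A"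
proof -
  have "A \<subseteq> \<tau> ` {0..1}" using MPT_bij[OF assms(1)] assms(2) by (simp add: bij_betw_def)
  then show ?thesis by auto
qed

lemma MPT_image_Int:
  "\<tau> \<in> MPT \<Longrightarrow> A \<subseteq> {0..1} \<Longrightarrow> B \<subseteq> {0..1} \<Longrightarrow> \<tau> ` (A \<inter> B) = \<tau> ` A \<inter> \<tau> ` B"
  by (rule inj_on_image_Int[OF MPT_inj])

lemma MPT_image_Diff:
  "\<tau> \<in> MPT \<Longrightarrow> A \<subseteq> {0..1} \<Longrightarrow> B \<subseteq> {0..1} \<Longrightarrow> \<tau> ` (A - B) = \<tau> ` A - \<tau> ` B"
  by (rule inj_on_image_set_diff[OF MPT_inj]) auto

lemma MPT_funpow_vimage:
  assumes "\<tau> \<in> MPT" "A \<in> unit_sets"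
  shows "{x \<in> {0..1}. (\<tau> ^^ n) x \<in> A} \<in> unit_sets"
    and "measure lebesgue {x \<in> {0..1}. (\<tau> ^^ n) x \<in> A} = measure lebesgue A"
proof (induction n)
  case 0
  have "{x \<in> {0..1}. x \<in> A} = A" using assms(2) by (auto simp: unit_sets_iff)
  then show "{x \<in> {0..1}. (\<tau> ^^ 0) x \<in> A} \<in> unit_sets"
    and "measure lebesgue {x \<in> {0..1}. (\<tau> ^^ 0) x \<in> A} = measure lebesgue A"
    using assms(2) by simp_all
next
  case (Suc n)
  have *: "{x \<in> {0..1}. (\<tau> ^^ Suc n) x \<in> A} = \<tau> -` {x \<in> {0..1}. (\<tau> ^^ n) x \<in> A} \<inter> {0..1}"
    using MPT_maps_to[OF assms(1)] unfolding set_eq_iff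
    by (simp add: funpow_Suc_right del: funpow.simps) blast
  show "{x \<in> {0..1}. (\<tau> ^^ Suc n) x \<in> A} \<in> unit_sets"
    and "measure lebesgue {x \<in> {0..1}. (\<tau> ^^ Suc n) x \<in> A} = measure lebesgue A"
    unfolding * using MPT_vimage[OF assms(1) Suc(1)] Suc(2) by simp_all
qed

section \<open>The weak topology\<close>

lemma openin_weak_top_basic:
  assumes "\<tau> \<in> MPT" "A \<in> unit_sets" "\<epsilon> > 0"
  shows "openin weak_top {\<sigma> \<in> MPT. sdm (\<sigma> ` A) (\<tau> ` A) < \<epsilon>}"
  unfolding weak_top_def by (rule topology_generated_by_Basis) (use assms in blast)

lemma topspace_weak_top: "topspace weak_top = MPT"
proof
  show "topspace weak_top \<subseteq> MPT"
    unfolding weak_top_def topology_generated_by_topspace by auto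
  show "MPT \<subseteq> topspace weak_top"
  proof
    fix \<tau> assume \<tau>: "\<tau> \<in> MPT"
    have "\<tau> \<in> {\<sigma> \<in> MPT. sdm (\<sigma> ` {}) (\<tau> ` {}) < 1}" using \<tau> by simp
    then show "\<tau> \<in> topspace weak_top"
      using openin_subset[OF openin_weak_top_basic[OF \<tau>, of "{}" 1]] by auto
  qed
qed

text \<open>The generating sets are centred at images under members of \<open>MPT\<close>. The
  triangle inequality frees the centre \<open>C\<close>, which will be a cell.\<close>

lemma openin_weak_top_sdm:
  assumes "A \<in> unit_sets" "C \<in> unit_sets"
  shows "openin weak_top {\<sigma> \<in> MPT. sdm (\<sigma> ` A) C < \<delta>}"
proof (subst openin_subopen, intro ballI)
  fix \<tau> assume \<tau>: "\<tau> \<in> {\<sigma> \<in> MPT. sdm (\<sigma> ` A) C < \<delta>}"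
  let ?T = "{\<sigma> \<in> MPT. sdm (\<sigma> ` A) (\<tau> ` A) < \<delta> - sdm (\<tau> ` A) C}"
  have "openin weak_top ?T" using \<tau> assms by (intro openin_weak_top_basic) auto
  moreover have "\<tau> \<in> ?T" using \<tau> by simp
  moreover have "?T \<subseteq> {\<sigma> \<in> MPT. sdm (\<sigma> ` A) C < \<delta>}"
  proof
    fix \<sigma> assume \<sigma>: "\<sigma> \<in> ?T"
    have "sdm (\<sigma> ` A) C \<le> sdm (\<sigma> ` A) (\<tau> ` A) + sdm (\<tau> ` A) C"
      using \<sigma> \<tau> assms by (intro sdm_triangle MPT_image) auto
    then show "\<sigma> \<in> {\<sigma> \<in> MPT. sdm (\<sigma> ` A) C < \<delta>}" using \<sigma> by auto
  qed
  ultimately show "\<exists>T. openin weak_top T \<and> \<tau> \<in> T \<and> T \<subseteq> {\<sigma> \<in> MPT. sdm (\<sigma> ` A) C < \<delta>}" by blast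
qed

text \<open>Intersections take the smaller radius, and a generating set centred at another map is
  recentred at \<open>\<tau>\<close> by the triangle inequality. Density thus becomes a question
  about the images of finitely many sets.\<close>

lemma weak_top_nbhd:
  assumes "openin weak_top U" "\<tau> \<in> U"
  shows "\<exists>F \<epsilon>. finite F \<and> F \<subseteq> unit_sets \<and> \<epsilon> > 0 \<and>
           (\<forall>\<sigma>\<in>MPT. (\<forall>A\<in>F. sdm (\<sigma> ` A) (\<tau> ` A) < \<epsilon>) \<longrightarrow> \<sigma> \<in> U)"
proof -
  have \<tau>: "\<tau> \<in> MPT" using assms openin_subset topspace_weak_top by blast
  have "generate_topology_on {{\<sigma> \<in> MPT. sdm (\<sigma> ` A) (\<tau> ` A) < \<epsilon>} | \<tau> A \<epsilon>.
        \<tau> \<in> MPT \<and> A \<in> unit_sets \<and> \<epsilon> > 0} U"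
    using assms(1) unfolding weak_top_def by (rule openin_topology_generated_by)
  then show ?thesis using assms(2)
  proof (induction rule: generate_topology_on.induct)
    case Empty
    then show ?case by simp
  next
    case (Int a b)
    obtain F \<epsilon> where F: "finite F" "F \<subseteq> unit_sets" "\<epsilon> > 0"
      "\<forall>\<sigma>\<in>MPT. (\<forall>A\<in>F. sdm (\<sigma> ` A) (\<tau> ` A) < \<epsilon>) \<longrightarrow> \<sigma> \<in> a"
      using Int by auto
    obtain F' \<epsilon>' where F': "finite F'" "F' \<subseteq> unit_sets" "\<epsilon>' > 0"
      "\<forall>\<sigma>\<in>MPT. (\<forall>A\<in>F'. sdm (\<sigma> ` A) (\<tau> ` A) < \<epsilon>') \<longrightarrow> \<sigma> \<in> b"
      using Int by auto
    show ?case using F F'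
      by (intro exI[of _ "F \<union> F'"] exI[of _ "min \<epsilon> \<epsilon>'"]) auto
  next
    case (UN K)
    then obtain k where k: "k \<in> K" "\<tau> \<in> k" by blast
    from UN.IH[OF this] show ?case using k(1) by (meson UnionI)
  next
    case (Basis s)
    then obtain \<rho> A \<epsilon> where s: "s = {\<sigma> \<in> MPT. sdm (\<sigma> ` A) (\<rho> ` A) < \<epsilon>}"
      and \<rho>: "\<rho> \<in> MPT" "A \<in> unit_sets" "\<epsilon> > 0" by blast
    have "\<sigma> \<in> s" if \<sigma>: "\<sigma> \<in> MPT" "sdm (\<sigma> ` A) (\<tau> ` A) < \<epsilon> - sdm (\<tau> ` A) (\<rho> ` A)" for \<sigma>
    proof -
      have "sdm (\<sigma> ` A) (\<rho> ` A) \<le> sdm (\<sigma> ` A) (\<tau> ` A) + sdm (\<tau> ` A) (\<rho> ` A)"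
        using \<sigma> \<rho> \<tau> by (intro sdm_triangle MPT_image)
      then show ?thesis using \<sigma> s by simp
    qed
    then show ?case using Basis s \<rho>
      by (intro exI[of _ "{A}"] exI[of _ "\<epsilon> - sdm (\<tau> ` A) (\<rho> ` A)"]) auto
  qed
qed

text \<open>\<open>e\<close> enumerates the cells periodically in the order in which the cycle
  visits them, \<open>cell q (e t)\<close> being mapped to \<open>cell q (e (Suc t))\<close>.\<close>
definition cyc :: "nat \<Rightarrow> (nat \<Rightarrow> nat) \<Rightarrow> bool" where
  "cyc q e \<longleftrightarrow> q > 0 \<and> bij_betw e {..<q} {..<q} \<and> (\<forall>t. e (t + q) = e t)"

definition near :: "nat \<Rightarrow> (nat \<Rightarrow> nat) \<Rightarrow> real \<Rightarrow> (real \<Rightarrow> real) set" where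
  "near q e \<delta> = {\<tau> \<in> MPT. \<forall>t. sdm (\<tau> ` cell q (e t)) (cell q (e (Suc t))) < \<delta>}"

lemma cyc_mod:
  assumes "cyc q e"
  shows "e (t mod q) = e t"
proof -
  have "e (s + k * q) = e s" for s k
  proof (induction k)
    case (Suc k)
    have "e (s + Suc k * q) = e (s + k * q + q)" by (simp add: algebra_simps)
    then show ?case using assms Suc by (simp add: cyc_def)
  qed simp
  from this[of "t mod q" "t div q"] show ?thesis by simp
qed

lemma cyc_less: "cyc q e \<Longrightarrow> e t < q"
  using cyc_mod[of q e t] bij_betwE[of e "{..<q}" "{..<q}"]
  by (metis cyc_def lessThan_iff mod_less_divisor)

lemma near_subset_MPT: "near q e \<delta> \<subseteq> MPT"
  by (auto simp: near_def)

text \<open>By periodicity only the times \<open>t < q\<close> impose conditions, so this is a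
  finite intersection of open sets.\<close>

lemma openin_near:
  assumes "cyc q e"
  shows "openin weak_top (near q e \<delta>)"
proof -
  have "near q e \<delta> = (\<Inter>t<q. {\<tau> \<in> MPT. sdm (\<tau> ` cell q (e t)) (cell q (e (Suc t))) < \<delta>})"
  proof
    show "(\<Inter>t<q. {\<tau> \<in> MPT. sdm (\<tau> ` cell q (e t)) (cell q (e (Suc t))) < \<delta>}) \<subseteq> near q e \<delta>"
    proof
      fix \<tau> assume *: "\<tau> \<in> (\<Inter>t<q. {\<tau> \<in> MPT. sdm (\<tau> ` cell q (e t)) (cell q (e (Suc t))) < \<delta>})"
      have q: "q > 0" using assms by (simp add: cyc_def)
      have "sdm (\<tau> ` cell q (e t)) (cell q (e (Suc t))) < \<delta>" for t
      proof -
        have "e (Suc (t mod q)) = e (Suc t)"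
          using cyc_mod[OF assms, of "Suc (t mod q)"] cyc_mod[OF assms, of "Suc t"]
          by (simp add: mod_Suc_eq)
        then show ?thesis using * q cyc_mod[OF assms, of t] by (auto dest!: bspec[of _ _ "t mod q"])
      qed
      then show "\<tau> \<in> near q e \<delta>" using * q by (auto simp: near_def)
    qed
  qed (auto simp: near_def)
  also have "openin weak_top \<dots>"
    using assms by (intro openin_INT2 openin_weak_top_sdm cell_unit_sets cyc_less) (auto simp: cyc_def)
  finally show ?thesis .
qed

text \<open>A point that is off the cycle after one more step was off it before, or sits in the part
  of the current cell that \<open>\<tau>\<close> sends elsewhere. That part has measure at most
  \<open>\<delta>\<close>, and pulling it back by an iterate preserves its measure.\<close>

lemma near_funpow_leave:
  assumes \<tau>: "\<tau> \<in> near q e \<delta>" and e: "cyc q e"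
  shows "measure lebesgue {x \<in> cell q (e t). (\<tau> ^^ n) x \<notin> cell q (e (t + n))} \<le> real n * \<delta>"
proof -
  have M: "\<tau> \<in> MPT" using \<tau> near_subset_MPT by blast
  have c: "cell q (e s) \<in> unit_sets" for s using cell_unit_sets cyc_less[OF e] by blast
  have c01: "cell q (e s) \<subseteq> {0..1}" for s using c unit_sets_iff by blast
  let ?L = "\<lambda>n. {x \<in> cell q (e t). (\<tau> ^^ n) x \<notin> cell q (e (t + n))}"
  have L: "?L n \<in> unit_sets" for n
  proof -
    have "?L n = cell q (e t) - {x \<in> {0..1}. (\<tau> ^^ n) x \<in> cell q (e (t + n))}"
      using c01[of t] by auto
    also have "\<dots> \<in> unit_sets" by (intro sets.Diff MPT_funpow_vimage M c)
    finally show ?thesis .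
  qed
  show ?thesis
  proof (induction n)
    case (Suc n)
    let ?D = "cell q (e (t + n)) - (\<tau> -` cell q (e (t + Suc n)) \<inter> {0..1})"
    let ?E = "{x \<in> {0..1}. (\<tau> ^^ n) x \<in> ?D}"
    have D: "?D \<in> unit_sets" by (intro sets.Diff MPT_vimage M c)
    have "\<tau> ` ?D = \<tau> ` cell q (e (t + n)) - cell q (e (t + Suc n))"
      using c01 by (simp add: MPT_image_Diff[OF M] MPT_image_vimage[OF M])
    then have "measure lebesgue ?D = measure lebesgue (\<tau> ` cell q (e (t + n)) - cell q (e (t + Suc n)))"
      using MPT_image(2)[OF M D] by simp
    also have "\<dots> \<le> sdm (\<tau> ` cell q (e (t + n))) (cell q (e (t + Suc n)))"
      by (intro measure_Diff_le_sdm MPT_image M c)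
    also have "\<dots> \<le> \<delta>" using \<tau> by (simp add: near_def less_imp_le)
    finally have "measure lebesgue ?E \<le> \<delta>" using MPT_funpow_vimage(2)[OF M D] by simp
    moreover have "?L (Suc n) \<subseteq> ?L n \<union> ?E"
    proof
      fix x assume x: "x \<in> ?L (Suc n)"
      have "x \<in> {0..1}" using x c01 by blast
      then show "x \<in> ?L n \<union> ?E" using x by auto
    qed
    then have "measure lebesgue (?L (Suc n)) \<le> measure lebesgue (?L n) + measure lebesgue ?E"
      using measure_unit_mono[OF L unit_sets_Un[OF L MPT_funpow_vimage(1)[OF M D]]]
        measure_unit_Un_le[OF L MPT_funpow_vimage(1)[OF M D]] order_trans by blast
    ultimately show ?case using Suc by (simp add: algebra_simps)
  qed simp
qed

section \<open>Visits to the sets \<open>B n\<close> and the open sets of the construction\<close>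

text \<open>\<open>f t\<close> names one time at which the cell visited at time \<open>t\<close> is
  credited with a hit. Cells are followed along the cycle alone, so no map is involved, and the
  bound \<open>M\<close> limits the error that a nearby map accumulates. The sum would be 1 if every
  credited cell lay inside its target set.\<close>

definition hits :: "(nat \<Rightarrow> real set) \<Rightarrow> nat \<Rightarrow> nat \<Rightarrow> real \<Rightarrow> nat \<Rightarrow> (nat \<Rightarrow> nat) \<Rightarrow> bool" where
  "hits B N M \<epsilon> q e \<longleftrightarrow> (\<exists>f. (\<forall>t. N \<le> f t \<and> f t \<le> M) \<and>
     (\<Sum>t<q. measure lebesgue (cell q (e (t + f t)) \<inter> B (f t))) \<ge> 1 - \<epsilon>)"

text \<open>Most points that are in the target cell at time \<open>f t\<close> started in the cell
  that the cycle prescribes. The exceptions cost at most \<open>real M * \<delta>\<close> for each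
  of the \<open>q\<close> start cells.\<close>

lemma near_hits:
  assumes \<tau>: "\<tau> \<in> near q e \<delta>" and e: "cyc q e" and h: "hits B N M \<epsilon> q e" and N: "N \<ge> 1"
    and B: "\<And>n. n \<ge> 1 \<Longrightarrow> B n \<in> unit_sets" and \<delta>: "\<delta> \<ge> 0"
  shows "measure lebesgue {x \<in> {0..1}. \<exists>n\<in>{N..M}. (\<tau> ^^ n) x \<in> B n} \<ge> 1 - \<epsilon> - real q * real M * \<delta>"
    (is "measure lebesgue ?H \<ge> _")
proof -
  obtain f where f: "\<And>t. N \<le> f t" "\<And>t. f t \<le> M"
    and s: "(\<Sum>t<q. measure lebesgue (cell q (e (t + f t)) \<inter> B (f t))) \<ge> 1 - \<epsilon>"
    using h unfolding hits_def by auto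
  have q: "q > 0" using e by (simp add: cyc_def)
  have M: "\<tau> \<in> MPT" using \<tau> near_subset_MPT by blast
  have c: "cell q (e s) \<in> unit_sets" for s using cell_unit_sets cyc_less[OF e] by blast
  have "?H = (\<Union>n\<in>{N..M}. {x \<in> {0..1}. (\<tau> ^^ n) x \<in> B n})" by auto
  also have "\<dots> \<in> unit_sets"
    using B N by (intro sets.finite_UN MPT_funpow_vimage M) auto
  finally have H: "?H \<in> unit_sets" .
  have *: "measure lebesgue (cell q (e (t + f t)) \<inter> B (f t)) - real M * \<delta> \<le> measure lebesgue (?H \<inter> cell q (e t))" for t
  proof -
    let ?n = "f t"
    have Bn: "B ?n \<in> unit_sets" using B N f(1)[of t] by simp
    let ?C = "cell q (e (t + ?n))"
    let ?Y = "{x \<in> {0..1}. (\<tau> ^^ ?n) x \<in> ?C \<inter> B ?n}"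
    let ?Z = "{x \<in> {0..1}. (\<tau> ^^ ?n) x \<in> ?C}"
    let ?L = "{x \<in> cell q (e t). (\<tau> ^^ ?n) x \<notin> ?C}"
    have Y: "?Y \<in> unit_sets" by (intro MPT_funpow_vimage M sets.Int c Bn)
    have Z: "?Z \<in> unit_sets" by (intro MPT_funpow_vimage M c)
    have L: "?L = cell q (e t) - ?Z" using c[of t] unfolding unit_sets_iff by auto
    \<comment> \<open>\<open>?Z\<close> and the start cell have equal measure, so what
      \<open>?Z\<close> contains outside the cell equals what the cell loses to other cells on the
      way.\<close>
    have "measure lebesgue (?Y - cell q (e t)) \<le> measure lebesgue (?Z - cell q (e t))"
      by (intro measure_unit_mono sets.Diff Y Z c) auto
    also have "\<dots> = measure lebesgue ?Z - measure lebesgue (?Z \<inter> cell q (e t))"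
      using measure_unit_Diff_Int[OF Z c[of t]] by simp
    also have "measure lebesgue ?Z = measure lebesgue (cell q (e t))"
      using MPT_funpow_vimage(2)[OF M c] q by (simp add: measure_cell)
    also have "measure lebesgue (cell q (e t)) - measure lebesgue (?Z \<inter> cell q (e t)) = measure lebesgue ?L"
      unfolding L using measure_unit_Diff_Int[OF c[of t] Z] by (simp add: Int_commute)
    also have "\<dots> \<le> real ?n * \<delta>" by (rule near_funpow_leave[OF \<tau> e])
    also have "\<dots> \<le> real M * \<delta>" using f(2) \<delta> by (intro mult_right_mono) auto
    finally have 1: "measure lebesgue (?Y - cell q (e t)) \<le> real M * \<delta>" .
    have "measure lebesgue (?C \<inter> B ?n) = measure lebesgue ?Y"
      by (intro MPT_funpow_vimage(2)[symmetric] M sets.Int c Bn)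
    also have "\<dots> = measure lebesgue (?Y \<inter> cell q (e t)) + measure lebesgue (?Y - cell q (e t))"
      by (intro measure_unit_Diff_Int Y c)
    also have "measure lebesgue (?Y \<inter> cell q (e t)) \<le> measure lebesgue (?H \<inter> cell q (e t))"
      using f by (intro measure_unit_mono sets.Int Y H c) auto
    finally show ?thesis using 1 by linarith
  qed
  have "1 - \<epsilon> - real q * real M * \<delta> \<le> (\<Sum>t<q. measure lebesgue (cell q (e (t + f t)) \<inter> B (f t)) - real M * \<delta>)"
    using s by (simp add: sum_subtractf algebra_simps)
  also have "\<dots> \<le> (\<Sum>t<q. measure lebesgue (?H \<inter> cell q (e t)))" by (intro sum_mono *)
  also have "\<dots> = (\<Sum>a<q. measure lebesgue (?H \<inter> cell q a))"
    using e unfolding cyc_def by (intro sum.reindex_bij_betw) auto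
  also have "\<dots> = measure lebesgue ?H" using measure_unit_eq_sum_cells[OF H q] by simp
  finally show ?thesis .
qed

text \<open>The tolerance must beat the accumulated error of \<open>M\<close> iterations on all
  \<open>q\<close> cells (for the visits) and of \<open>q\<close> steps on each of \<open>q\<close> cells (for ergodicity).\<close>
definition stage :: "(nat \<Rightarrow> real set) \<Rightarrow> nat \<Rightarrow> (real \<Rightarrow> real) set" where
  "stage B N = {\<tau>. \<exists>q e M. q \<ge> N \<and> cyc q e \<and> hits B (Suc N) M (1 / Suc N) q e \<and>
     \<tau> \<in> near q e (1 / (real (Suc N) * real q ^ 2 * real (Suc M)))}"

lemma openin_stage: "openin weak_top (stage B N)"
proof -
  have "stage B N = \<Union>{near q e (1 / (real (Suc N) * real q ^ 2 * real (Suc M))) | q e M.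
      q \<ge> N \<and> cyc q e \<and> hits B (Suc N) M (1 / Suc N) q e}"
    unfolding stage_def by blast
  also have "openin weak_top \<dots>" by (intro openin_Union) (auto intro: openin_near)
  finally show ?thesis .
qed

section \<open>Ergodicity and infinitely many visits\<close>

text \<open>Mapping a cell almost onto the next one carries its share of the invariant set along, so
  consecutive shares differ by at most \<open>\<delta>\<close>. The single cycle reaches all cells
  within \<open>q\<close> steps, which bounds the distance of any two shares, hence also that of a
  share from their mean.\<close>

lemma near_invariant_equidistributed:
  assumes \<tau>: "\<tau> \<in> near q e \<delta>" and e: "cyc q e" and A: "A \<in> unit_sets"
    and inv: "sdm (\<tau> -` A \<inter> {0..1}) A = 0" and a: "a < q"
  shows "\<bar>measure lebesgue (A \<inter> cell q a) - measure lebesgue A / real q\<bar> \<le> real q * \<delta>"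
proof -
  have q: "q > 0" and M: "\<tau> \<in> MPT" using e \<tau> near_subset_MPT by (auto simp: cyc_def)
  have c: "cell q (e s) \<in> unit_sets" for s using cell_unit_sets cyc_less[OF e] by blast
  have "sdm (\<tau> ` cell q (e 0)) (cell q (e (Suc 0))) < \<delta>" using \<tau> by (simp add: near_def)
  then have \<delta>: "\<delta> > 0" by (rule le_less_trans[OF measure_nonneg])
  define m where "m t = measure lebesgue (A \<inter> cell q (e t))" for t
  let ?A' = "\<tau> -` A \<inter> {0..1}"
  have A': "?A' \<in> unit_sets" by (intro MPT_vimage M A)
  have close: "\<bar>measure lebesgue X - measure lebesgue Y\<bar> \<le> sdm X Y" if "X \<in> unit_sets" "Y \<in> unit_sets" for X Y
    using measure_unit_Diff_Int[OF that] measure_unit_Diff_Int[OF that(2,1)]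
      measure_Diff_le_sdm[OF that] measure_Diff_le_sdm[OF that(2,1)]
      measure_nonneg[of lebesgue "X - Y"] measure_nonneg[of lebesgue "Y - X"]
    unfolding sdm_commute[of Y X] Int_commute[of Y X] by linarith
  have step: "\<bar>m (Suc t) - m t\<bar> \<le> \<delta>" for t
  proof -
    have "sdm (?A' \<inter> cell q (e t)) (A \<inter> cell q (e t)) \<le> sdm ?A' A"
      by (intro measure_unit_mono unit_sets_sd sets.Int A A' c) auto
    then have "m t = measure lebesgue (?A' \<inter> cell q (e t))"
      using close[OF sets.Int[OF A' c] sets.Int[OF A c], of t t] inv by (simp add: m_def)
    also have "\<dots> = measure lebesgue (\<tau> ` (?A' \<inter> cell q (e t)))"
      by (intro MPT_image(2)[symmetric] M sets.Int A' c)
    also have "\<tau> ` (?A' \<inter> cell q (e t)) = A \<inter> \<tau> ` cell q (e t)"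
      using A A' c[of t] by (simp add: MPT_image_Int[OF M] MPT_image_vimage[OF M] unit_sets_iff)
    finally have "m t = measure lebesgue (A \<inter> \<tau> ` cell q (e t))" .
    then have "\<bar>m t - m (Suc t)\<bar> \<le> sdm (A \<inter> \<tau> ` cell q (e t)) (A \<inter> cell q (e (Suc t)))"
      unfolding m_def by (simp only:) (intro close sets.Int A MPT_image M c)
    also have "\<dots> \<le> sdm (\<tau> ` cell q (e t)) (cell q (e (Suc t)))"
      by (intro measure_unit_mono unit_sets_sd sets.Int A MPT_image M c) auto
    also have "\<dots> \<le> \<delta>" using \<tau> by (simp add: near_def less_imp_le)
    finally show ?thesis by (simp add: abs_minus_commute)
  qed
  have walk: "\<bar>m (t + k) - m t\<bar> \<le> real k * \<delta>" for t k
  proof (induction k)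
    case (Suc k)
    then show ?case using step[of "t + k"] by (simp add: algebra_simps)
  qed simp
  have all: "\<bar>m s - m t\<bar> \<le> real q * \<delta>" if "s < q" "t < q" for s t
  proof -
    have "\<bar>m s - m t\<bar> \<le> real (max s t - min s t) * \<delta>"
      using walk[of s "t - s"] walk[of t "s - t"] by (cases "s \<le> t") (auto simp: max_def min_def)
    also have "\<dots> \<le> real q * \<delta>" using that \<delta> by (intro mult_right_mono) auto
    finally show ?thesis .
  qed
  obtain t where t: "t < q" "e t = a"
    using e a unfolding cyc_def bij_betw_def by (metis imageE lessThan_iff)
  have "measure lebesgue A = (\<Sum>a<q. measure lebesgue (A \<inter> cell q a))"
    by (rule measure_unit_eq_sum_cells[OF A q])
  also have "\<dots> = (\<Sum>s<q. m s)"
    unfolding m_def using e unfolding cyc_def by (intro sum.reindex_bij_betw[symmetric]) auto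
  finally have "real q * m t - measure lebesgue A = (\<Sum>s<q. m t - m s)"
    by (simp add: sum_subtractf)
  also have "\<bar>\<dots>\<bar> \<le> (\<Sum>s<q. \<bar>m t - m s\<bar>)" by (rule sum_abs)
  also have "\<dots> \<le> (\<Sum>s<q. real q * \<delta>)" using t all by (intro sum_mono) auto
  finally have "\<bar>real q * m t - measure lebesgue A\<bar> \<le> real q * (real q * \<delta>)" by simp
  moreover have "real q * m t - measure lebesgue A = real q * (m t - measure lebesgue A / real q)"
    using q by (simp add: field_simps)
  ultimately have "real q * \<bar>m t - measure lebesgue A / real q\<bar> \<le> real q * (real q * \<delta>)"
    by (simp add: abs_mult)
  then show ?thesis using q t by (simp add: m_def)
qed

text \<open>Let C be a union of cells close to \<open>A\<close>. Equidistribution makes m(A \<inter>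
  C) nearly at most m(A) m(C), while m(A \<inter> C) and m(C) are both close to m(A). In the limit
  m(A) \<le> m(A)^2, which leaves only 0 and 1.\<close>

lemma stages_ergodic:
  assumes \<tau>: "\<And>N. \<tau> \<in> stage B N"
  shows "ergodic \<tau>"
  unfolding ergodic_def
proof (intro ballI impI)
  fix A assume A: "A \<in> unit_sets" and inv: "sdm (\<tau> -` A \<inter> {0..1}) A = 0"
  let ?m = "measure lebesgue A"
  have "?m \<le> ?m * ?m + \<eta>" if \<eta>: "\<eta> > 0" for \<eta>
  proof -
    obtain q0 where q0: "\<And>q. q \<ge> q0 \<Longrightarrow> \<exists>S\<subseteq>{..<q}. sdm A (\<Union>a\<in>S. cell q a) < \<eta> / 3"
      using cell_approximation[OF A, of "\<eta> / 3"] \<eta> by auto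
    obtain N0 :: nat where N0: "3 / \<eta> < real N0" using reals_Archimedean2 by blast
    \<comment> \<open>\<open>stage\<close> supplies \<open>q \<ge> N\<close>: the part
      \<open>q0\<close> makes the cells fine enough, the part \<open>N0\<close> makes 1 / (N + 1) at
      most \<open>\<eta> / 3\<close>.\<close>
    define N where "N = max q0 N0"
    obtain q e M where q: "q \<ge> N" and e: "cyc q e"
      and near: "\<tau> \<in> near q e (1 / (real (Suc N) * real q ^ 2 * real (Suc M)))"
      using \<tau>[of N] unfolding stage_def by blast
    let ?\<delta> = "1 / (real (Suc N) * real q ^ 2 * real (Suc M))"
    have qp: "q > 0" using e by (simp add: cyc_def)
    obtain S where S: "S \<subseteq> {..<q}" "sdm A (\<Union>a\<in>S. cell q a) < \<eta> / 3"
      using q0[of q] q by (auto simp: N_def)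
    let ?C = "\<Union>a\<in>S. cell q a"
    have fS: "finite S" using S(1) finite_subset by blast
    have C: "?C \<in> unit_sets" by (rule UN_cell_unit_sets[OF S(1)])
    have "card S \<le> q" using card_mono[OF _ S(1)] by simp
    \<comment> \<open>A deviation of \<open>real q * ?\<delta>\<close> on each of up to
      \<open>q\<close> cells: the square of \<open>q\<close> in the tolerance of
      \<open>stage\<close> cancels this.\<close>
    have "real q * real q * ?\<delta> = 1 / (real (Suc N) * real (Suc M))"
      using qp by (simp add: power2_eq_square del: of_nat_Suc)
    also have "\<dots> \<le> 1 / (real (Suc N) * 1)" by (intro divide_left_mono mult_left_mono) auto
    also have "\<dots> \<le> \<eta> / 3"
    proof -
      have "real N0 \<le> real (Suc N)" by (simp add: N_def)
      then have "3 / \<eta> < real (Suc N)" using N0 by linarith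
      then show ?thesis using \<eta> by (simp add: field_simps)
    qed
    finally have qq: "real q * real q * ?\<delta> \<le> \<eta> / 3" .
    have "measure lebesgue (A \<inter> ?C) = measure lebesgue (\<Union>a\<in>S. A \<inter> cell q a)"
      by (rule arg_cong[where f = "measure lebesgue"]) auto
    also have "\<dots> = (\<Sum>a\<in>S. measure lebesgue (A \<inter> cell q a))"
    proof (rule measure_UN_disjoint_unit[OF fS])
      show "disjoint_family_on (\<lambda>a. A \<inter> cell q a) S"
        using disjoint_family_cell[of q S] unfolding disjoint_family_on_def by blast
    qed (use A S(1) cell_unit_sets in blast)
    also have "\<dots> \<le> (\<Sum>a\<in>S. ?m / real q + real q * ?\<delta>)"
    proof (rule sum_mono)
      fix a assume "a \<in> S"
      then have "a < q" using S by auto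
      from near_invariant_equidistributed[OF near e A inv this]
      show "measure lebesgue (A \<inter> cell q a) \<le> ?m / real q + real q * ?\<delta>" by linarith
    qed
    also have "\<dots> = ?m * (real (card S) / real q) + real (card S) * (real q * ?\<delta>)"
      by (simp add: algebra_simps)
    also have "real (card S) * (real q * ?\<delta>) \<le> real q * (real q * ?\<delta>)"
      using \<open>card S \<le> q\<close> by (intro mult_right_mono) auto
    also have "\<dots> \<le> \<eta> / 3" using qq by (simp add: mult.assoc)
    also have "real (card S) / real q = measure lebesgue ?C" using measure_UN_cell[OF S(1) qp] by simp
    finally have 1: "measure lebesgue (A \<inter> ?C) \<le> ?m * measure lebesgue ?C + \<eta> / 3" by simp
    have 2: "?m - measure lebesgue (A \<inter> ?C) < \<eta> / 3"
      using measure_unit_Diff_Int[OF A C] measure_Diff_le_sdm[OF A C] S(2) by simp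
    have "measure lebesgue ?C - measure lebesgue (A \<inter> ?C) < \<eta> / 3"
      using measure_unit_Diff_Int[OF C A] measure_Diff_le_sdm[OF C A] S(2)
      unfolding sdm_commute[of ?C] by (simp add: Int_commute)
    moreover have "measure lebesgue (A \<inter> ?C) \<le> ?m"
      using A C by (intro measure_unit_mono) auto
    ultimately have "measure lebesgue ?C \<le> ?m + \<eta> / 3" by simp
    then have "?m * measure lebesgue ?C \<le> ?m * (?m + \<eta> / 3)" by (intro mult_left_mono) auto
    also have "\<dots> \<le> ?m * ?m + \<eta> / 3"
      using measure_unit_le_1[OF A] \<eta> mult_right_mono[of ?m 1 "\<eta> / 3"] by (simp add: distrib_left)
    finally show ?thesis using 1 2 by simp
  qed
  then have "?m \<le> ?m * ?m" by (rule field_le_epsilon)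
  then have "?m * (1 - ?m) \<le> 0" by (simp add: algebra_simps)
  moreover have "?m * (1 - ?m) \<ge> 0" using measure_unit_le_1[OF A] by simp
  ultimately show "?m = 0 \<or> ?m = 1" by (simp add: antisym)
qed

text \<open>A point without visits after time k avoids, for every N \<ge> k, all visits credited by
  stage N. Such failures have measure at most 2 / (N + 1): one half is the deficit allowed by
  \<open>hits\<close>, the other the accumulated tolerance.\<close>

lemma stages_hit_infinitely_often:
  assumes \<tau>: "\<And>N. \<tau> \<in> stage B N" and B: "\<And>n. n \<ge> 1 \<Longrightarrow> B n \<in> unit_sets"
  shows "AE x in lebesgue_on {0..1}. \<exists>\<^sub>\<infinity>n. n \<ge> 1 \<and> (\<tau> ^^ n) x \<in> B n"
proof -
  have M: "\<tau> \<in> MPT" using \<tau>[of 0] near_subset_MPT unfolding stage_def by blast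
  define Z where "Z k = {x \<in> {0..1}. \<forall>n>k. (\<tau> ^^ n) x \<notin> B n}" for k
  have Z_eq: "Z k = {0..1} - (\<Union>n\<in>{k<..}. {x \<in> {0..1}. (\<tau> ^^ n) x \<in> B n})" for k
    by (auto simp: Z_def)
  have Z: "Z k \<in> unit_sets" for k
    unfolding Z_eq using B
    by (intro sets.Diff sets.countable_UN'' MPT_funpow_vimage(1) M) auto
  have "negligible (Z k)" for k
  proof -
    have "measure lebesgue (Z k) \<le> 2 / real (Suc N)" if "N \<ge> k" for N
    proof -
      obtain q e L where e: "cyc q e" and h: "hits B (Suc N) L (1 / Suc N) q e"
        and near: "\<tau> \<in> near q e (1 / (real (Suc N) * real q ^ 2 * real (Suc L)))"
        using \<tau>[of N] unfolding stage_def by blast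
      let ?\<delta> = "1 / (real (Suc N) * real q ^ 2 * real (Suc L))"
      let ?H = "{x \<in> {0..1}. \<exists>n\<in>{Suc N..L}. (\<tau> ^^ n) x \<in> B n}"
      have q: "q > 0" using e by (simp add: cyc_def)
      have "?H = (\<Union>n\<in>{Suc N..L}. {x \<in> {0..1}. (\<tau> ^^ n) x \<in> B n})" by auto
      also have "\<dots> \<in> unit_sets"
        using B by (intro sets.finite_UN MPT_funpow_vimage M) auto
      finally have H: "?H \<in> unit_sets" .
      have "real q * real L * ?\<delta> = (real L / real (Suc L)) * ((1 / real q) * (1 / real (Suc N)))"
        using q by (simp add: power2_eq_square del: of_nat_Suc)
      also have "\<dots> \<le> 1 * (1 * (1 / real (Suc N)))"
        using q by (intro mult_mono) auto
      finally have \<delta>: "real q * real L * ?\<delta> \<le> 1 / real (Suc N)" by simp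
      have "1 - 1 / real (Suc N) - real q * real L * ?\<delta> \<le> measure lebesgue ?H"
        by (intro near_hits[OF near e h _ B]) auto
      then have "1 - 1 / real (Suc N) - 1 / real (Suc N) \<le> measure lebesgue ?H"
        using \<delta> by linarith
      moreover have "measure lebesgue (Z k \<union> ?H) = measure lebesgue (Z k) + measure lebesgue ?H"
        using that by (intro measure_unit_Un_disjoint Z H) (auto simp: Z_def)
      moreover have "measure lebesgue (Z k \<union> ?H) \<le> 1"
        by (intro measure_unit_le_1 unit_sets_Un Z H)
      ultimately show ?thesis by simp
    qed
    then have "\<forall>\<^sub>F N in sequentially. measure lebesgue (Z k) \<le> 2 / real (Suc N)"
      by (auto simp: eventually_sequentially)
    moreover have "(\<lambda>N. 2 / real (Suc N)) \<longlonglongrightarrow> 0"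
      using LIMSEQ_Suc[OF lim_const_over_n[of "2::real"]] by simp
    ultimately have "measure lebesgue (Z k) \<le> 0"
      by (intro tendsto_lowerbound[where F = sequentially]) auto
    then have "measure lebesgue (Z k) = 0" using measure_nonneg[of lebesgue "Z k"] by linarith
    then show ?thesis using unit_sets_lmeasurable[OF Z] negligible_iff_measure by blast
  qed
  then have neg: "negligible (\<Union>k. Z k)" by (intro negligible_countable_Union) auto
  have "\<exists>\<^sub>\<infinity>n. n \<ge> 1 \<and> (\<tau> ^^ n) x \<in> B n" if "x \<in> {0..1}" "x \<notin> (\<Union>k. Z k)" for x
    unfolding INFM_nat
  proof
    fix k
    from that obtain n where "n > k" "(\<tau> ^^ n) x \<in> B n" by (auto simp: Z_def)
    then show "\<exists>n>k. n \<ge> 1 \<and> (\<tau> ^^ n) x \<in> B n" by (intro exI[of _ n]) auto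
  qed
  moreover have "AE x in lebesgue. x \<notin> (\<Union>k. Z k)"
    using neg negligible_iff_null_sets AE_not_in by blast
  ultimately show ?thesis
    by (subst AE_restrict_space_iff) (auto elim!: eventually_mono)
qed

subsection \<open>Refining a cyclic permutation along a word\<close>

text \<open>With t = i K + n, the time \<open>t\<close> is position \<open>n\<close> in the i-th of
  \<open>m\<close> concatenated words of length \<open>K\<close>. Counting along the concatenation
  becomes counting words, position by position.\<close>

lemma card_div_mod:
  fixes K m :: nat
  assumes "K > 0"
  shows "card {t. t < K * m \<and> P (t div K) (t mod K)} = (\<Sum>n<K. card {i. i < m \<and> P i n})"
proof -
  let ?A = "{t. t < K * m \<and> P (t div K) (t mod K)}"
  let ?B = "SIGMA n:{..<K}. {i. i < m \<and> P i n}"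
  have "bij_betw (\<lambda>t. (t mod K, t div K)) ?A ?B"
  proof (rule bij_betw_byWitness[where f' = "\<lambda>(n, i). i * K + n"])
    show "\<forall>a\<in>?A. (\<lambda>(n, i). i * K + n) (a mod K, a div K) = a" by simp
    show "\<forall>a'\<in>?B. (((\<lambda>(n, i). i * K + n) a') mod K, ((\<lambda>(n, i). i * K + n) a') div K) = a'"
      by auto
    show "(\<lambda>t. (t mod K, t div K)) ` ?A \<subseteq> ?B"
      using assms by (auto simp: less_mult_imp_div_less mult.commute)
    show "(\<lambda>(n, i). i * K + n) ` ?B \<subseteq> ?A"
    proof clarsimp
      fix n i assume ni: "n < K" "i < m" "P i n"
      have "i * K + n < Suc i * K" using ni by simp
      also have "\<dots> \<le> m * K" using ni by (intro mult_right_mono) auto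
      finally show "i * K + n < K * m" by (simp add: mult.commute)
    qed
  qed
  then have "card ?A = card ?B" by (rule bij_betw_same_card)
  also have "\<dots> = (\<Sum>n<K. card {i. i < m \<and> P i n})" by (rule card_SigmaI) auto
  finally show ?thesis .
qed

text \<open>Each value \<open>b\<close> owns a block of \<open>l\<close> consecutive numbers, and a
  fibre of at most \<open>l\<close> elements fits into its block.\<close>

lemma injection_with_quotient:
  fixes f :: "'a \<Rightarrow> nat"
  assumes "finite Z" "\<And>z. z \<in> Z \<Longrightarrow> f z < m" "\<And>b. b < m \<Longrightarrow> card {z \<in> Z. f z = b} \<le> l"
  shows "\<exists>g. inj_on g Z \<and> (\<forall>z\<in>Z. g z < m * l \<and> g z div l = f z)"
proof -
  have "\<exists>h. h ` {z \<in> Z. f z = b} \<subseteq> {..<l} \<and> inj_on h {z \<in> Z. f z = b}" if "b < m" for b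
    using assms(3)[OF that] assms(1) by (intro card_le_inj) auto
  then have "\<forall>b. \<exists>h. b < m \<longrightarrow> h ` {z \<in> Z. f z = b} \<subseteq> {..<l} \<and> inj_on h {z \<in> Z. f z = b}" by blast
  then obtain h where "\<forall>b. b < m \<longrightarrow> h b ` {z \<in> Z. f z = b} \<subseteq> {..<l} \<and> inj_on (h b) {z \<in> Z. f z = b}"
    by (rule choice[THEN exE])
  then have h: "\<And>b. b < m \<Longrightarrow> h b ` {z \<in> Z. f z = b} \<subseteq> {..<l}"
    "\<And>b. b < m \<Longrightarrow> inj_on (h b) {z \<in> Z. f z = b}" by blast+
  define g where "g z = f z * l + h (f z) z" for z
  have hl: "h (f z) z < l" if "z \<in> Z" for z
    using h(1)[of "f z"] assms(2)[OF that] that by auto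
  have 1: "g z div l = f z" "g z mod l = h (f z) z" if "z \<in> Z" for z
    using hl[OF that] by (auto simp: g_def)
  have "g z < m * l" if "z \<in> Z" for z
  proof -
    have "g z < Suc (f z) * l" using hl[OF that] by (simp add: g_def)
    also have "\<dots> \<le> m * l" using assms(2)[OF that] by (intro mult_right_mono) auto
    finally show ?thesis .
  qed
  moreover have "inj_on g Z"
  proof (rule inj_onI)
    fix y z assume yz: "y \<in> Z" "z \<in> Z" "g y = g z"
    then have "f y = f z" "h (f y) y = h (f z) z" using 1 by metis+
    then show "y = z" using h(2)[of "f z"] assms(2) yz by (auto dest: inj_onD)
  qed
  ultimately show ?thesis using 1 by blast
qed

text \<open>Here the number of slots equals the number of elements, and an injection of a finite set
  into itself is onto.\<close>

lemma permutation_with_quotient: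
  fixes W :: "nat \<Rightarrow> nat"
  assumes "\<And>t. t < m * l \<Longrightarrow> W t < m" "\<And>b. b < m \<Longrightarrow> card {t. t < m * l \<and> W t = b} \<le> l"
  shows "\<exists>g. bij_betw g {..<m * l} {..<m * l} \<and> (\<forall>t<m * l. g t div l = W t)"
proof -
  obtain g where g: "inj_on g {..<m * l}" "\<forall>z\<in>{..<m * l}. g z < m * l \<and> g z div l = W z"
    using injection_with_quotient[of "{..<m * l}" W m l] assms by auto
  have "g ` {..<m * l} = {..<m * l}"
    using g by (intro endo_inj_surj) auto
  then show ?thesis using g by (auto simp: bij_betw_def)
qed

text \<open>Both cycles share the time index: at each time the fine cell lies in the coarse cell
  visited then, so one fine period winds \<open>k\<close> times around the coarse cycle. This
  synchronisation is what makes limits exist.\<close>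

definition refines :: "nat \<Rightarrow> (nat \<Rightarrow> nat) \<Rightarrow> nat \<Rightarrow> (nat \<Rightarrow> nat) \<Rightarrow> bool" where
  "refines q e q' e' \<longleftrightarrow> (\<exists>k>0. q' = q * k \<and> (\<forall>t. e' t div k = e t))"

text \<open>\<open>W\<close> may enter a cell of rank \<open>q * k\<close> up to \<open>l\<close>
  times. Splitting that cell into \<open>l\<close> pieces and giving each occurrence its own piece
  turns the word into a cycle; the coarse cell visited at each time stays the one prescribed by
  \<open>e\<close>.\<close>

lemma cyc_of_word:
  assumes e: "cyc q e" and pos: "k > 0" "l > 0"
    and W: "\<And>t. t < q * k * l \<Longrightarrow> W t < q * k" "\<And>t. t < q * k * l \<Longrightarrow> W t div k = e t"
    and fib: "\<And>b. b < q * k \<Longrightarrow> card {t. t < q * k * l \<and> W t = b} \<le> l"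
  shows "\<exists>e'. cyc (q * k * l) e' \<and> refines q e (q * k * l) e' \<and> (\<forall>t<q * k * l. e' t div l = W t)"
proof -
  let ?Q = "q * k * l"
  have q: "q > 0" using e by (simp add: cyc_def)
  obtain g where g: "bij_betw g {..<?Q} {..<?Q}" "\<forall>t<?Q. g t div l = W t"
    using permutation_with_quotient[of "q * k" l W] W(1) fib by blast
  define e' where "e' t = g (t mod ?Q)" for t
  have Q: "t mod ?Q < ?Q" for t using q pos by simp
  have "bij_betw e' {..<?Q} {..<?Q} \<longleftrightarrow> bij_betw g {..<?Q} {..<?Q}"
    by (intro bij_betw_cong) (auto simp: e'_def)
  then have "cyc ?Q e'" using g q pos by (auto simp: cyc_def e'_def)
  moreover have "e' t div (k * l) = e t" for t
  proof -
    have "e' t div (k * l) = W (t mod ?Q) div k"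
      using g(2) Q[of t] by (simp add: e'_def mult.commute[of k] div_mult2_eq)
    also have "\<dots> = e (t mod ?Q)" using W(2) Q by blast
    also have "\<dots> = e (t mod ?Q mod q)" using cyc_mod[OF e] by simp
    also have "t mod ?Q mod q = t mod q" by (intro mod_mod_cancel) (simp add: mult.assoc)
    finally show ?thesis using cyc_mod[OF e] by simp
  qed
  then have "refines q e ?Q e'" using pos unfolding refines_def
    by (intro exI[of _ "k * l"]) (simp add: mult.assoc)
  ultimately show ?thesis using g by (auto simp: e'_def)
qed

lemma card_words_fixed_letter:
  assumes "n < K" "d < L"
  shows "card {w \<in> PiE {..<K} (\<lambda>_. {..<L}). w n = d} = L ^ (K - 1)"
proof -
  have "{w \<in> PiE {..<K} (\<lambda>_. {..<L}). w n = d} = PiE {..<K} (\<lambda>k. if k = n then {d} else {..<L})"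
  proof (intro set_eqI iffI)
    fix w assume w: "w \<in> PiE {..<K} (\<lambda>k. if k = n then {d} else {..<L})"
    have "w n = d" using PiE_mem[OF w, of n] assms by simp
    moreover have "w k < L" if "k < K" for k
      using PiE_mem[OF w, of k] that assms by (cases "k = n") auto
    ultimately show "w \<in> {w \<in> PiE {..<K} (\<lambda>_. {..<L}). w n = d}" using w by (simp add: PiE_iff)
  qed (simp add: PiE_iff)
  also have "card \<dots> = (\<Prod>k<K. if k = n then 1 else L)"
    by (subst card_PiE) (auto intro: prod.cong)
  also have "\<dots> = 1 * (\<Prod>k\<in>{..<K} - {n}. L)"
    using assms by (subst prod.remove[of _ n]) (auto intro: prod.cong)
  also have "\<dots> = L ^ (K - 1)" using assms by simp
  finally show ?thesis .
qed

text \<open>The letters at different positions are independent, so the proportion of avoiding words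
  is the product of the factors 1 - y over the positions, and 1 - y \<le> exp (- y).\<close>

lemma card_words_avoiding:
  fixes E :: "nat \<Rightarrow> nat set"
  assumes L: "L > 0" and E: "\<And>n. E n \<subseteq> {..<L}" and n0: "n0 + M < K"
    and C: "(\<Sum>n=N..M. real (card (E n)) / real L) \<ge> C"
  shows "real (card {w \<in> PiE {..<K} (\<lambda>_. {..<L}). \<forall>n\<in>{N..M}. w (n0 + n) \<notin> E n}) \<le> real L ^ K * exp (- C)"
proof -
  \<comment> \<open>The density of forbidden letters at position \<open>k\<close>, zero outside the
    window that starts at \<open>n0\<close>.\<close>
  define y where "y k = (if k \<in> {n0 + N..n0 + M} then real (card (E (k - n0))) / real L else 0)" for k
  let ?F = "\<lambda>k. if k \<in> {n0 + N..n0 + M} then {..<L} - E (k - n0) else {..<L}"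
  have fE: "finite (E n)" for n using E finite_subset by blast
  have "{w \<in> PiE {..<K} (\<lambda>_. {..<L}). \<forall>n\<in>{N..M}. w (n0 + n) \<notin> E n} \<subseteq> PiE {..<K} ?F"
  proof
    fix w assume w: "w \<in> {w \<in> PiE {..<K} (\<lambda>_. {..<L}). \<forall>n\<in>{N..M}. w (n0 + n) \<notin> E n}"
    have "w k \<in> ?F k" if "k < K" for k
    proof (cases "k \<in> {n0 + N..n0 + M}")
      case True
      then have "k - n0 \<in> {N..M}" "n0 + (k - n0) = k" by auto
      then have "w k \<notin> E (k - n0)" using w by force
      then show ?thesis using w True that by auto
    next
      case False
      then show ?thesis using w that by (auto simp: PiE_iff)
    qed
    then show "w \<in> PiE {..<K} ?F" using w by (auto simp: PiE_iff)
  qed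
  then have "card {w \<in> PiE {..<K} (\<lambda>_. {..<L}). \<forall>n\<in>{N..M}. w (n0 + n) \<notin> E n} \<le> card (PiE {..<K} ?F)"
    by (intro card_mono finite_PiE) auto
  also have "card (PiE {..<K} ?F) = (\<Prod>k<K. card (?F k))" by (rule card_PiE) simp
  finally have "real (card {w \<in> PiE {..<K} (\<lambda>_. {..<L}). \<forall>n\<in>{N..M}. w (n0 + n) \<notin> E n}) \<le> real (\<Prod>k<K. card (?F k))"
    by (rule of_nat_mono)
  also have "\<dots> = (\<Prod>k<K. real (card (?F k)))" by (rule of_nat_prod)
  also have "\<dots> \<le> (\<Prod>k<K. real L * exp (- y k))"
  proof (intro prod_mono conjI)
    fix k
    have "real (card (?F k)) = real L * (1 - y k)"
      using L E[of "k - n0"] fE[of "k - n0"] card_mono[OF _ E[of "k - n0"]]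
      by (auto simp: y_def card_Diff_subset of_nat_diff field_simps)
    also have "\<dots> \<le> real L * exp (- y k)"
      using exp_ge_add_one_self[of "- y k"] by (intro mult_left_mono) auto
    finally show "real (card (?F k)) \<le> real L * exp (- y k)" .
  qed auto
  also have "\<dots> = real L ^ K * exp (- (\<Sum>k<K. y k))"
    by (simp add: prod.distrib exp_sum sum_negf[symmetric])
  also have "(\<Sum>k<K. y k) = (\<Sum>k\<in>{n0 + N..n0 + M}. real (card (E (k - n0))) / real L)"
  proof -
    have "{n0 + N..n0 + M} = {..<K} \<inter> {n0 + N..n0 + M}" using n0 by auto
    then show ?thesis unfolding y_def by (metis (no_types, lifting) finite_lessThan sum.cong sum.inter_restrict)
  qed
  also have "\<dots> = (\<Sum>n\<in>{N..M}. real (card (E n)) / real L)"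
    using sum.shift_bounds_cl_nat_ivl[of "\<lambda>k. real (card (E (k - n0))) / real L" N n0 M]
    by (simp add: add.commute)
  also have "real L ^ K * exp (- \<dots>) \<le> real L ^ K * exp (- C)"
    using C by (intro mult_left_mono) auto
  finally show ?thesis .
qed

text \<open>The word \<open>W\<close> is the concatenation of all words of length \<open>K\<close> over
  \<open>L\<close> letters, read simultaneously with the given cycle, whose length divides \<open>K\<close>.
  A start position is bad if its word avoids every target, or if fewer than \<open>M\<close> letters of
  its word remain.\<close>
lemma hitting_word:
  fixes S :: "nat \<Rightarrow> nat set"
  assumes e: "cyc q e" and L: "L > 0" and \<epsilon>: "\<epsilon> > 0" "exp (- C) \<le> \<epsilon>"
    and C: "\<And>j. (\<Sum>n=N..M. real (card {d. d < L \<and> e (j + n) * L + d \<in> S n}) / real L) \<ge> C"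
  shows "\<exists>l>0. \<exists>W. (\<forall>t<q * L * l. W t < q * L \<and> W t div L = e t) \<and>
     (\<forall>b<q * L. card {t. t < q * L * l \<and> W t = b} \<le> l) \<and>
     real (card {t. t < q * L * l \<and> \<not> (\<exists>n\<in>{N..M}. t + n < q * L * l \<and> W (t + n) \<in> S n)}) \<le> 2 * \<epsilon> * real (q * L * l)"
proof -
  have q: "q > 0" using e by (simp add: cyc_def)
  obtain k :: nat where k: "1 / \<epsilon> < real k" using reals_Archimedean2 by blast
  have kp: "k > 0" using k \<epsilon> by (intro Nat.gr0I) (auto simp: field_simps)
  \<comment> \<open>\<open>K\<close> is a multiple of \<open>q\<close>, so every word starts in
    phase with the cycle, and it is so long that \<open>M\<close> positions are at most a fraction
    \<open>\<epsilon>\<close> of a word.\<close>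
  define \<kappa> where "\<kappa> = (M + 1) * k"
  define K where "K = q * \<kappa>"
  have \<kappa>: "\<kappa> > 0" and K: "K > 0" using q kp by (auto simp: \<kappa>_def K_def)
  \<comment> \<open>The number of occurrences of one letter in one coarse cell: a word passes the
    coarse cell \<open>\<kappa>\<close> times, and \<open>L ^ (K - 1)\<close> words have the given
    letter at a given position.\<close>
  define l where "l = \<kappa> * L ^ (K - 1)"
  have l: "l > 0" using \<kappa> L by (simp add: l_def)
  have "L * L ^ (K - 1) = L ^ K" using K by (metis power_minus_mult mult.commute)
  then have Ql: "q * L * l = K * L ^ K" by (simp add: l_def K_def)
  have MK: "real M \<le> \<epsilon> * real K"
  proof -
    have "1 \<le> \<epsilon> * real k" using k \<epsilon> by (simp add: field_simps)
    then have "real M * 1 \<le> real (M + 1) * (\<epsilon> * real k)" by (intro mult_mono) auto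
    also have "\<dots> = \<epsilon> * real \<kappa>" by (simp add: \<kappa>_def algebra_simps)
    also have "\<dots> \<le> \<epsilon> * real K" using \<epsilon> q unfolding K_def by (intro mult_left_mono of_nat_mono) simp_all
    finally show ?thesis by simp
  qed
  let ?Words = "PiE {..<K} (\<lambda>_. {..<L})"
  have "card ?Words = L ^ K" by (simp add: card_PiE)
  then obtain u where u: "bij_betw u {..<L ^ K} ?Words"
    using finite_same_card_bij[of "{..<L ^ K}" ?Words] by (auto intro: finite_PiE)
  have card_u: "card {i. i < L ^ K \<and> P (u i)} = card {w \<in> ?Words. P w}" for P
  proof -
    have "bij_betw u {i. i < L ^ K \<and> P (u i)} {w \<in> ?Words. P w}"
      using u unfolding bij_betw_def inj_on_def by auto
    then show ?thesis by (rule bij_betw_same_card)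
  qed
  define W where "W t = e t * L + u (t div K) (t mod K)" for t
  have uL: "u (t div K) (t mod K) < L" if "t < K * L ^ K" for t
  proof -
    have "t div K < L ^ K" using that by (simp add: less_mult_imp_div_less mult.commute)
    then have "u (t div K) \<in> ?Words" using u by (auto simp: bij_betw_def)
    then show ?thesis using K by (auto simp: PiE_iff)
  qed
  have Wdiv: "W t div L = e t" "W t mod L = u (t div K) (t mod K)" if "t < K * L ^ K" for t
    using uL[OF that] by (auto simp: W_def)
  have Wless: "W t < q * L" if "t < K * L ^ K" for t
  proof -
    have "W t < Suc (e t) * L" using uL[OF that] by (simp add: W_def)
    also have "\<dots> \<le> q * L" using cyc_less[OF e, of t] by (intro mult_right_mono) auto
    finally show ?thesis .
  qed
  have eK: "e (t mod K) = e t" for t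
    using cyc_mod[OF e, of t] cyc_mod[OF e, of "t mod K"] by (simp add: K_def mod_mod_cancel)
  have fib: "card {t. t < K * L ^ K \<and> W t = b} \<le> l" if b: "b < q * L" for b
  proof -
    have "{t. t < K * L ^ K \<and> W t = b} = {t. t < K * L ^ K \<and> (e (t mod K) = b div L \<and> u (t div K) (t mod K) = b mod L)}"
      using Wdiv eK by (metis (no_types, lifting) div_mult_mod_eq W_def)
    then have "card {t. t < K * L ^ K \<and> W t = b} = (\<Sum>n<K. card {i. i < L ^ K \<and> (e n = b div L \<and> u i n = b mod L)})"
      using card_div_mod[OF K, of "L ^ K" "\<lambda>i n. e n = b div L \<and> u i n = b mod L"] by simp
    also have "\<dots> = (\<Sum>n<K. if e n = b div L then L ^ (K - 1) else 0)"
    proof (intro sum.cong refl)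
      fix n assume "n \<in> {..<K}"
      then show "card {i. i < L ^ K \<and> (e n = b div L \<and> u i n = b mod L)} = (if e n = b div L then L ^ (K - 1) else 0)"
        using card_u[of "\<lambda>w. w n = b mod L"] card_words_fixed_letter[of n K "b mod L" L] L by auto
    qed
    also have "\<dots> = card {n. n < K \<and> e n = b div L} * L ^ (K - 1)"
      by (simp add: sum.If_cases Int_def)
    also have "card {n. n < K \<and> e n = b div L} = card {n. n < q * \<kappa> \<and> e (n mod q) = b div L}"
      using cyc_mod[OF e] by (simp add: K_def)
    also have "\<dots> = (\<Sum>n<q. card {i. i < \<kappa> \<and> e n = b div L})"
      using card_div_mod[OF q, of \<kappa> "\<lambda>_ n. e n = b div L"] by simp
    also have "\<dots> = (\<Sum>n<q. if e n = b div L then \<kappa> else 0)" by (intro sum.cong) auto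
    also have "\<dots> = card {n. n < q \<and> e n = b div L} * \<kappa>"
      by (simp add: sum.If_cases Int_def)
    also have "\<dots> \<le> 1 * \<kappa>"
    proof (intro mult_right_mono)
      have "inj_on e {..<q}" using e by (simp add: cyc_def bij_betw_def)
      then have "\<forall>x\<in>{n. n < q \<and> e n = b div L}. \<forall>y\<in>{n. n < q \<and> e n = b div L}. x = y"
        unfolding inj_on_def by auto
      then show "card {n. n < q \<and> e n = b div L} \<le> 1" by (simp add: card_le_Suc0_iff_eq)
    qed auto
    finally show ?thesis by (simp add: l_def)
  qed
  let ?bad = "\<lambda>i n0. n0 + M < K \<longrightarrow> (\<forall>n\<in>{N..M}. u i (n0 + n) \<notin> {d. d < L \<and> e (n0 + n) * L + d \<in> S n})"
  have "{t. t < K * L ^ K \<and> \<not> (\<exists>n\<in>{N..M}. t + n < K * L ^ K \<and> W (t + n) \<in> S n)} \<subseteq>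
        {t. t < K * L ^ K \<and> ?bad (t div K) (t mod K)}"
  proof clarsimp
    fix t n assume t: "t < K * L ^ K" "\<forall>n\<in>{N..M}. t + n < K * L ^ K \<longrightarrow> W (t + n) \<notin> S n"
      and n0: "t mod K + M < K" and n: "N \<le> n" "n \<le> M"
      and mem: "e (t mod K + n) * L + u (t div K) (t mod K + n) \<in> S n"
    have dm: "(t + n) div K = t div K" "(t + n) mod K = t mod K + n"
    proof -
      have "t + n = t div K * K + (t mod K + n)" by simp
      moreover have "t mod K + n < K" using n0 n by simp
      ultimately show "(t + n) div K = t div K" "(t + n) mod K = t mod K + n"
        by (metis add.right_neutral div_less div_mult_self3 K less_irrefl, metis mod_less mod_mult_self3)
    qed
    have "t div K < L ^ K" using t by (simp add: less_mult_imp_div_less mult.commute)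
    then have lt: "t + n < K * L ^ K" using dm(1) K by (metis div_less_iff_less_mult mult.commute)
    have "e (t + n) = e (t mod K + n)" using eK[of "t + n"] dm by simp
    then have "W (t + n) \<in> S n" using mem dm by (simp add: W_def)
    then show False using t(2) lt n by auto
  qed
  then have "card {t. t < K * L ^ K \<and> \<not> (\<exists>n\<in>{N..M}. t + n < K * L ^ K \<and> W (t + n) \<in> S n)} \<le>
        card {t. t < K * L ^ K \<and> ?bad (t div K) (t mod K)}"
    by (intro card_mono) auto
  also have "\<dots> = (\<Sum>n0<K. card {i. i < L ^ K \<and> ?bad i n0})"
    by (rule card_div_mod[OF K])
  finally have "real (card {t. t < K * L ^ K \<and> \<not> (\<exists>n\<in>{N..M}. t + n < K * L ^ K \<and> W (t + n) \<in> S n)}) \<le>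
      real (\<Sum>n0<K. card {i. i < L ^ K \<and> ?bad i n0})"
    by (rule of_nat_mono)
  also have "\<dots> = (\<Sum>n0<K. real (card {i. i < L ^ K \<and> ?bad i n0}))" by (rule of_nat_sum)
  \<comment> \<open>One \<open>\<epsilon>\<close> pays for the words that avoid all targets. The at
    most \<open>M\<close> start positions near the end of a word contribute in full, which costs the
    second one.\<close>
  also have "\<dots> \<le> (\<Sum>n0<K. real L ^ K * \<epsilon> + (if n0 + M < K then 0 else real L ^ K))"
  proof (rule sum_mono)
    fix n0 assume "n0 \<in> {..<K}"
    show "real (card {i. i < L ^ K \<and> ?bad i n0}) \<le> real L ^ K * \<epsilon> + (if n0 + M < K then 0 else real L ^ K)"
    proof (cases "n0 + M < K")
      case True
      have "real (card {i. i < L ^ K \<and> ?bad i n0}) = real (card {w \<in> ?Words. \<forall>n\<in>{N..M}. w (n0 + n) \<notin> {d. d < L \<and> e (n0 + n) * L + d \<in> S n}})"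
        using card_u[of "\<lambda>w. \<forall>n\<in>{N..M}. w (n0 + n) \<notin> {d. d < L \<and> e (n0 + n) * L + d \<in> S n}"] True by simp
      also have "\<dots> \<le> real L ^ K * exp (- C)"
        by (rule card_words_avoiding[OF L _ True C]) auto
      also have "\<dots> \<le> real L ^ K * \<epsilon>" using \<epsilon> by (intro mult_left_mono) auto
      finally show ?thesis using True by simp
    next
      case False
      have "card {i. i < L ^ K \<and> ?bad i n0} \<le> card {..<L ^ K}" by (intro card_mono) auto
      then have "real (card {i. i < L ^ K \<and> ?bad i n0}) \<le> real (card {..<L ^ K})" by (rule of_nat_mono)
      also have "\<dots> = real L ^ K" by simp
      finally have "real (card {i. i < L ^ K \<and> ?bad i n0}) \<le> real L ^ K" .
      then show ?thesis using False \<epsilon> by (simp add: add_increasing)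
    qed
  qed
  also have "\<dots> = real K * (real L ^ K * \<epsilon>) + real (card {n0. n0 < K \<and> \<not> n0 + M < K}) * real L ^ K"
    by (simp add: sum.distrib sum.If_cases Int_def)
  also have "\<dots> \<le> real K * (real L ^ K * \<epsilon>) + real M * real L ^ K"
  proof -
    have "card {n0. n0 < K \<and> \<not> n0 + M < K} \<le> card {K - M..<K}" by (intro card_mono) auto
    also have "\<dots> \<le> M" by simp
    finally show ?thesis by (simp add: mult_right_mono)
  qed
  also have "\<dots> \<le> real K * (real L ^ K * \<epsilon>) + (\<epsilon> * real K) * real L ^ K"
    using MK by (intro add_left_mono mult_right_mono) auto
  also have "\<dots> = 2 * \<epsilon> * real (K * L ^ K)" by simp
  finally have bad: "real (card {t. t < K * L ^ K \<and> \<not> (\<exists>n\<in>{N..M}. t + n < K * L ^ K \<and> W (t + n) \<in> S n)}) \<le> 2 * \<epsilon> * real (K * L ^ K)" .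
  show ?thesis
    using l Wdiv Wless fib bad unfolding Ql[symmetric] by (intro exI[of _ l] conjI exI[of _ W]) auto
qed

lemma cyc_shift_bij:
  assumes "cyc q e"
  shows "bij_betw (\<lambda>i. e (s + i)) {..<q} {..<q}"
proof -
  have inj: "inj_on e {..<q}" using assms by (simp add: cyc_def bij_betw_def)
  have q: "q > 0" using assms by (simp add: cyc_def)
  have le: "i = k" if "i \<le> k" "k < q" "e (s + i) = e (s + k)" for i k
  proof -
    have "e ((s + i) mod q) = e ((s + k) mod q)" using that cyc_mod[OF assms] by simp
    then have "(s + k) mod q = (s + i) mod q" using inj q by (simp add: inj_on_eq_iff)
    then have "q dvd (s + k) - (s + i)" using that by (subst (asm) mod_eq_dvd_iff_nat) auto
    then have "q dvd k - i" by simp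
    then show "i = k" using that by (auto dest: dvd_imp_le)
  qed
  have "inj_on (\<lambda>i. e (s + i)) {..<q}"
    by (rule inj_onI) (metis le lessThan_iff nat_le_linear)
  moreover have "(\<lambda>i. e (s + i)) ` {..<q} \<subseteq> {..<q}" using cyc_less[OF assms] by auto
  ultimately show ?thesis by (simp add: bij_betw_def endo_inj_surj)
qed

section \<open>One refinement step that produces hits\<close>

text \<open>During \<open>q\<close> consecutive times each cell is visited once. The set
  \<open>B (n + (N + q))\<close> lies in all sets belonging to such a window, so its measure is at
  most the total collected there. Bounded sums from one start \<open>j\<close> would make the
  measures summable. The factor \<open>real q\<close> turns a measure into a fraction of a
  cell.\<close>

lemma level_sums_diverge:
  assumes e: "cyc q e"
    and meas: "\<And>n. n \<ge> 1 \<Longrightarrow> B n \<in> unit_sets"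
    and decr: "\<And>n. n \<ge> 1 \<Longrightarrow> B (Suc n) \<subseteq> B n"
    and diverge: "\<not> summable (\<lambda>n. measure lebesgue (B (Suc n)))"
    and N: "N \<ge> 1"
  shows "\<exists>M\<ge>N. \<forall>j. C \<le> (\<Sum>n=N..M. real q * measure lebesgue (cell q (e (j + n)) \<inter> B n))"
proof -
  have q: "q > 0" using e by (simp add: cyc_def)
  have c: "cell q (e s) \<in> unit_sets" for s using cell_unit_sets cyc_less[OF e] by blast
  define x where "x j n = real q * measure lebesgue (cell q (e (j + n)) \<inter> B n)" for j n
  have x0: "x j n \<ge> 0" for j n by (simp add: x_def)
  have mono: "B (n + k) \<subseteq> B n" if "n \<ge> 1" for n k
  proof (induction k)
    case (Suc k)
    then show ?case using decr[of "n + k"] that by (simp add: subset_trans)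
  qed simp
  have "\<exists>m. C \<le> (\<Sum>n<m. x j (n + N))" for j
  proof (rule ccontr)
    assume "\<nexists>m. C \<le> (\<Sum>n<m. x j (n + N))"
    then have "summable (\<lambda>n. x j (n + N))"
      using x0 by (intro summableI_nonneg_bounded[where x = C]) (auto simp: not_le intro: less_imp_le)
    then have "summable (\<lambda>n. \<Sum>i<q. x j (n + i + N))"
      by (intro summable_sum) (metis (no_types, lifting) summable_iff_shift[of "\<lambda>n. x j (n + N)"])
    moreover have "norm (real q * measure lebesgue (B (n + (N + q)))) \<le> (\<Sum>i<q. x j (n + i + N))" for n
    proof -
      have Bm: "B (n + (N + q)) \<in> unit_sets" using meas N by simp
      have "measure lebesgue (B (n + (N + q))) = (\<Sum>a<q. measure lebesgue (B (n + (N + q)) \<inter> cell q a))"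
        by (rule measure_unit_eq_sum_cells[OF Bm q])
      also have "\<dots> = (\<Sum>i<q. measure lebesgue (B (n + (N + q)) \<inter> cell q (e (j + n + N + i))))"
        using cyc_shift_bij[OF e, of "j + n + N"] by (rule sum.reindex_bij_betw[symmetric])
      also have "\<dots> \<le> (\<Sum>i<q. measure lebesgue (cell q (e (j + n + N + i)) \<inter> B (n + i + N)))"
      proof (rule sum_mono)
        fix i assume "i \<in> {..<q}"
        then have "B (n + (N + q)) \<subseteq> B (n + i + N)"
          using mono[of "n + i + N" "q - i"] N by (simp add: ac_simps)
        then show "measure lebesgue (B (n + (N + q)) \<inter> cell q (e (j + n + N + i))) \<le>
            measure lebesgue (cell q (e (j + n + N + i)) \<inter> B (n + i + N))"
          using meas N by (intro measure_unit_mono sets.Int Bm c) auto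
      qed
      finally show ?thesis using q by (simp add: x_def sum_distrib_left[symmetric] ac_simps)
    qed
    ultimately have "summable (\<lambda>n. real q * measure lebesgue (B (n + (N + q))))"
      by (rule summable_comparison_test'[where N = 0])
    then have "summable (\<lambda>n. measure lebesgue (B (n + (N + q))))"
      using q by (simp add: summable_cmult_iff)
    then have "summable (\<lambda>n. measure lebesgue (B n))" by (subst (asm) summable_iff_shift)
    then show False using diverge summable_iff_shift[of "\<lambda>n. measure lebesgue (B n)" 1] by simp
  qed
  then obtain m where m: "\<And>j. C \<le> (\<Sum>n<m j. x j (n + N))" by metis
  \<comment> \<open>Only \<open>j mod q\<close> matters, so finitely many lengths \<open>m j\<close>
    have to be dominated.\<close>
  define k where "k = (\<Sum>j<q. m j)"
  have "C \<le> (\<Sum>n=N..N + k. x j n)" for j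
  proof -
    let ?j = "j mod q"
    have "m ?j \<le> k" unfolding k_def using q by (intro member_le_sum) auto
    have "C \<le> (\<Sum>n<m ?j. x ?j (n + N))" by (rule m)
    also have "\<dots> \<le> (\<Sum>n\<le>k. x ?j (n + N))"
      using \<open>m ?j \<le> k\<close> x0 by (intro sum_mono2) auto
    also have "\<dots> = (\<Sum>n=N..N + k. x ?j n)"
      using sum.shift_bounds_cl_nat_ivl[of "x ?j" 0 N k] by (simp add: add.commute atLeast0AtMost)
    also have "\<dots> = (\<Sum>n=N..N + k. x j n)"
    proof (intro sum.cong refl)
      fix n
      have "e (j mod q + n) = e (j + n)"
        using cyc_mod[OF e, of "j mod q + n"] cyc_mod[OF e, of "j + n"] by (simp add: mod_simps)
      then show "x ?j n = x j n" by (simp add: x_def)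
    qed
    finally show ?thesis .
  qed
  then show ?thesis unfolding x_def by (intro exI[of _ "N + k"]) auto
qed

text \<open>On a window of times with large total density the sets \<open>B n\<close> are replaced
  by unions of subcells, so that hitting them becomes a property of words. The deficit is
  \<open>\<epsilon> / 2\<close> for start times without a hit and \<open>\<epsilon> / 4\<close> for
  the parts of hit cells that stick out of \<open>B n\<close>.\<close>

lemma hits_refinement:
  assumes e: "cyc q e"
    and meas: "\<And>n. n \<ge> 1 \<Longrightarrow> B n \<in> unit_sets"
    and decr: "\<And>n. n \<ge> 1 \<Longrightarrow> B (Suc n) \<subseteq> B n"
    and diverge: "\<not> summable (\<lambda>n. measure lebesgue (B (Suc n)))"
    and N: "N \<ge> 1" and \<epsilon>: "\<epsilon> > 0"
  shows "\<exists>q' e' M. cyc q' e' \<and> refines q e q' e' \<and> q < q' \<and> hits B N M \<epsilon> q' e'"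
proof -
  have q: "q > 0" using e by (simp add: cyc_def)
  have c: "cell q (e s) \<in> unit_sets" for s using cell_unit_sets cyc_less[OF e] by blast
  \<comment> \<open>Makes exp (- C) equal to \<open>\<epsilon> / 4\<close>;
    \<open>hitting_word\<close> doubles this to \<open>\<epsilon> / 2\<close>.\<close>
  define C where "C = - ln (\<epsilon> / 4)"
  have C: "exp (- C) \<le> \<epsilon> / 4" using \<epsilon> by (simp add: C_def)
  \<comment> \<open>The surplus 1 over \<open>C\<close> pays for replacing each \<open>B n\<close>
    by a union of subcells.\<close>
  obtain M where M: "M \<ge> N"
    and large: "\<And>j. C + 1 \<le> (\<Sum>n=N..M. real q * measure lebesgue (cell q (e (j + n)) \<inter> B n))"
    using level_sums_diverge[OF e meas decr diverge N, of "C + 1"] by blast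
  \<comment> \<open>Two requirements at once: M + 1 density losses of \<open>real q * \<eta>\<close>
    sum to at most 1, and M + 1 measure losses of \<open>\<eta>\<close> sum to at most
    \<open>\<epsilon> / 4\<close>.\<close>
  define \<eta> where "\<eta> = min 1 (\<epsilon> / 4) / (real q * real (M + 1))"
  have \<eta>: "\<eta> > 0" using \<epsilon> q by (simp add: \<eta>_def)
  have \<eta>1: "real (M + 1) * (real q * \<eta>) = min 1 (\<epsilon> / 4)"
    using q by (simp add: \<eta>_def del: of_nat_add)
  have "real (M + 1) * \<eta> \<le> real (M + 1) * (real q * \<eta>)"
    using q \<eta> by (intro mult_left_mono) auto
  then have \<eta>2: "real (M + 1) * \<eta> \<le> \<epsilon> / 4" using \<eta>1 by linarith
  have "\<exists>q0. n \<in> {N..M} \<longrightarrow> (\<forall>q\<ge>q0. \<exists>S\<subseteq>{..<q}. sdm (B n) (\<Union>a\<in>S. cell q a) < \<eta>)" for n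
    using cell_approximation[OF meas \<eta>, of n] N by auto
  then obtain q0 where q0: "\<And>n q. n \<in> {N..M} \<Longrightarrow> q \<ge> q0 n \<Longrightarrow> \<exists>S\<subseteq>{..<q}. sdm (B n) (\<Union>a\<in>S. cell q a) < \<eta>"
    by metis
  \<comment> \<open>The sum makes \<open>q * L\<close> fine enough for all \<open>B n\<close> of the
    window, and the summand 2 makes the new cycle strictly longer.\<close>
  define L where "L = 2 + (\<Sum>n\<le>M. q0 n)"
  have L: "L > 0" by (simp add: L_def)
  have "\<exists>S. n \<in> {N..M} \<longrightarrow> S \<subseteq> {..<q * L} \<and> sdm (B n) (\<Union>a\<in>S. cell (q * L) a) < \<eta>" for n
  proof (cases "n \<in> {N..M}")
    case True
    have "q0 n \<le> (\<Sum>n\<le>M. q0 n)" using True by (intro member_le_sum) auto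
    also have "\<dots> \<le> 1 * L" by (simp add: L_def)
    also have "\<dots> \<le> q * L" using q by (intro mult_right_mono) auto
    finally show ?thesis using q0[OF True] by blast
  qed blast
  then obtain S where S: "\<And>n. n \<in> {N..M} \<Longrightarrow> S n \<subseteq> {..<q * L}"
    and Sd: "\<And>n. n \<in> {N..M} \<Longrightarrow> sdm (B n) (\<Union>a\<in>S n. cell (q * L) a) < \<eta>" by metis
  have dense: "(\<Sum>n=N..M. real (card {d. d < L \<and> e (j + n) * L + d \<in> S n}) / real L) \<ge> C" for j
  proof -
    have "real q * measure lebesgue (cell q (e (j + n)) \<inter> B n) - real q * \<eta> \<le>
        real (card {d. d < L \<and> e (j + n) * L + d \<in> S n}) / real L" if n: "n \<in> {N..M}" for n
    proof -
      let ?c = "e (j + n)"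
      let ?U = "\<Union>a\<in>S n. cell (q * L) a"
      let ?S = "{a \<in> S n. a div L = ?c}"
      have Bn: "B n \<in> unit_sets" and U: "?U \<in> unit_sets"
        using meas N n UN_cell_unit_sets[OF S[OF n]] by auto
      have "?S = (\<lambda>d. ?c * L + d) ` {d. d < L \<and> ?c * L + d \<in> S n}"
      proof (intro equalityI subsetI)
        fix a assume a: "a \<in> ?S"
        then have "a = ?c * L + a mod L" using div_mult_mod_eq[of a L] by simp
        moreover have "a mod L < L" using L by simp
        ultimately show "a \<in> (\<lambda>d. ?c * L + d) ` {d. d < L \<and> ?c * L + d \<in> S n}"
          using a by (intro image_eqI[of _ _ "a mod L"]) auto
      qed auto
      then have card: "card ?S = card {d. d < L \<and> ?c * L + d \<in> S n}"
        by (simp add: card_image inj_on_def)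
      have "cell q ?c \<inter> ?U \<subseteq> (\<Union>a\<in>?S. cell (q * L) a)"
      proof
        fix x assume "x \<in> cell q ?c \<inter> ?U"
        then obtain a where a: "a \<in> S n" "x \<in> cell (q * L) a" "x \<in> cell q ?c" by auto
        then have "x \<in> cell q (a div L)" using cell_mult_subset[OF q L] by blast
        then have "a div L = ?c" using a cell_disjoint[of "a div L" ?c q] by blast
        then show "x \<in> (\<Union>a\<in>?S. cell (q * L) a)" using a by auto
      qed
      then have "measure lebesgue (cell q ?c \<inter> ?U) \<le> measure lebesgue (\<Union>a\<in>?S. cell (q * L) a)"
        using S[OF n] by (intro measure_unit_mono sets.Int c U UN_cell_unit_sets) auto
      also have "\<dots> = real (card ?S) / real (q * L)"
        using S[OF n] q L by (intro measure_UN_cell) auto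
      finally have 1: "measure lebesgue (cell q ?c \<inter> ?U) \<le> real (card ?S) / real (q * L)" .
      have "measure lebesgue (cell q ?c \<inter> B n) \<le> measure lebesgue ((cell q ?c \<inter> ?U) \<union> (B n - ?U))"
        by (intro measure_unit_mono sets.Int unit_sets_Un sets.Diff c U Bn) auto
      also have "\<dots> \<le> measure lebesgue (cell q ?c \<inter> ?U) + measure lebesgue (B n - ?U)"
        by (intro measure_unit_Un_le sets.Int sets.Diff c U Bn)
      also have "measure lebesgue (B n - ?U) \<le> \<eta>"
        using measure_Diff_le_sdm[OF Bn U] Sd[OF n] by linarith
      finally have "measure lebesgue (cell q ?c \<inter> B n) \<le> real (card ?S) / real (q * L) + \<eta>"
        using 1 by linarith
      then have "real q * measure lebesgue (cell q ?c \<inter> B n) \<le> real q * (real (card ?S) / real (q * L) + \<eta>)"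
        by (intro mult_left_mono) auto
      also have "\<dots> = real (card ?S) / real L + real q * \<eta>" using q by (simp add: distrib_left)
      finally show ?thesis unfolding card by simp
    qed
    then have "(\<Sum>n=N..M. real q * measure lebesgue (cell q (e (j + n)) \<inter> B n) - real q * \<eta>) \<le>
        (\<Sum>n=N..M. real (card {d. d < L \<and> e (j + n) * L + d \<in> S n}) / real L)"
      by (intro sum_mono) auto
    moreover have "real (card {N..M}) * (real q * \<eta>) \<le> real (M + 1) * (real q * \<eta>)"
      using \<eta> by (intro mult_right_mono of_nat_mono) auto
    then have "real (card {N..M}) * (real q * \<eta>) \<le> 1" using \<eta>1 by linarith
    ultimately show ?thesis using large[of j] by (simp add: sum_subtractf)
  qed
  obtain l W where l: "l > 0" and W: "\<And>t. t < q * L * l \<Longrightarrow> W t < q * L" "\<And>t. t < q * L * l \<Longrightarrow> W t div L = e t"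
    and fib: "\<And>b. b < q * L \<Longrightarrow> card {t. t < q * L * l \<and> W t = b} \<le> l"
    and bad: "real (card {t. t < q * L * l \<and> \<not> (\<exists>n\<in>{N..M}. t + n < q * L * l \<and> W (t + n) \<in> S n)}) \<le> 2 * (\<epsilon> / 4) * real (q * L * l)"
    using hitting_word[where S = S, OF e L _ C dense] \<epsilon> by auto
  define q' where "q' = q * L * l"
  obtain e' where e': "cyc q' e'" "refines q e q' e'" "\<And>t. t < q' \<Longrightarrow> e' t div l = W t"
    using cyc_of_word[OF e L l W fib] unfolding q'_def by blast
  have q': "q' > 0" "q < q'"
  proof -
    show "q' > 0" using q L l by (simp add: q'_def)
    have "q * 2 \<le> q * (L * l)" using l by (intro mult_left_mono) (auto simp: L_def Suc_le_eq)
    then show "q < q'" using q by (simp add: q'_def mult.assoc)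
  qed
  have c': "cell q' (e' s) \<in> unit_sets" for s using cell_unit_sets cyc_less[OF e'(1)] by blast
  \<comment> \<open>The demand \<open>t + n < q'\<close> keeps the hit within one period: for fixed
    \<open>n\<close>, different start times then lead to different cells.\<close>
  define hit where "hit t n \<longleftrightarrow> n \<in> {N..M} \<and> t + n < q' \<and> W (t + n) \<in> S n" for t n
  \<comment> \<open>Start times without a hit get the default \<open>N\<close>, since
    \<open>hits\<close> wants \<open>f t\<close> in the window for every \<open>t\<close>.\<close>
  define f where "f t = (if \<exists>n. hit t n then SOME n. hit t n else N)" for t
  define G where "G = {t. t < q' \<and> (\<exists>n. hit t n)}"
  have fG: "hit t (f t)" if "t \<in> G" for t using that someI_ex[of "hit t"] by (auto simp: f_def G_def)
  have fNM: "N \<le> f t \<and> f t \<le> M" for t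
    using someI_ex[of "hit t"] M by (auto simp: f_def hit_def)
  have finG: "finite G" by (simp add: G_def)
  have cardG: "(1 - \<epsilon> / 2) * real q' \<le> real (card G)"
  proof -
    have "{..<q'} - G = {t. t < q * L * l \<and> \<not> (\<exists>n\<in>{N..M}. t + n < q * L * l \<and> W (t + n) \<in> S n)}"
      by (auto simp: G_def hit_def q'_def)
    then have "real (card ({..<q'} - G)) \<le> \<epsilon> / 2 * real q'" using bad by (simp add: q'_def)
    moreover have "card ({..<q'} - G) = q' - card G"
      by (subst card_Diff_subset) (auto simp: G_def)
    moreover have "card G \<le> q'" using card_mono[of "{..<q'}" G] by (auto simp: G_def)
    ultimately show ?thesis by (simp add: of_nat_diff algebra_simps)
  qed
  \<comment> \<open>For fixed \<open>n\<close> the cells that are hit are disjoint subsets of the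
    union approximating \<open>B n\<close>. All of them together lose only the approximation error,
    not once per cell.\<close>
  have loss: "(\<Sum>t\<in>{t \<in> G. f t = n}. measure lebesgue (cell q' (e' (t + f t)) - B (f t))) \<le> \<eta>" if n: "n \<in> {N..M}" for n
  proof -
    let ?G = "{t \<in> G. f t = n}"
    let ?U = "\<Union>a\<in>S n. cell (q * L) a"
    have Bn: "B n \<in> unit_sets" and U: "?U \<in> unit_sets"
      using meas N n UN_cell_unit_sets[OF S[OF n]] by auto
    have less: "t + n < q'" and mem: "W (t + n) \<in> S n" if "t \<in> ?G" for t using fG[of t] that by (auto simp: hit_def)
    have "(\<Sum>t\<in>?G. measure lebesgue (cell q' (e' (t + f t)) - B (f t))) = (\<Sum>t\<in>?G. measure lebesgue (cell q' (e' (t + n)) - B n))"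
      by (intro sum.cong) auto
    also have "\<dots> = measure lebesgue (\<Union>t\<in>?G. cell q' (e' (t + n)) - B n)"
    proof (rule measure_UN_disjoint_unit[symmetric])
      show "disjoint_family_on (\<lambda>t. cell q' (e' (t + n)) - B n) ?G"
        unfolding disjoint_family_on_def
      proof (intro ballI impI)
        fix s t assume st: "s \<in> ?G" "t \<in> ?G" "s \<noteq> t"
        have "inj_on e' {..<q'}" using e'(1) by (simp add: cyc_def bij_betw_def)
        then have "e' (s + n) \<noteq> e' (t + n)" using st less by (simp add: inj_on_eq_iff)
        then show "(cell q' (e' (s + n)) - B n) \<inter> (cell q' (e' (t + n)) - B n) = {}"
          using cell_disjoint by blast
      qed
    qed (use finG c' Bn in auto)
    also have "\<dots> \<le> measure lebesgue (?U - B n)"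
    proof (intro measure_unit_mono sets.Diff U Bn sets.finite_UN)
      show "(\<Union>t\<in>?G. cell q' (e' (t + n)) - B n) \<subseteq> ?U - B n"
      proof (intro UN_least Diff_mono order_refl)
        fix t assume t: "t \<in> ?G"
        have "cell q' (e' (t + n)) \<subseteq> cell (q * L) (e' (t + n) div l)"
          unfolding q'_def using q L l by (intro cell_mult_subset) auto
        also have "e' (t + n) div l = W (t + n)" using e'(3) less[OF t] by simp
        finally show "cell q' (e' (t + n)) \<subseteq> ?U" using mem[OF t] by blast
      qed
    qed (use finG c' Bn in auto)
    also have "\<dots> \<le> sdm ?U (B n)" by (rule measure_Diff_le_sdm[OF U Bn])
    also have "\<dots> \<le> \<eta>" unfolding sdm_commute[of ?U] using Sd[OF n] by simp
    finally show ?thesis .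
  qed
  have "(\<Sum>t\<in>G. measure lebesgue (cell q' (e' (t + f t)) - B (f t))) =
      (\<Sum>n=N..M. \<Sum>t\<in>{t \<in> G. f t = n}. measure lebesgue (cell q' (e' (t + f t)) - B (f t)))"
    using finG fNM by (intro sum.group[symmetric]) auto
  also have "\<dots> \<le> (\<Sum>n=N..M. \<eta>)" by (intro sum_mono loss)
  also have "\<dots> = real (card {N..M}) * \<eta>" by simp
  also have "\<dots> \<le> real (M + 1) * \<eta>" using \<eta> by (intro mult_right_mono of_nat_mono) auto
  finally have total: "(\<Sum>t\<in>G. measure lebesgue (cell q' (e' (t + f t)) - B (f t))) \<le> \<epsilon> / 4" using \<eta>2 by linarith
  have "1 - \<epsilon> / 2 \<le> real (card G) / real q'" using cardG q' by (simp add: field_simps)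
  also have "\<dots> = (\<Sum>t\<in>G. measure lebesgue (cell q' (e' (t + f t))))" using q' by (simp add: measure_cell)
  also have "\<dots> = (\<Sum>t\<in>G. measure lebesgue (cell q' (e' (t + f t)) \<inter> B (f t)) + measure lebesgue (cell q' (e' (t + f t)) - B (f t)))"
  proof (rule sum.cong[OF refl])
    fix t
    have "B (f t) \<in> unit_sets" using meas fNM[of t] N by simp
    then show "measure lebesgue (cell q' (e' (t + f t))) = measure lebesgue (cell q' (e' (t + f t)) \<inter> B (f t)) + measure lebesgue (cell q' (e' (t + f t)) - B (f t))"
      by (intro measure_unit_Diff_Int c')
  qed
  also have "\<dots> \<le> (\<Sum>t\<in>G. measure lebesgue (cell q' (e' (t + f t)) \<inter> B (f t))) + \<epsilon> / 4"
    using total by (simp add: sum.distrib)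
  also have "(\<Sum>t\<in>G. measure lebesgue (cell q' (e' (t + f t)) \<inter> B (f t))) \<le> (\<Sum>t<q'. measure lebesgue (cell q' (e' (t + f t)) \<inter> B (f t)))"
    by (intro sum_mono2) (auto simp: G_def)
  finally have "1 - \<epsilon> \<le> (\<Sum>t<q'. measure lebesgue (cell q' (e' (t + f t)) \<inter> B (f t)))" using \<epsilon> by linarith
  then have "hits B N M \<epsilon> q' e'" unfolding hits_def using fNM by blast
  then show ?thesis using e' q' by blast
qed

subsection \<open>Weak density of cyclic permutations\<close>

lemma permutation_with_transitions:
  fixes c :: "nat \<Rightarrow> nat \<Rightarrow> nat"
  assumes row: "\<And>a. a < r \<Longrightarrow> (\<Sum>b<r. c a b) \<le> l" and col: "\<And>b. b < r \<Longrightarrow> (\<Sum>a<r. c a b) \<le> l"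
  shows "\<exists>P. bij_betw P {..<r * l} {..<r * l} \<and>
    (\<forall>a<r. \<forall>b<r. c a b \<le> card {x. x < r * l \<and> x div l = a \<and> P x div l = b})"
proof -
  define Z where "Z = (SIGMA p:{..<r} \<times> {..<r}. {..<c (fst p) (snd p)})"
  have Z: "finite Z" by (auto simp: Z_def)
  have "card {z \<in> Z. fst (fst z) = a} \<le> l" if "a < r" for a
  proof -
    have "{z \<in> Z. fst (fst z) = a} = (SIGMA p:{a} \<times> {..<r}. {..<c (fst p) (snd p)})"
      using that by (auto simp: Z_def)
    then have "card {z \<in> Z. fst (fst z) = a} = (\<Sum>p\<in>{a} \<times> {..<r}. c (fst p) (snd p))"
      by (simp add: card_SigmaI)
    also have "\<dots> = (\<Sum>b<r. c a b)" by (simp add: sum.cartesian_product')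
    finally show ?thesis using row[OF that] by simp
  qed
  then have "\<exists>s. inj_on s Z \<and> (\<forall>z\<in>Z. s z < r * l \<and> s z div l = fst (fst z))"
    using Z by (intro injection_with_quotient) (auto simp: Z_def)
  then obtain s where s: "inj_on s Z" "\<And>z. z \<in> Z \<Longrightarrow> s z < r * l" "\<And>z. z \<in> Z \<Longrightarrow> s z div l = fst (fst z)"
    by blast
  have "card {z \<in> Z. snd (fst z) = b} \<le> l" if "b < r" for b
  proof -
    have "{z \<in> Z. snd (fst z) = b} = (SIGMA p:{..<r} \<times> {b}. {..<c (fst p) (snd p)})"
      using that by (auto simp: Z_def)
    then have "card {z \<in> Z. snd (fst z) = b} = (\<Sum>p\<in>{..<r} \<times> {b}. c (fst p) (snd p))"
      by (simp add: card_SigmaI)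
    also have "\<dots> = (\<Sum>a<r. c a b)" by (simp add: sum.cartesian_product')
    finally show ?thesis using col[OF that] by simp
  qed
  then have "\<exists>u. inj_on u Z \<and> (\<forall>z\<in>Z. u z < r * l \<and> u z div l = snd (fst z))"
    using Z by (intro injection_with_quotient) (auto simp: Z_def)
  then obtain u where u: "inj_on u Z" "\<And>z. z \<in> Z \<Longrightarrow> u z < r * l" "\<And>z. z \<in> Z \<Longrightarrow> u z div l = snd (fst z)"
    by blast
  let ?X = "{..<r * l}"
  have sub: "s ` Z \<subseteq> ?X" "u ` Z \<subseteq> ?X" using s u by auto
  have "card (?X - s ` Z) = card (?X - u ` Z)"
    using sub Z s(1) u(1) by (simp add: card_Diff_subset card_image)
  then obtain h where h: "bij_betw h (?X - s ` Z) (?X - u ` Z)"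
    using finite_same_card_bij[of "?X - s ` Z" "?X - u ` Z"] by auto
  define P where "P x = (if x \<in> s ` Z then u (the_inv_into Z s x) else h x)" for x
  have Ps: "P (s z) = u z" if "z \<in> Z" for z using that s(1) by (simp add: P_def the_inv_into_f_f)
  have "bij_betw P (s ` Z) (u ` Z)"
  proof (rule bij_betw_imageI)
    show "inj_on P (s ` Z)" using Ps s(1) u(1) by (auto simp: inj_on_def)
    show "P ` s ` Z = u ` Z" using Ps by (force simp: image_image)
  qed
  moreover have "bij_betw P (?X - s ` Z) (?X - u ` Z)"
    using h by (subst bij_betw_cong[of _ P h]) (auto simp: P_def)
  ultimately have "bij_betw P (s ` Z \<union> (?X - s ` Z)) (u ` Z \<union> (?X - u ` Z))"
    by (intro bij_betw_combine) auto
  then have P: "bij_betw P ?X ?X" using sub by (simp add: Un_absorb1)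
  have "c a b \<le> card {x. x < r * l \<and> x div l = a \<and> P x div l = b}" if ab: "a < r" "b < r" for a b
  proof -
    have sub: "(\<lambda>i. s ((a, b), i)) ` {..<c a b} \<subseteq> {x. x < r * l \<and> x div l = a \<and> P x div l = b}"
    proof clarsimp
      fix i assume "i < c a b"
      then have "((a, b), i) \<in> Z" using ab by (simp add: Z_def)
      then show "s ((a, b), i) < r * l \<and> s ((a, b), i) div l = a \<and> P (s ((a, b), i)) div l = b"
        using s u Ps by simp
    qed
    have "inj_on (\<lambda>i. s ((a, b), i)) {..<c a b}"
      using s(1) ab by (auto simp: inj_on_def Z_def)
    then have "c a b = card ((\<lambda>i. s ((a, b), i)) ` {..<c a b})" by (simp add: card_image)
    also have "\<dots> \<le> card {x. x < r * l \<and> x div l = a \<and> P x div l = b}"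
      by (intro card_mono sub) auto
    finally show ?thesis .
  qed
  then show ?thesis using P by blast
qed

text \<open>Concatenating the orbit segments of length \<open>T\<close> of all letters visits every letter
  \<open>T\<close> times and violates \<open>P\<close> only at the \<open>n\<close> joints.\<close>
lemma cyc_of_permutation:
  assumes P: "bij_betw P {..<n} {..<n}" and n: "n > 0" and T: "T > 0"
  shows "\<exists>e. cyc (n * T) e \<and> (\<forall>X\<subseteq>{..<n}. (T - 1) * card X \<le>
    card {t. Suc t < n * T \<and> e t div T \<in> X \<and> e (Suc t) div T = P (e t div T)})"
proof -
  have Pj: "bij_betw (P ^^ j) {..<n} {..<n}" for j by (rule bij_betw_funpow[OF P])
  have count: "card {i. i < n \<and> (P ^^ j) i \<in> X} = card X" if "X \<subseteq> {..<n}" for j X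
  proof -
    have "bij_betw (P ^^ j) {i. i < n \<and> (P ^^ j) i \<in> X} X"
      using Pj[of j] that unfolding bij_betw_def inj_on_def by (auto 0 3)
    then show ?thesis by (rule bij_betw_same_card)
  qed
  define W where "W t = (P ^^ (t mod T)) (t div T)" for t
  have Wn: "W t < n" if "t < n * T" for t
    using bij_betwE[OF Pj[of "t mod T"]] that by (simp add: W_def less_mult_imp_div_less)
  have fib: "card {t. t < 1 * n * T \<and> W t = b} \<le> T" if "b < 1 * n" for b
  proof -
    have "card {t. t < T * n \<and> (P ^^ (t mod T)) (t div T) \<in> {b}} = (\<Sum>j<T. card {i. i < n \<and> (P ^^ j) i \<in> {b}})"
      by (rule card_div_mod[OF T])
    also have "\<dots> = (\<Sum>j<T. 1)" using count[of "{b}"] that by (intro sum.cong) auto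
    finally show ?thesis by (simp add: W_def mult.commute)
  qed
  \<comment> \<open>The one-cell cycle imposes no condition on the word, so
    \<open>cyc_of_word\<close> merely turns the word into a cycle.\<close>
  have c1: "cyc 1 (\<lambda>_. 0)" by (simp add: cyc_def bij_betw_def lessThan_Suc)
  obtain e where e: "cyc (1 * n * T) e" "\<forall>t<1 * n * T. e t div T = W t"
    using cyc_of_word[OF c1 n T, of W] Wn fib by auto
  have "(T - 1) * card X \<le> card {t. Suc t < n * T \<and> e t div T \<in> X \<and> e (Suc t) div T = P (e t div T)}"
    if X: "X \<subseteq> {..<n}" for X
  proof -
    have "(T - 1) * card X = (\<Sum>j<T. if Suc j < T then card X else 0)"
    proof -
      have "{j. j < T \<and> Suc j < T} = {..<T - 1}" by auto
      then show ?thesis by (simp add: sum.If_cases Int_def)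
    qed
    also have "\<dots> = (\<Sum>j<T. card {i. i < n \<and> (Suc j < T \<and> (P ^^ j) i \<in> X)})"
      using count[OF X] by (intro sum.cong) auto
    also have "\<dots> = card {t. t < T * n \<and> (Suc (t mod T) < T \<and> (P ^^ (t mod T)) (t div T) \<in> X)}"
      by (rule card_div_mod[OF T, symmetric])
    also have "\<dots> \<le> card {t. Suc t < n * T \<and> e t div T \<in> X \<and> e (Suc t) div T = P (e t div T)}"
    proof (rule card_mono)
      show "finite {t. Suc t < n * T \<and> e t div T \<in> X \<and> e (Suc t) div T = P (e t div T)}"
        by (rule finite_subset[of _ "{..<n * T}"]) auto
      show "{t. t < T * n \<and> (Suc (t mod T) < T \<and> (P ^^ (t mod T)) (t div T) \<in> X)} \<subseteq>
          {t. Suc t < n * T \<and> e t div T \<in> X \<and> e (Suc t) div T = P (e t div T)}"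
      proof clarsimp
        fix t assume t: "t < T * n" "Suc (t mod T) < T" "(P ^^ (t mod T)) (t div T) \<in> X"
        have sm: "Suc t mod T = Suc (t mod T)" using t(2) by (simp add: mod_Suc)
        have sd: "Suc t div T = t div T" using t(2) by (simp add: div_Suc sm)
        have "t div T < n" using t(1) by (simp add: less_mult_imp_div_less mult.commute)
        then have lt: "Suc t < n * T" using sd T by (metis div_less_iff_less_mult)
        have "W (Suc t) = P (W t)" by (simp add: W_def sm sd)
        then show "Suc t < n * T \<and> e t div T \<in> X \<and> e (Suc t) div T = P (e t div T)"
          using lt e(2) t(3) by (simp add: W_def)
      qed
    qed
    finally show ?thesis .
  qed
  then show ?thesis using e by auto
qed

lemma measure_image_UN_cells:
  assumes \<rho>: "\<rho> \<in> MPT" and S: "S \<subseteq> {..<r}" and S': "S' \<subseteq> {..<r}"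
  shows "measure lebesgue (\<rho> ` (\<Union>a\<in>S. cell r a) \<inter> (\<Union>b\<in>S'. cell r b)) =
    (\<Sum>a\<in>S. \<Sum>b\<in>S'. measure lebesgue (\<rho> ` cell r a \<inter> cell r b))"
proof -
  let ?F = "\<lambda>p. \<rho> ` cell r (fst p) \<inter> cell r (snd p)"
  have fin: "finite S" "finite S'" using S S' finite_subset by blast+
  have "\<rho> ` (\<Union>a\<in>S. cell r a) \<inter> (\<Union>b\<in>S'. cell r b) = (\<Union>p\<in>S \<times> S'. ?F p)" by (fastforce simp: image_UN)
  also have "measure lebesgue \<dots> = (\<Sum>p\<in>S \<times> S'. measure lebesgue (?F p))"
  proof (rule measure_UN_disjoint_unit)
    show "disjoint_family_on ?F (S \<times> S')"
      unfolding disjoint_family_on_def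
    proof (intro ballI impI)
      fix p p' assume p: "p \<in> S \<times> S'" "p' \<in> S \<times> S'" "p \<noteq> p'"
      show "?F p \<inter> ?F p' = {}"
      proof (cases "fst p = fst p'")
        case True
        then have "snd p \<noteq> snd p'" using p by (auto simp: prod_eq_iff)
        then show ?thesis using cell_disjoint by blast
      next
        case False
        have "\<rho> ` cell r (fst p) \<inter> \<rho> ` cell r (fst p') = \<rho> ` (cell r (fst p) \<inter> cell r (fst p'))"
        proof (rule MPT_image_Int[OF \<rho>, symmetric])
          have "fst p < r" "fst p' < r" using p S by auto
          then show "cell r (fst p) \<subseteq> {0..1}" "cell r (fst p') \<subseteq> {0..1}"
            using cell_unit_sets unit_sets_iff by blast+
        qed
        also have "\<dots> = {}" using cell_disjoint[OF False] by simp
        finally show ?thesis by blast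
      qed
    qed
  next
    fix p assume "p \<in> S \<times> S'"
    then have "fst p < r" "snd p < r" using S S' by auto
    then show "?F p \<in> unit_sets" by (intro sets.Int MPT_image[OF \<rho>] cell_unit_sets)
  qed (use fin in simp)
  finally show ?thesis by (simp add: sum.cartesian_product split_def)
qed

text \<open>Both images have the measure of \<open>A\<close>, so the symmetric difference is twice
  what the overlap lacks; a lower bound on the overlap, hence on the transitions of
  \<open>\<sigma>\<close>, suffices. Passing from \<open>A\<close> and its image to unions of cells
  costs \<open>2 * \<eta>\<close> in each direction, doubled to \<open>8 * \<eta>\<close>.\<close>

lemma sdm_image_le:
  assumes \<sigma>: "\<sigma> \<in> MPT" and \<tau>: "\<tau> \<in> MPT" and A: "A \<in> unit_sets"
    and S: "S \<subseteq> {..<r}" "sdm A (\<Union>a\<in>S. cell r a) \<le> \<eta>"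
    and S': "S' \<subseteq> {..<r}" "sdm (\<tau> ` A) (\<Union>b\<in>S'. cell r b) \<le> \<eta>"
    and trans: "\<And>a b. a < r \<Longrightarrow> b < r \<Longrightarrow>
      measure lebesgue (\<tau> ` cell r a \<inter> cell r b) - \<kappa> \<le> measure lebesgue (\<sigma> ` cell r a \<inter> cell r b)"
    and \<kappa>: "\<kappa> \<ge> 0"
  shows "sdm (\<sigma> ` A) (\<tau> ` A) \<le> 8 * \<eta> + 2 * (real r ^ 2 * \<kappa>)"
proof -
  let ?A' = "\<Union>a\<in>S. cell r a" and ?C = "\<Union>b\<in>S'. cell r b"
  let ?m = "measure lebesgue"
  have A': "?A' \<in> unit_sets" and C: "?C \<in> unit_sets" by (rule UN_cell_unit_sets S S')+
  note im = MPT_image(1)[OF \<sigma>] MPT_image(1)[OF \<tau>]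
  note ms = unit_sets_Un sets.Int sets.Diff im A A' C
  have fin: "card S \<le> r" "card S' \<le> r" using card_mono[OF _ S(1)] card_mono[OF _ S'(1)] by simp_all
  have dA: "?m (?A' - A) \<le> \<eta>" "?m (A - ?A') \<le> \<eta>"
    using measure_Diff_le_sdm[OF A' A] measure_Diff_le_sdm[OF A A'] S(2) unfolding sdm_commute[of ?A'] by linarith+
  have dC: "?m (?C - \<tau> ` A) \<le> \<eta>" "?m (\<tau> ` A - ?C) \<le> \<eta>"
    using measure_Diff_le_sdm[OF C im(2)[OF A]] measure_Diff_le_sdm[OF im(2)[OF A] C] S'(2)
    unfolding sdm_commute[of ?C] by linarith+
  have Un3: "?m (X \<union> Y \<union> Z) \<le> ?m X + ?m Y + ?m Z" if "X \<in> unit_sets" "Y \<in> unit_sets" "Z \<in> unit_sets" for X Y Z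
    using measure_unit_Un_le[OF unit_sets_Un[OF that(1,2)] that(3)] measure_unit_Un_le[OF that(1,2)] by linarith
  have "?m (\<tau> ` A) \<le> ?m ((\<tau> ` ?A' \<inter> ?C) \<union> \<tau> ` (A - ?A') \<union> (\<tau> ` A - ?C))"
    by (intro measure_unit_mono ms) auto
  also have "\<dots> \<le> ?m (\<tau> ` ?A' \<inter> ?C) + ?m (\<tau> ` (A - ?A')) + ?m (\<tau> ` A - ?C)"
    by (intro Un3 ms)
  also have "?m (\<tau> ` (A - ?A')) = ?m (A - ?A')" by (intro MPT_image(2)[OF \<tau>] ms)
  finally have 1: "?m (\<tau> ` A) \<le> ?m (\<tau> ` ?A' \<inter> ?C) + 2 * \<eta>" using dA dC by linarith
  have "?m (\<tau> ` ?A' \<inter> ?C) = (\<Sum>a\<in>S. \<Sum>b\<in>S'. ?m (\<tau> ` cell r a \<inter> cell r b))"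
    by (rule measure_image_UN_cells[OF \<tau> S(1) S'(1)])
  also have "\<dots> \<le> (\<Sum>a\<in>S. \<Sum>b\<in>S'. ?m (\<sigma> ` cell r a \<inter> cell r b) + \<kappa>)"
    using trans S(1) S'(1) by (intro sum_mono) (auto simp: algebra_simps subset_iff)
  also have "\<dots> = ?m (\<sigma> ` ?A' \<inter> ?C) + real (card S) * (real (card S') * \<kappa>)"
    by (simp add: sum.distrib measure_image_UN_cells[OF \<sigma> S(1) S'(1)])
  also have "real (card S) * (real (card S') * \<kappa>) \<le> real r * (real r * \<kappa>)"
    using fin \<kappa> by (intro mult_mono) auto
  finally have 2: "?m (\<tau> ` ?A' \<inter> ?C) \<le> ?m (\<sigma> ` ?A' \<inter> ?C) + real r ^ 2 * \<kappa>"
    by (simp add: power2_eq_square mult.assoc)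
  have "?m (\<sigma> ` ?A' \<inter> ?C) \<le> ?m ((\<sigma> ` A \<inter> \<tau> ` A) \<union> \<sigma> ` (?A' - A) \<union> (?C - \<tau> ` A))"
    by (intro measure_unit_mono ms) auto
  also have "\<dots> \<le> ?m (\<sigma> ` A \<inter> \<tau> ` A) + ?m (\<sigma> ` (?A' - A)) + ?m (?C - \<tau> ` A)"
    by (intro Un3 ms)
  also have "?m (\<sigma> ` (?A' - A)) = ?m (?A' - A)" by (intro MPT_image(2)[OF \<sigma>] ms)
  finally have 3: "?m (\<sigma> ` ?A' \<inter> ?C) \<le> ?m (\<sigma> ` A \<inter> \<tau> ` A) + 2 * \<eta>" using dA dC by linarith
  have "sdm (\<sigma> ` A) (\<tau> ` A) = 2 * (?m (\<tau> ` A) - ?m (\<sigma> ` A \<inter> \<tau> ` A))"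
    using sdm_eq_measure_Diff[OF im(1)[OF A] im(2)[OF A]] MPT_image(2)[OF \<sigma> A] MPT_image(2)[OF \<tau> A] by simp
  then show ?thesis using 1 2 3 by simp
qed

text \<open>At rank \<open>r\<close> the map \<open>\<tau>\<close> is seen only through the measures
  \<open>p a b\<close> of its transitions, a doubly stochastic matrix up to scale. Rounded down it
  is realised by a permutation of finer cells, whose orbits are joined into one cycle at small
  cost.\<close>

lemma cycles_weakly_dense:
  assumes \<tau>: "\<tau> \<in> MPT" and F: "finite F" "F \<subseteq> unit_sets" and \<epsilon>: "\<epsilon> > 0"
  shows "\<exists>q e. cyc q e \<and> (\<forall>\<sigma>\<in>MPT. (\<forall>t. sdm (\<sigma> ` cell q (e t)) (cell q (e (Suc t))) = 0) \<longrightarrow>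
    (\<forall>A\<in>F. sdm (\<sigma> ` A) (\<tau> ` A) < \<epsilon>))"
proof -
  \<comment> \<open>\<open>8 * \<eta>\<close> is \<open>\<epsilon> / 4\<close>; together with twice
    \<open>\<epsilon> / 16\<close> for the transitions this stays below
    \<open>\<epsilon>\<close>.\<close>
  define \<eta> where "\<eta> = \<epsilon> / 32"
  have \<eta>: "\<eta> > 0" using \<epsilon> by (simp add: \<eta>_def)
  have ev: "\<forall>\<^sub>F q in sequentially. \<exists>S\<subseteq>{..<q}. sdm A (\<Union>a\<in>S. cell q a) < \<eta>" if "A \<in> unit_sets" for A
    using cell_approximation[OF that \<eta>] by (simp add: eventually_sequentially)
  have "\<forall>\<^sub>F q in sequentially. \<forall>A\<in>F \<union> (`) \<tau> ` F. \<exists>S\<subseteq>{..<q}. sdm A (\<Union>a\<in>S. cell q a) < \<eta>"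
    using F ev MPT_image(1)[OF \<tau>] by (intro eventually_ball_finite) auto
  then have "\<forall>\<^sub>F q in sequentially. q > 0 \<and> (\<forall>A\<in>F \<union> (`) \<tau> ` F. \<exists>S\<subseteq>{..<q}. sdm A (\<Union>a\<in>S. cell q a) < \<eta>)"
    by (intro eventually_conj eventually_gt_at_top)
  then obtain r where r: "r > 0" and approx: "\<And>A. A \<in> F \<union> (`) \<tau> ` F \<Longrightarrow> \<exists>S\<subseteq>{..<r}. sdm A (\<Union>a\<in>S. cell r a) < \<eta>"
    by (auto simp: eventually_sequentially)
  define p where "p a b = measure lebesgue (\<tau> ` cell r a \<inter> cell r b)" for a b
  have p0: "p a b \<ge> 0" for a b by (simp add: p_def)
  have row: "(\<Sum>b<r. p a b) = 1 / real r" if a: "a < r" for a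
    using measure_unit_eq_sum_cells[OF MPT_image(1)[OF \<tau> cell_unit_sets[OF a]] r]
      MPT_image(2)[OF \<tau> cell_unit_sets[OF a]] r
    by (simp add: p_def measure_cell)
  have col: "(\<Sum>a<r. p a b) = 1 / real r" if b: "b < r" for b
  proof -
    let ?V = "\<tau> -` cell r b \<inter> {0..1}"
    have V: "?V \<in> unit_sets" by (rule MPT_vimage(1)[OF \<tau> cell_unit_sets[OF b]])
    have "p a b = measure lebesgue (?V \<inter> cell r a)" if a: "a < r" for a
    proof -
      have "\<tau> ` (cell r a \<inter> ?V) = \<tau> ` cell r a \<inter> cell r b"
        using MPT_image_Int[OF \<tau>, of "cell r a" ?V] MPT_image_vimage[OF \<tau>, of "cell r b"]
          cell_unit_sets[OF a] cell_unit_sets[OF b] by (simp add: unit_sets_iff)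
      then show ?thesis
        using MPT_image(2)[OF \<tau> sets.Int[OF cell_unit_sets[OF a] V]] by (simp add: p_def Int_commute)
    qed
    then have "(\<Sum>a<r. p a b) = (\<Sum>a<r. measure lebesgue (?V \<inter> cell r a))" by (intro sum.cong) auto
    also have "\<dots> = measure lebesgue ?V" by (rule measure_unit_eq_sum_cells[OF V r, symmetric])
    also have "\<dots> = 1 / real r" using MPT_vimage(2)[OF \<tau> cell_unit_sets[OF b]] r by (simp add: measure_cell)
    finally show ?thesis .
  qed
  \<comment> \<open>Chosen to make \<open>real r ^ 2 * \<kappa>\<close> at most
    \<open>\<epsilon> / 16\<close> for the \<open>\<kappa>\<close> below.\<close>
  obtain l :: nat where l: "32 * real r ^ 2 / \<epsilon> < real l" using reals_Archimedean2 by blast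
  have l0: "l > 0" using l \<epsilon> by (intro Nat.gr0I) (auto simp: field_simps mult_less_0_iff not_less)
  define n where "n = r * l"
  have n: "n > 0" using r l0 by (simp add: n_def)
  \<comment> \<open>The scaled rows and columns sum to exactly \<open>l\<close>; rounding down keeps
    them at most \<open>l\<close>, as the permutation requires.\<close>
  define c where "c a b = nat \<lfloor>real n * p a b\<rfloor>" for a b
  have c_le: "real (c a b) \<le> real n * p a b" and c_ge: "real n * p a b - 1 \<le> real (c a b)" for a b
    using p0[of a b] by (simp_all add: c_def)
  have "(\<Sum>b<r. c a b) \<le> l" if "a < r" for a
  proof -
    have "real (\<Sum>b<r. c a b) \<le> (\<Sum>b<r. real n * p a b)" by (simp add: sum_mono c_le)
    also have "\<dots> = real l" using row[OF that] r by (simp add: sum_distrib_left[symmetric] n_def)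
    finally show ?thesis by (simp only: of_nat_le_iff)
  qed
  moreover have "(\<Sum>a<r. c a b) \<le> l" if "b < r" for b
  proof -
    have "real (\<Sum>a<r. c a b) \<le> (\<Sum>a<r. real n * p a b)" by (simp add: sum_mono c_le)
    also have "\<dots> = real l" using col[OF that] r by (simp add: sum_distrib_left[symmetric] n_def)
    finally show ?thesis by (simp only: of_nat_le_iff)
  qed
  ultimately obtain P where P: "bij_betw P {..<n} {..<n}"
    and Pc: "\<And>a b. a < r \<Longrightarrow> b < r \<Longrightarrow> c a b \<le> card {x. x < n \<and> x div l = a \<and> P x div l = b}"
    using permutation_with_transitions[of r c l] unfolding n_def by blast
  \<comment> \<open>\<open>l\<close> is used again, now as the length of the orbit segments that are
    joined into a cycle. Hence two divisions by \<open>l\<close> lead from rank \<open>q\<close>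
    back to rank \<open>r\<close>.\<close>
  define q where "q = n * l"
  obtain e where e: "cyc q e" and trans: "\<And>X. X \<subseteq> {..<n} \<Longrightarrow> (l - 1) * card X \<le>
      card {t. Suc t < q \<and> e t div l \<in> X \<and> e (Suc t) div l = P (e t div l)}"
    using cyc_of_permutation[OF P n l0] unfolding q_def by blast
  have q: "q > 0" using e by (simp add: cyc_def)
  \<comment> \<open>One \<open>1 / real l\<close> for the joints of the orbit segments, one for the
    rounding, as 1 / n is at most 1 / l.\<close>
  define \<kappa> where "\<kappa> = 2 / real l"
  have "sdm (\<sigma> ` A) (\<tau> ` A) < \<epsilon>"
    if \<sigma>: "\<sigma> \<in> MPT" and follows: "\<And>t. sdm (\<sigma> ` cell q (e t)) (cell q (e (Suc t))) = 0" and A: "A \<in> F" for \<sigma> A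
  proof -
    have cq: "cell q (e s) \<in> unit_sets" for s using cell_unit_sets cyc_less[OF e] by blast
    have "p a b - \<kappa> \<le> measure lebesgue (\<sigma> ` cell r a \<inter> cell r b)" if ab: "a < r" "b < r" for a b
    proof -
      let ?X = "{x. x < n \<and> x div l = a \<and> P x div l = b}"
      let ?T = "{t. Suc t < q \<and> e t div l \<in> ?X \<and> e (Suc t) div l = P (e t div l)}"
      let ?D = "\<lambda>t. \<sigma> ` cell q (e t) \<inter> cell q (e (Suc t))"
      have finT: "finite ?T" by (rule finite_subset[of _ "{..<q}"]) auto
      have D: "?D t \<in> unit_sets" for t by (intro sets.Int MPT_image[OF \<sigma>] cq)
      have mD: "measure lebesgue (?D t) = 1 / real q" for t
        using sdm_eq_measure_Diff[OF MPT_image(1)[OF \<sigma> cq[of t]] cq[of "Suc t"]] follows[of t]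
          MPT_image(2)[OF \<sigma> cq[of t]] q by (simp add: measure_cell)
      have sub: "cell q s \<subseteq> cell r (s div l div l)" for s
        using cell_mult_subset[of "r * l" l s] cell_mult_subset[of r l "s div l"] r l0
        unfolding q_def n_def by simp
      have "(real l - 1) * (real n * p a b - 1) \<le> (real l - 1) * real (c a b)"
        using c_ge l0 by (intro mult_left_mono) auto
      also have "\<dots> = real ((l - 1) * c a b)" using l0 by (simp add: of_nat_diff)
      also have "\<dots> \<le> real ((l - 1) * card ?X)" using Pc[OF ab] by (intro of_nat_mono mult_left_mono) auto
      also have "\<dots> \<le> real (card ?T)" using trans[of ?X] by (intro of_nat_mono) auto
      finally have "(real l - 1) * (real n * p a b - 1) / real q \<le> real (card ?T) / real q"
        by (intro divide_right_mono) auto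
      also have "\<dots> = (\<Sum>t\<in>?T. measure lebesgue (?D t))" unfolding mD by simp
      also have "\<dots> = measure lebesgue (\<Union>t\<in>?T. ?D t)"
      proof (rule measure_UN_disjoint_unit[symmetric, OF finT D])
        show "disjoint_family_on ?D ?T"
          unfolding disjoint_family_on_def
        proof (intro ballI impI)
          fix s t assume st: "s \<in> ?T" "t \<in> ?T" "s \<noteq> t"
          have "inj_on e {..<q}" using e by (simp add: cyc_def bij_betw_def)
          then have "e (Suc s) \<noteq> e (Suc t)" using st by (simp add: inj_on_eq_iff)
          then show "?D s \<inter> ?D t = {}" using cell_disjoint by blast
        qed
      qed
      also have "\<dots> \<le> measure lebesgue (\<sigma> ` cell r a \<inter> cell r b)"
      proof (intro measure_unit_mono sets.finite_UN finT D sets.Int MPT_image[OF \<sigma>] cell_unit_sets ab)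
        show "(\<Union>t\<in>?T. ?D t) \<subseteq> \<sigma> ` cell r a \<inter> cell r b"
        proof (intro UN_least Int_mono image_mono)
          fix t assume t: "t \<in> ?T"
          show "cell q (e t) \<subseteq> cell r a" using sub[of "e t"] t by simp
          show "cell q (e (Suc t)) \<subseteq> cell r b" using sub[of "e (Suc t)"] t by simp
        qed
      qed
      finally have *: "(real l - 1) * (real n * p a b - 1) / real q \<le> measure lebesgue (\<sigma> ` cell r a \<inter> cell r b)" .
      have "p a b \<le> 1" unfolding p_def
        by (intro measure_unit_le_1 sets.Int MPT_image[OF \<tau>] cell_unit_sets ab)
      have "real l \<le> real n" unfolding n_def using r by (intro of_nat_mono) simp
      have "(real l - 1) * (real n * p a b - 1) / real q = p a b - p a b / real l - 1 / real n + 1 / real q"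
        using l0 n by (simp add: q_def field_simps)
      moreover have "p a b / real l \<le> 1 / real l" using \<open>p a b \<le> 1\<close> by (simp add: divide_right_mono)
      moreover have "1 / real n \<le> 1 / real l" using \<open>real l \<le> real n\<close> l0 by (intro divide_left_mono) auto
      moreover have "1 / real q \<ge> 0" by simp
      ultimately show ?thesis using * unfolding \<kappa>_def by linarith
    qed
    then have trans: "\<And>a b. a < r \<Longrightarrow> b < r \<Longrightarrow>
      measure lebesgue (\<tau> ` cell r a \<inter> cell r b) - \<kappa> \<le> measure lebesgue (\<sigma> ` cell r a \<inter> cell r b)"
      by (simp add: p_def)
    have "A \<in> unit_sets" using F A by blast
    obtain S where S: "S \<subseteq> {..<r}" "sdm A (\<Union>a\<in>S. cell r a) \<le> \<eta>" using approx[of A] A by (auto intro: less_imp_le)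
    obtain S' where S': "S' \<subseteq> {..<r}" "sdm (\<tau> ` A) (\<Union>a\<in>S'. cell r a) \<le> \<eta>"
      using approx[of "\<tau> ` A"] A by (auto intro: less_imp_le)
    have "sdm (\<sigma> ` A) (\<tau> ` A) \<le> 8 * \<eta> + 2 * (real r ^ 2 * \<kappa>)"
      by (rule sdm_image_le[OF \<sigma> \<tau> \<open>A \<in> unit_sets\<close> S S' trans]) (simp_all add: \<kappa>_def)
    also have "real r ^ 2 * \<kappa> \<le> \<epsilon> / 16"
      using l \<epsilon> l0 by (simp add: \<kappa>_def field_simps)
    finally show ?thesis using \<epsilon> by (simp add: \<eta>_def)
  qed
  then show ?thesis using e by blast
qed

subsection \<open>Limits of refining cyclic permutations\<close>

text \<open>Cyclicity is forgotten here: the limit needs only compatible permutations of nested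
  cells. Carrying the inverse permutations \<open>p'\<close> makes the notion symmetric, so every
  fact about the limit map also holds for its inverse.\<close>

definition tower :: "(nat \<Rightarrow> nat) \<Rightarrow> (nat \<Rightarrow> nat \<Rightarrow> nat) \<Rightarrow> (nat \<Rightarrow> nat \<Rightarrow> nat) \<Rightarrow> bool" where
  "tower q p p' \<longleftrightarrow>
     (\<forall>i. q i > 0 \<and> q i < q (Suc i)) \<and>
     (\<forall>i a. a < q i \<longrightarrow> p i a < q i \<and> p' i a < q i \<and> p' i (p i a) = a \<and> p i (p' i a) = a) \<and>
     (\<forall>i. \<exists>k>0. q (Suc i) = q i * k \<and>
        (\<forall>a<q (Suc i). p (Suc i) a div k = p i (a div k) \<and> p' (Suc i) a div k = p' i (a div k)))"

definition addr :: "nat \<Rightarrow> real \<Rightarrow> nat" where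
  "addr q x = nat \<lfloor>real q * x\<rfloor>"

text \<open>A limit of step functions, which makes the map Borel. On [0,1) the left endpoints of the
  image cells increase with the rank, so the limit exists there.\<close>

definition limit_map :: "(nat \<Rightarrow> nat) \<Rightarrow> (nat \<Rightarrow> nat \<Rightarrow> nat) \<Rightarrow> real \<Rightarrow> real" where
  "limit_map q p x = lim (\<lambda>i. real (p i (addr (q i) x)) / real (q i))"

text \<open>Contains all endpoints of cells of all ranks, the only values at which the limit can
  leave its half-open image cell.\<close>

definition grid :: "(nat \<Rightarrow> nat) \<Rightarrow> real set" where
  "grid q = (\<lambda>(a, i). real a / real (q i)) ` UNIV"

lemma countable_grid: "countable (grid q)"
  unfolding grid_def by (intro countable_image) auto

lemma grid_memI: "real a / real (q i) \<in> grid q"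
  unfolding grid_def by (rule image_eqI[of _ _ "(a, i)"]) auto

lemma tower_step:
  assumes "tower q p p'"
  shows "\<exists>k>0. q (Suc i) = q i * k \<and>
    (\<forall>a<q (Suc i). p (Suc i) a div k = p i (a div k) \<and> p' (Suc i) a div k = p' i (a div k))"
  using assms[unfolded tower_def, THEN conjunct2, THEN conjunct2] by (rule spec)

lemma tower_sym:
  assumes "tower q p p'"
  shows "tower q p' p"
  unfolding tower_def
proof (intro conjI allI impI)
  fix i
  obtain k where "k > 0" "q (Suc i) = q i * k"
    "\<And>a. a < q (Suc i) \<Longrightarrow> p (Suc i) a div k = p i (a div k) \<and> p' (Suc i) a div k = p' i (a div k)"
    using tower_step[OF assms, of i] by auto
  then show "\<exists>k>0. q (Suc i) = q i * k \<and>
    (\<forall>a<q (Suc i). p' (Suc i) a div k = p' i (a div k) \<and> p (Suc i) a div k = p i (a div k))"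
    by (intro exI[of _ k]) auto
qed (use assms in \<open>auto simp: tower_def\<close>)

lemma tower_pos: "tower q p p' \<Longrightarrow> q i > 0"
  by (simp add: tower_def)

lemma tower_less: "tower q p p' \<Longrightarrow> a < q i \<Longrightarrow> p i a < q i"
  by (simp add: tower_def)

lemma tower_bij:
  assumes "tower q p p'"
  shows "bij_betw (p i) {..<q i} {..<q i}"
  using assms unfolding tower_def
  by (intro bij_betw_byWitness[where f' = "p' i"]) auto

lemma tower_ge: "tower q p p' \<Longrightarrow> i \<le> q i"
proof (induction i)
  case (Suc i)
  then have "i \<le> q i" "q i < q (Suc i)" by (auto simp: tower_def)
  then show ?case by simp
qed simp

lemma tower_scale_tendsto:
  assumes "tower q p p'"
  shows "(\<lambda>i. 1 / real (q i)) \<longlonglongrightarrow> 0"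
proof -
  have "filterlim q at_top sequentially"
    by (rule filterlim_at_top_mono[OF filterlim_ident]) (simp add: tower_ge[OF assms])
  then have "filterlim (\<lambda>i. real (q i)) at_top sequentially"
    by (rule filterlim_compose[OF filterlim_real_sequentially])
  then show ?thesis by (rule tendsto_divide_0[OF tendsto_const filterlim_at_top_imp_at_infinity])
qed

lemma eq_if_tower_close:
  assumes "tower q p p'" "\<And>i. \<bar>x - y\<bar> \<le> 1 / real (q i)"
  shows "x = y"
proof -
  have "\<bar>x - y\<bar> \<le> 0"
    by (rule tendsto_lowerbound[OF tower_scale_tendsto[OF assms(1)]]) (use assms(2) in auto)
  then show ?thesis by simp
qed

lemma mem_cell_addr: "q > 0 \<Longrightarrow> x \<ge> 0 \<Longrightarrow> x \<in> cell q a \<longleftrightarrow> addr q x = a"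
  by (simp add: mem_cell_iff addr_def)

lemma addr_less:
  assumes "q > 0" "x \<in> {0..<1}"
  shows "addr q x < q"
proof -
  obtain a where "a < q" "x \<in> cell q a" using UN_cell[OF assms(1)] assms(2) by blast
  then show ?thesis using assms mem_cell_addr[of q x a] by simp
qed

lemma limit_map_measurable: "limit_map q p \<in> borel_measurable borel"
proof -
  have "(\<lambda>x. real (p i (addr (q i) x)) / real (q i)) \<in> borel_measurable borel" for i
  proof -
    have "(\<lambda>x. nat \<lfloor>real (q i) * x\<rfloor>) \<in> borel \<rightarrow>\<^sub>M count_space UNIV" by measurable
    then show ?thesis unfolding addr_def by measurable
  qed
  then show ?thesis unfolding limit_map_def by measurable
qed

text \<open>The closed image cells are nested, because \<open>p\<close> is compatible with passing
  to the coarser cell. The limit of the left endpoints may be a right endpoint, hence no strict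
  inequality.\<close>

lemma limit_map_bounds:
  assumes T: "tower q p p'" and x: "x \<in> {0..<1}"
  shows "real (p i (addr (q i) x)) / real (q i) \<le> limit_map q p x"
    and "limit_map q p x \<le> (real (p i (addr (q i) x)) + 1) / real (q i)"
proof -
  define b where "b i = p i (addr (q i) x)" for i
  have q: "q i > 0" for i by (rule tower_pos[OF T])
  define lo hi where "lo i = real (b i) / real (q i)" and "hi i = (real (b i) + 1) / real (q i)" for i
  have step: "lo i \<le> lo (Suc i) \<and> hi (Suc i) \<le> hi i" for i
  proof -
    obtain k where k: "k > 0" "q (Suc i) = q i * k"
      and comp: "\<And>a. a < q (Suc i) \<Longrightarrow> p (Suc i) a div k = p i (a div k)"
      using tower_step[OF T, of i] by auto
    have "x \<in> cell (q i * k) (addr (q (Suc i)) x)"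
      using x q[of "Suc i"] by (simp add: mem_cell_addr k(2))
    then have "x \<in> cell (q i) (addr (q (Suc i)) x div k)" using cell_mult_subset[OF q k(1)] by blast
    then have "addr (q (Suc i)) x div k = addr (q i) x" using x q by (simp add: mem_cell_addr)
    then have bk: "b (Suc i) div k = b i" using comp[OF addr_less[OF q x]] by (simp add: b_def)
    have "b i * k \<le> b (Suc i)" "b (Suc i) + 1 \<le> (b i + 1) * k"
      using bk k(1) div_mult_mod_eq[of "b (Suc i)" k] mod_less_divisor[OF k(1), of "b (Suc i)"] by auto
    then have r: "real (b i) * real k \<le> real (b (Suc i))" "real (b (Suc i)) + 1 \<le> (real (b i) + 1) * real k"
      using of_nat_mono[of "b i * k" "b (Suc i)", where 'a = real]
        of_nat_mono[of "b (Suc i) + 1" "(b i + 1) * k", where 'a = real] by (simp_all add: algebra_simps)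
    have qq: "real (q (Suc i)) > 0" using q by simp
    have "lo i = real (b i) * real k / real (q (Suc i))" using k(1) by (simp add: lo_def k(2))
    also have "\<dots> \<le> lo (Suc i)" unfolding lo_def using r(1) qq by (intro divide_right_mono) auto
    finally have "lo i \<le> lo (Suc i)" .
    moreover have "hi (Suc i) \<le> (real (b i) + 1) * real k / real (q (Suc i))"
      unfolding hi_def using r(2) qq by (intro divide_right_mono) auto
    moreover have "(real (b i) + 1) * real k / real (q (Suc i)) = hi i" using k(1) by (simp add: hi_def k(2))
    ultimately show ?thesis by simp
  qed
  have lo: "incseq lo" and hi: "decseq hi" using step by (auto intro!: incseq_SucI decseq_SucI)
  have lohi: "lo i \<le> hi j" for i j
  proof -
    have "lo i \<le> lo (max i j)" using lo by (simp add: incseqD)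
    also have "\<dots> \<le> hi (max i j)" by (simp add: lo_def hi_def divide_right_mono)
    also have "\<dots> \<le> hi j" using hi by (simp add: decseqD)
    finally show ?thesis .
  qed
  obtain L where L: "lo \<longlonglongrightarrow> L" "\<forall>i. lo i \<le> L"
    using incseq_convergent[OF lo, of "hi 0"] lohi by blast
  have "limit_map q p x = L" using limI[OF L(1)] by (simp add: limit_map_def lo_def[abs_def] b_def)
  moreover have "L \<le> hi i" by (rule LIMSEQ_le_const2[OF L(1)]) (use lohi in blast)
  ultimately show "real (p i (addr (q i) x)) / real (q i) \<le> limit_map q p x"
    "limit_map q p x \<le> (real (p i (addr (q i) x)) + 1) / real (q i)"
    using L(2) by (simp_all add: lo_def hi_def b_def)
qed

text \<open>The right endpoint excluded from a half-open cell is itself a grid point.\<close>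

lemma limit_map_off_grid:
  assumes T: "tower q p p'" and x: "x \<in> {0..<1}" and off: "limit_map q p x \<notin> grid q"
  shows "limit_map q p x \<in> {0..<1}" "limit_map q p x \<in> cell (q i) (p i (addr (q i) x))"
    "addr (q i) (limit_map q p x) = p i (addr (q i) x)"
proof -
  have q: "q i > 0" by (rule tower_pos[OF T])
  have "limit_map q p x \<noteq> (real (p i (addr (q i) x)) + 1) / real (q i)"
    using off grid_memI[of "Suc (p i (addr (q i) x))" q i] by (auto simp: add.commute)
  then show c: "limit_map q p x \<in> cell (q i) (p i (addr (q i) x))"
    using limit_map_bounds[OF T x, of i] by (simp add: cell_def add.commute)
  then show "limit_map q p x \<in> {0..<1}"
    using cell_subset_unit[OF tower_less[OF T addr_less[OF q x]]] by blast
  then show "addr (q i) (limit_map q p x) = p i (addr (q i) x)" using c q by (simp add: mem_cell_addr)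
qed

text \<open>Applying \<open>p\<close> and \<open>p'\<close> in turn restores the address of
  \<open>x\<close>, so at every rank the result shares a closed cell with \<open>x\<close>.\<close>

lemma limit_map_inverse:
  assumes T: "tower q p p'" and x: "x \<in> {0..<1}" and off: "limit_map q p x \<notin> grid q"
  shows "limit_map q p' (limit_map q p x) = x"
proof (rule eq_if_tower_close[OF T])
  fix i
  have q: "q i > 0" by (rule tower_pos[OF T])
  note f = limit_map_off_grid[OF T x off]
  have "p' i (addr (q i) (limit_map q p x)) = addr (q i) x"
    using T addr_less[OF q x] by (simp add: f(3) tower_def)
  then have "real (addr (q i) x) / real (q i) \<le> limit_map q p' (limit_map q p x)"
    "limit_map q p' (limit_map q p x) \<le> (real (addr (q i) x) + 1) / real (q i)"
    using limit_map_bounds[OF tower_sym[OF T] f(1), of i] by simp_all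
  moreover have "x \<in> cell (q i) (addr (q i) x)" using q x by (simp add: mem_cell_addr)
  ultimately show "\<bar>limit_map q p' (limit_map q p x) - x\<bar> \<le> 1 / real (q i)"
    by (auto simp: cell_def add_divide_distrib abs_le_iff)
qed

text \<open>For \<open>f x = y\<close> the integer \<open>p i (addr (q i) x)\<close> lies in \<open>[q y - 1, q y]\<close>,
  so at most two cells of each rank meet the fibre.\<close>
lemma finite_limit_map_fibre:
  assumes T: "tower q p p'"
  shows "finite {x \<in> {0..<1}. limit_map q p x = y}"
proof (rule ccontr)
  let ?S = "{x \<in> {0..<1}. limit_map q p x = y}"
  assume "infinite ?S"
  then obtain R where R: "finite R" "card R = 3" "R \<subseteq> ?S" by (meson infinite_arbitrarily_large)
  obtain u v w where uvw: "R = {u, v, w}" "u \<noteq> v" "u \<noteq> w" "v \<noteq> w"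
    using R(2) by (auto simp: card_3_iff)
  define d where "d = min \<bar>u - v\<bar> (min \<bar>u - w\<bar> \<bar>v - w\<bar>)"
  have "d > 0" using uvw by (simp add: d_def)
  then obtain i where i: "1 / real (q i) < d"
    using order_tendstoD(2)[OF tower_scale_tendsto[OF T], of d] by (auto simp: eventually_sequentially)
  have q: "q i > 0" by (rule tower_pos[OF T])
  have inj: "inj_on (p i) {..<q i}" using tower_bij[OF T] by (rule bij_betw_imp_inj_on)
  have sep: "p i (addr (q i) s) \<noteq> p i (addr (q i) t)" if "s \<in> R" "t \<in> R" "\<bar>s - t\<bar> \<ge> d" for s t
  proof
    have st: "s \<in> {0..<1}" "t \<in> {0..<1}" using that R(3) by auto
    assume "p i (addr (q i) s) = p i (addr (q i) t)"
    then have "addr (q i) s = addr (q i) t"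
      using inj addr_less[OF q st(1)] addr_less[OF q st(2)] by (simp add: inj_on_eq_iff)
    then have "s \<in> cell (q i) (addr (q i) t)" "t \<in> cell (q i) (addr (q i) t)"
      using q st by (simp_all add: mem_cell_addr)
    then have "\<bar>s - t\<bar> < 1 / real (q i)" by (auto simp: cell_def add_divide_distrib)
    then show False using i that by linarith
  qed
  have bound: "real (p i (addr (q i) s)) \<le> real (q i) * y \<and> real (q i) * y \<le> real (p i (addr (q i) s)) + 1"
    if "s \<in> R" for s
    using limit_map_bounds[OF T, of s i] that R(3) q by (auto simp: field_simps)
  have "p i (addr (q i) u) \<noteq> p i (addr (q i) v)" "p i (addr (q i) u) \<noteq> p i (addr (q i) w)"
    "p i (addr (q i) v) \<noteq> p i (addr (q i) w)"
    using sep uvw by (auto simp: d_def)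
  moreover have "u \<in> R" "v \<in> R" "w \<in> R" using uvw by auto
  note bound[OF this(1)] bound[OF this(2)] bound[OF this(3)]
  ultimately show False by linarith
qed

text \<open>At each rank the limit map and the identity are compared with the same unions of cells;
  \<open>p i\<close> permutes the addresses and so does not change how many satisfy a condition.
  Both measures then lie between two bounds that differ by at most one cell.\<close>

lemma measure_limit_map_greater:
  assumes T: "tower q p p'"
  shows "measure lebesgue {x \<in> {0..<1}. c < limit_map q p x} = measure lebesgue {x \<in> {0..<1}. c < x}"
proof (rule eq_if_tower_close[OF T])
  fix i
  let ?q = "q i" and ?m = "measure lebesgue"
  have q: "?q > 0" by (rule tower_pos[OF T])
  have bij: "bij_betw (p i) {..<?q} {..<?q}" by (rule tower_bij[OF T])
  have cells: "{x \<in> {0..<1}. P (addr ?q x)} = (\<Union>a\<in>{a. a < ?q \<and> P a}. cell ?q a)" for P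
  proof (intro equalityI subsetI)
    fix x assume x: "x \<in> {x \<in> {0..<1}. P (addr ?q x)}"
    then show "x \<in> (\<Union>a\<in>{a. a < ?q \<and> P a}. cell ?q a)"
      using addr_less[OF q, of x] q by (auto simp: mem_cell_addr)
  next
    fix x assume "x \<in> (\<Union>a\<in>{a. a < ?q \<and> P a}. cell ?q a)"
    then obtain a where a: "a < ?q" "P a" "x \<in> cell ?q a" by blast
    then have "x \<in> {0..<1}" using cell_subset_unit by blast
    then show "x \<in> {x \<in> {0..<1}. P (addr ?q x)}" using a q by (auto simp: mem_cell_addr)
  qed
  have ms: "{x \<in> {0..<1}. P (addr ?q x)} \<in> unit_sets" for P
    unfolding cells by (rule UN_cell_unit_sets) auto
  have mP: "?m {x \<in> {0..<1}. P (addr ?q x)} = real (card {a. a < ?q \<and> P a}) / real ?q" for P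
    unfolding cells using q by (intro measure_UN_cell) auto
  have cardp: "card {a. a < ?q \<and> P (p i a)} = card {a. a < ?q \<and> P a}" for P
  proof -
    have "bij_betw (p i) {a. a < ?q \<and> P (p i a)} {a. a < ?q \<and> P a}"
      using bij unfolding bij_betw_def inj_on_def by (auto 0 3)
    then show ?thesis by (rule bij_betw_same_card)
  qed
  \<comment> \<open>\<open>?U\<close> selects the cells whose right endpoint exceeds
    \<open>c\<close>, \<open>?V\<close> those whose left endpoint does.\<close>
  let ?U = "\<lambda>a. real ?q * c < real a + 1" and ?V = "\<lambda>a. real ?q * c < real a"
  have UV: "?m {x \<in> {0..<1}. ?U (addr ?q x)} \<le> ?m {x \<in> {0..<1}. ?V (addr ?q x)} + 1 / real ?q"
  proof -
    have "{a. a < ?q \<and> ?U a} \<subseteq> {a. a < ?q \<and> ?V a} \<union> {nat \<lfloor>real ?q * c\<rfloor>}"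
    proof
      fix a assume a: "a \<in> {a. a < ?q \<and> ?U a}"
      have "a = nat \<lfloor>real ?q * c\<rfloor>" if "\<not> ?V a"
      proof -
        have "\<lfloor>real ?q * c\<rfloor> = int a" using a that by (simp add: floor_eq_iff)
        then show ?thesis by simp
      qed
      then show "a \<in> {a. a < ?q \<and> ?V a} \<union> {nat \<lfloor>real ?q * c\<rfloor>}" using a by auto
    qed
    then have "card {a. a < ?q \<and> ?U a} \<le> card ({a. a < ?q \<and> ?V a} \<union> {nat \<lfloor>real ?q * c\<rfloor>})"
      by (intro card_mono) auto
    also have "\<dots> \<le> card {a. a < ?q \<and> ?V a} + 1" by (simp add: card_insert_if)
    finally have "real (card {a. a < ?q \<and> ?U a}) \<le> real (card {a. a < ?q \<and> ?V a}) + 1" by linarith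
    then have "real (card {a. a < ?q \<and> ?U a}) / real ?q \<le> (real (card {a. a < ?q \<and> ?V a}) + 1) / real ?q"
      by (rule divide_right_mono) simp
    then show ?thesis unfolding mP[of ?U] mP[of ?V] by (simp only: add_divide_distrib)
  qed
  have sandwich: "?m {x \<in> {0..<1}. ?V (addr ?q x)} \<le> ?m {x \<in> {0..<1}. c < h x} \<and>
      ?m {x \<in> {0..<1}. c < h x} \<le> ?m {x \<in> {0..<1}. ?U (addr ?q x)}"
    if h: "h \<in> borel_measurable borel" and r: "\<And>x. x \<in> {0..<1} \<Longrightarrow> real (s (addr ?q x)) / real ?q \<le> h x"
      "\<And>x. x \<in> {0..<1} \<Longrightarrow> h x \<le> (real (s (addr ?q x)) + 1) / real ?q"
      and card: "\<And>P. card {a. a < ?q \<and> P (s a)} = card {a. a < ?q \<and> P a}" for h s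
  proof
    have "{x \<in> {0..<1}. c < h x} = {0..<1} \<inter> (h -` {c<..} \<inter> space borel)" by auto
    also have "\<dots> \<in> sets borel" using h by (intro sets.Int measurable_sets) auto
    finally have hm: "{x \<in> {0..<1}. c < h x} \<in> unit_sets" by (intro unit_setsI) auto
    have "?m {x \<in> {0..<1}. ?V (addr ?q x)} = ?m {x \<in> {0..<1}. ?V (s (addr ?q x))}"
      unfolding mP[of ?V] mP[of "\<lambda>a. ?V (s a)"] card[of ?V] by (rule refl)
    also have "\<dots> \<le> ?m {x \<in> {0..<1}. c < h x}"
    proof (intro measure_unit_mono ms hm subsetI)
      fix x assume x: "x \<in> {x \<in> {0..<1}. ?V (s (addr ?q x))}"
      then have "c < real (s (addr ?q x)) / real ?q" using q by (simp add: field_simps)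
      then show "x \<in> {x \<in> {0..<1}. c < h x}" using r(1)[of x] x by auto
    qed
    finally show "?m {x \<in> {0..<1}. ?V (addr ?q x)} \<le> ?m {x \<in> {0..<1}. c < h x}" .
    have "?m {x \<in> {0..<1}. c < h x} \<le> ?m {x \<in> {0..<1}. ?U (s (addr ?q x))}"
    proof (intro measure_unit_mono ms hm subsetI)
      fix x assume x: "x \<in> {x \<in> {0..<1}. c < h x}"
      then have "c < (real (s (addr ?q x)) + 1) / real ?q" using r(2)[of x] by auto
      then show "x \<in> {x \<in> {0..<1}. ?U (s (addr ?q x))}" using q x by (simp add: field_simps)
    qed
    also have "\<dots> = ?m {x \<in> {0..<1}. ?U (addr ?q x)}"
      unfolding mP[of ?U] mP[of "\<lambda>a. ?U (s a)"] card[of ?U] by (rule refl)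
    finally show "?m {x \<in> {0..<1}. c < h x} \<le> ?m {x \<in> {0..<1}. ?U (addr ?q x)}" .
  qed
  have "?m {x \<in> {0..<1}. ?V (addr ?q x)} \<le> ?m {x \<in> {0..<1}. c < limit_map q p x} \<and>
      ?m {x \<in> {0..<1}. c < limit_map q p x} \<le> ?m {x \<in> {0..<1}. ?U (addr ?q x)}"
    by (rule sandwich[OF limit_map_measurable limit_map_bounds[OF T] cardp])
  moreover have "?m {x \<in> {0..<1}. ?V (addr ?q x)} \<le> ?m {x \<in> {0..<1}. c < x} \<and>
      ?m {x \<in> {0..<1}. c < x} \<le> ?m {x \<in> {0..<1}. ?U (addr ?q x)}"
  proof (rule sandwich[of "\<lambda>x. x" "\<lambda>a. a"])
    fix x :: real assume "x \<in> {0..<1}"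
    then have "x \<in> cell ?q (addr ?q x)" using q by (simp add: mem_cell_addr)
    then show "real (addr ?q x) / real ?q \<le> x" "x \<le> (real (addr ?q x) + 1) / real ?q"
      by (auto simp: cell_def add.commute)
  qed auto
  ultimately show "\<bar>?m {x \<in> {0..<1}. c < limit_map q p x} - ?m {x \<in> {0..<1}. c < x}\<bar> \<le> 1 / real ?q"
    using UV by linarith
qed

text \<open>Agreement on open rays identifies the image of Lebesgue measure under \<open>f\<close>
  with Lebesgue measure on Borel sets. A Lebesgue set is a Borel set plus a part of a Borel null
  set, and the preimage of the latter is null again.\<close>

lemma vimage_measure_preserving:
  fixes f :: "real \<Rightarrow> real"
  assumes f: "f \<in> borel_measurable borel"
    and gr: "\<And>c. measure lebesgue {x \<in> {0..<1}. c < f x} = measure lebesgue {x \<in> {0..<1}. c < x}"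
    and A: "A \<in> unit_sets"
  shows "{x \<in> {0..<1}. f x \<in> A} \<in> unit_sets"
    and "measure lebesgue {x \<in> {0..<1}. f x \<in> A} = measure lebesgue A"
proof -
  let ?R = "restrict_space lborel {0..<1::real}"
  have sb: "{x \<in> {0..<1}. h x \<in> S} \<in> sets borel" if "h \<in> borel_measurable borel" "S \<in> sets borel" for h :: "real \<Rightarrow> real" and S
  proof -
    have "{x \<in> {0..<1}. h x \<in> S} = {0..<1} \<inter> (h -` S \<inter> space borel)" by auto
    also have "\<dots> \<in> sets borel" using that by (intro sets.Int measurable_sets) auto
    finally show ?thesis .
  qed
  have hR: "h \<in> ?R \<rightarrow>\<^sub>M borel" if "h \<in> borel_measurable borel" for h :: "real \<Rightarrow> real"
    using that by (intro measurable_restrict_space1) (simp add: measurable_lborel1)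
  have em: "emeasure (distr ?R borel h) S = emeasure lborel {x \<in> {0..<1}. h x \<in> S}"
    if h: "h \<in> borel_measurable borel" and S: "S \<in> sets borel" for h :: "real \<Rightarrow> real" and S
  proof -
    have "emeasure (distr ?R borel h) S = emeasure ?R (h -` S \<inter> space ?R)"
      using hR[OF h] S by (rule emeasure_distr)
    also have "\<dots> = emeasure lborel (h -` S \<inter> space ?R)"
      by (rule emeasure_restrict_space) (auto simp: space_restrict_space)
    also have "h -` S \<inter> space ?R = {x \<in> {0..<1}. h x \<in> S}" by (auto simp: space_restrict_space)
    finally show ?thesis .
  qed
  have emm: "emeasure lborel X = ennreal (measure lebesgue X)" if "X \<in> sets borel" "X \<subseteq> {0..<1}" for X :: "real set"
  proof -
    have "X \<in> unit_sets" using that by (intro unit_setsI) auto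
    then have "emeasure lebesgue X = ennreal (measure lebesgue X)"
      by (intro emeasure_eq_measure2 unit_sets_lmeasurable)
    then show ?thesis using that by simp
  qed
  have "distr ?R borel f = distr ?R borel (\<lambda>x. x)"
  proof (rule measure_eqI_lessThan)
    fix c :: real
    have em': "emeasure (distr ?R borel h) {c<..} = ennreal (measure lebesgue {x \<in> {0..<1}. h x \<in> {c<..}})"
      if h: "h \<in> borel_measurable borel" for h :: "real \<Rightarrow> real"
    proof -
      have "emeasure (distr ?R borel h) {c<..} = emeasure lborel {x \<in> {0..<1}. h x \<in> {c<..}}"
        by (rule em[OF h]) simp
      also have "\<dots> = ennreal (measure lebesgue {x \<in> {0..<1}. h x \<in> {c<..}})"
        by (rule emm[OF sb[OF h]]) auto
      finally show ?thesis .
    qed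
    have "emeasure (distr ?R borel f) {c<..} = ennreal (measure lebesgue {x \<in> {0..<1}. f x \<in> {c<..}})"
      by (rule em'[OF f])
    moreover have "emeasure (distr ?R borel (\<lambda>x. x)) {c<..} = ennreal (measure lebesgue {x \<in> {0..<1}. x \<in> {c<..}})"
      by (rule em') simp
    ultimately show "emeasure (distr ?R borel f) {c<..} = emeasure (distr ?R borel (\<lambda>x. x)) {c<..}"
      "emeasure (distr ?R borel f) {c<..} < \<infinity>"
      using gr[of c] by simp_all
  qed simp_all
  then have pres: "emeasure lborel {x \<in> {0..<1}. f x \<in> S} = emeasure lborel {x \<in> {0..<1}. x \<in> S}" if "S \<in> sets borel" for S
    using em[OF f that] em[OF _ that, of "\<lambda>x. x"] by simp
  have "A \<in> sets (completion lborel)" using A by (simp add: unit_sets_iff)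
  then obtain S N N' where SN: "A = S \<union> N" "N \<subseteq> N'" "N' \<in> null_sets lborel" "S \<in> sets lborel"
    by (rule sets_completionE)
  have S: "S \<in> sets borel" and N': "N' \<in> sets borel" using SN by (auto simp: null_sets_def)
  have "emeasure lborel {x \<in> {0..<1}. f x \<in> N'} \<le> emeasure lborel N'"
    unfolding pres[OF N'] by (rule emeasure_mono) (use N' in auto)
  then have "{x \<in> {0..<1}. f x \<in> N'} \<in> null_sets lborel"
    using SN(3) sb[OF f N'] by (auto simp: null_sets_def)
  then have "negligible {x \<in> {0..<1}. f x \<in> N'}"
    by (simp add: negligible_iff_null_sets null_sets_completionI)
  then have neg: "negligible {x \<in> {0..<1}. f x \<in> N}" by (rule negligible_subset) (use SN(2) in auto)
  have neg': "negligible N"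
    using SN(2,3) by (meson negligible_iff_null_sets negligible_subset null_sets_completionI)
  have fS: "{x \<in> {0..<1}. f x \<in> S} \<in> unit_sets" using sb[OF f S] by (intro unit_setsI) auto
  have eq: "{x \<in> {0..<1}. f x \<in> A} = {x \<in> {0..<1}. f x \<in> S} \<union> {x \<in> {0..<1}. f x \<in> N}"
    using SN(1) by auto
  show m: "{x \<in> {0..<1}. f x \<in> A} \<in> unit_sets"
    unfolding eq by (rule unit_sets_Un[OF fS unit_setsI[OF negligible_imp_sets[OF neg]]]) auto
  have "measure lebesgue {x \<in> {0..<1}. f x \<in> A} = measure lebesgue {x \<in> {0..<1}. f x \<in> S}"
    by (rule measure_negligible_symdiff[OF unit_sets_lmeasurable[OF fS]])
      (rule negligible_subset[OF neg], auto simp: SN(1))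
  also have "\<dots> = measure lebesgue {x \<in> {0..<1}. x \<in> S}"
  proof -
    have "emeasure lborel {x \<in> {0..<1}. f x \<in> S} = ennreal (measure lebesgue {x \<in> {0..<1}. f x \<in> S})"
      by (rule emm[OF sb[OF f S]]) auto
    moreover have "emeasure lborel {x \<in> {0..<1}. x \<in> S} = ennreal (measure lebesgue {x \<in> {0..<1}. x \<in> S})"
      by (rule emm[OF sb[of "\<lambda>x. x", OF _ S]]) auto
    ultimately show ?thesis using pres[OF S] by (simp only: ennreal_inj measure_nonneg)
  qed
  also have "\<dots> = measure lebesgue A"
  proof (rule measure_negligible_symdiff[symmetric])
    show "{x \<in> {0..<1}. x \<in> S} \<in> lmeasurable"
      using sb[of "\<lambda>x. x", OF _ S] by (intro unit_sets_lmeasurable unit_setsI) auto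
    have "({x \<in> {0..<1}. x \<in> S} - A) \<union> (A - {x \<in> {0..<1}. x \<in> S}) \<subseteq> N \<union> {1}"
      using A SN(1) by (auto simp: unit_sets_iff)
    then show "negligible (({x \<in> {0..<1}. x \<in> S} - A) \<union> (A - {x \<in> {0..<1}. x \<in> S}))"
      by (rule negligible_subset[rotated]) (intro negligible_Un neg' negligible_sing)
  qed
  finally show "measure lebesgue {x \<in> {0..<1}. f x \<in> A} = measure lebesgue A" .
qed

lemma negligible_countable:
  fixes A :: "real set"
  assumes "countable A"
  shows "negligible A"
  using countable_imp_null_set_lborel[OF assms] by (simp add: negligible_iff_null_sets null_sets_completionI)

lemma unit_sets_countable_change:
  assumes X: "X \<in> unit_sets" and Y: "Y \<subseteq> {0..1}" and "countable ((X - Y) \<union> (Y - X))"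
  shows "Y \<in> unit_sets" "measure lebesgue Y = measure lebesgue X"
proof -
  have neg: "negligible (X - Y)" "negligible (Y - X)"
    using assms(3) by (auto intro: negligible_countable)
  have "Y = (X - (X - Y)) \<union> (Y - X)" by auto
  moreover have "X - Y \<in> unit_sets" "Y - X \<in> unit_sets"
    using neg Y X by (auto intro!: unit_setsI negligible_imp_sets simp: unit_sets_iff)
  ultimately show "Y \<in> unit_sets" using X by (metis sets.Diff unit_sets_Un)
  show "measure lebesgue Y = measure lebesgue X"
    using unit_sets_lmeasurable[OF X] neg by (intro measure_negligible_symdiff) auto
qed

text \<open>Giving up a countably infinite subset of the domain makes both complements countably
  infinite, so that they can be matched.\<close>
lemma bij_extend_countable_complements:
  fixes f :: "real \<Rightarrow> real"
  assumes f: "bij_betw f X Y" and X: "X \<subseteq> {0..1}" "countable ({0..1} - X)"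
    and Y: "Y \<subseteq> {0..1}" "countable ({0..1} - Y)"
  shows "\<exists>\<tau> C. countable C \<and> bij_betw \<tau> {0..1} {0..1} \<and> (\<forall>x\<in>X - C. \<tau> x = f x)"
proof -
  have "uncountable X"
  proof
    assume "countable X"
    then have "countable (X \<union> ({0..1} - X))" using X(2) by (rule countable_Un)
    then have "countable {0..1::real}" by (rule countable_subset[rotated]) auto
    then show False using uncountable_closed_interval[of 0 "1::real"] by simp
  qed
  then have "infinite X" using countable_finite by blast
  then obtain C where C: "C \<subseteq> X" "countable C" "infinite C"
    using infinite_countable_subset' by blast
  have inj: "inj_on f X" using f by (rule bij_betw_imp_inj_on)
  let ?P = "{0..1} - (X - C)" and ?Q = "{0..1} - (Y - f ` C)"
  have "countable ?P" by (rule countable_subset[of _ "({0..1} - X) \<union> C"]) (use X C in auto)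
  moreover have "infinite ?P" using C X by (meson Diff_iff finite_subset subset_iff subsetI)
  ultimately have P: "bij_betw (from_nat_into ?P) UNIV ?P" by (rule bij_betw_from_nat_into)
  have fC: "f ` C \<subseteq> Y" using C f by (auto simp: bij_betw_def)
  have "countable ?Q" by (rule countable_subset[of _ "({0..1} - Y) \<union> f ` C"]) (use Y C in auto)
  moreover have "infinite (f ` C)" using C inj by (meson finite_imageD inj_on_subset)
  then have "infinite ?Q" using fC Y by (meson Diff_iff finite_subset subset_iff subsetI)
  ultimately have Q: "bij_betw (from_nat_into ?Q) UNIV ?Q" by (rule bij_betw_from_nat_into)
  obtain h where h: "bij_betw h ?P ?Q" using bij_betw_trans[OF bij_betw_inv_into[OF P] Q] by blast
  define \<tau> where "\<tau> x = (if x \<in> X - C then f x else h x)" for x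
  have "f ` (X - C) = Y - f ` C" using f C inj by (simp add: inj_on_image_set_diff bij_betw_def)
  then have "bij_betw f (X - C) (Y - f ` C)" using inj by (auto intro!: bij_betw_imageI intro: inj_on_subset)
  then have "bij_betw \<tau> (X - C) (Y - f ` C)" by (subst bij_betw_cong[of _ \<tau> f]) (auto simp: \<tau>_def)
  moreover have "bij_betw \<tau> ?P ?Q" using h by (subst bij_betw_cong[of _ \<tau> h]) (auto simp: \<tau>_def)
  ultimately have "bij_betw \<tau> ((X - C) \<union> ?P) ((Y - f ` C) \<union> ?Q)" by (rule bij_betw_combine) auto
  moreover have "(X - C) \<union> ?P = {0..1}" "(Y - f ` C) \<union> ?Q = {0..1}" using X Y by auto
  ultimately show ?thesis using C by (intro exI[of _ \<tau>] exI[of _ C]) (auto simp: \<tau>_def)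
qed

text \<open>The limit maps of \<open>p\<close> and \<open>p'\<close> are mutually inverse off a
  countable set, since fibres over the countable grid are finite. Extending to a bijection of [0,1]
  alters countably many points only and so affects no measure.\<close>

lemma tower_limit:
  assumes T: "tower q p p'"
  shows "\<exists>\<tau>\<in>MPT. \<forall>i a. a < q i \<longrightarrow> sdm (\<tau> ` cell (q i) a) (cell (q i) (p i a)) = 0"
proof -
  define f g where "f = limit_map q p" and "g = limit_map q p'"
  note T' = tower_sym[OF T]
  let ?D = "grid q"
  \<comment> \<open>Both conditions are needed: \<open>f x\<close> off the grid makes
    \<open>g\<close> undo \<open>f\<close>, and \<open>x\<close> off the grid puts
    \<open>f x\<close> into \<open>Y\<close>.\<close>
  define X Y where "X = {x \<in> {0..<1}. x \<notin> ?D \<and> f x \<notin> ?D}" and "Y = {y \<in> {0..<1}. y \<notin> ?D \<and> g y \<notin> ?D}"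
  have fX: "f x \<in> Y \<and> g (f x) = x" if "x \<in> X" for x
    using that limit_map_off_grid(1)[OF T, of x] limit_map_inverse[OF T, of x] by (auto simp: X_def Y_def f_def g_def)
  have gY: "g y \<in> X \<and> f (g y) = y" if "y \<in> Y" for y
    using that limit_map_off_grid(1)[OF T', of y] limit_map_inverse[OF T', of y] by (auto simp: X_def Y_def f_def g_def)
  have bij: "bij_betw f X Y" using fX gY by (intro bij_betw_byWitness[where f' = g]) auto
  have co: "countable ({0..1} - {x \<in> {0..<1}. x \<notin> ?D \<and> limit_map q r x \<notin> ?D})" if "tower q r r'" for r r'
  proof (rule countable_subset)
    show "{0..1} - {x \<in> {0..<1}. x \<notin> ?D \<and> limit_map q r x \<notin> ?D} \<subseteq>
      {1} \<union> ?D \<union> (\<Union>y\<in>?D. {x \<in> {0..<1}. limit_map q r x = y})" by auto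
    show "countable ({1} \<union> ?D \<union> (\<Union>y\<in>?D. {x \<in> {0..<1}. limit_map q r x = y}))"
      using countable_grid[of q] finite_limit_map_fibre[OF that]
      by (intro countable_Un countable_UN) (auto intro: countable_finite)
  qed
  have cX: "countable ({0..1} - X)" and cY: "countable ({0..1} - Y)"
    using co[OF T] co[OF T'] by (simp_all add: X_def Y_def f_def g_def)
  have XY: "X \<subseteq> {0..1}" "Y \<subseteq> {0..1}" by (auto simp: X_def Y_def)
  obtain \<tau> C where C: "countable C" and \<tau>: "bij_betw \<tau> {0..1} {0..1}" and \<tau>f: "\<And>x. x \<in> X - C \<Longrightarrow> \<tau> x = f x"
    using bij_extend_countable_complements[OF bij XY(1) cX XY(2) cY] by blast
  have inj: "inj_on \<tau> {0..1}" using \<tau> by (rule bij_betw_imp_inj_on)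
  define E where "E = {0..1} - (X - C)"
  have E: "countable E" unfolding E_def
    by (rule countable_subset[of _ "({0..1} - X) \<union> C"]) (use cX C in auto)
  have maps: "\<tau> x \<in> {0..1}" if "x \<in> {0..1}" for x using \<tau> that by (rule bij_betw_apply)
  have pre: "\<tau> -` A \<inter> {0..1} \<in> unit_sets \<and> measure lebesgue (\<tau> -` A \<inter> {0..1}) = measure lebesgue A"
    if A: "A \<in> unit_sets" for A
  proof -
    let ?V = "{x \<in> {0..<1}. f x \<in> A}"
    have V: "?V \<in> unit_sets" "measure lebesgue ?V = measure lebesgue A"
      unfolding f_def using vimage_measure_preserving[OF limit_map_measurable measure_limit_map_greater[OF T] A] by auto
    have "((?V - (\<tau> -` A \<inter> {0..1})) \<union> ((\<tau> -` A \<inter> {0..1}) - ?V)) \<subseteq> E"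
      using \<tau>f by (auto simp: E_def X_def)
    then have "countable ((?V - (\<tau> -` A \<inter> {0..1})) \<union> ((\<tau> -` A \<inter> {0..1}) - ?V))"
      using E countable_subset by blast
    from unit_sets_countable_change[OF V(1) _ this] V(2) show ?thesis by auto
  qed
  have img: "\<tau> ` A \<in> unit_sets \<and> measure lebesgue (\<tau> ` A) = measure lebesgue A"
    if A: "A \<in> unit_sets" for A
  proof -
    have A01: "A \<subseteq> {0..1}" using A unit_sets_iff by blast
    \<comment> \<open>Off the exceptional points an image under \<open>\<tau>\<close> is a preimage
      under \<open>g\<close>, so the result on preimages applies to images as well.\<close>
    let ?V = "{y \<in> {0..<1}. g y \<in> A}"
    have V: "?V \<in> unit_sets" "measure lebesgue ?V = measure lebesgue A"
      unfolding g_def using vimage_measure_preserving[OF limit_map_measurable measure_limit_map_greater[OF T'] A] by auto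
    have sub: "(?V - \<tau> ` A) \<union> (\<tau> ` A - ?V) \<subseteq> ({0..1} - Y) \<union> f ` C \<union> \<tau> ` E"
    proof
      fix y assume y: "y \<in> (?V - \<tau> ` A) \<union> (\<tau> ` A - ?V)"
      show "y \<in> ({0..1} - Y) \<union> f ` C \<union> \<tau> ` E"
      proof (rule ccontr)
        assume n: "y \<notin> ({0..1} - Y) \<union> f ` C \<union> \<tau> ` E"
        have "y \<in> {0..1}" using y maps A01 by auto
        then have yY: "y \<in> Y" using n by blast
        then have gx: "g y \<in> X" "f (g y) = y" using gY by auto
        then have "g y \<notin> C" using n by (metis UnI1 UnI2 image_eqI)
        then have \<tau>g: "\<tau> (g y) = y" using \<tau>f gx by auto
        have "y \<in> ?V \<longleftrightarrow> g y \<in> A" using yY by (auto simp: Y_def)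
        moreover have "y \<in> \<tau> ` A \<longleftrightarrow> g y \<in> A"
        proof
          assume "y \<in> \<tau> ` A"
          then obtain x where x: "x \<in> A" "y = \<tau> x" by blast
          then have "x = g y" using \<tau>g inj A01 gx(1) XY(1) by (metis inj_onD subsetD)
          then show "g y \<in> A" using x by simp
        qed (use \<tau>g in force)
        ultimately show False using y by blast
      qed
    qed
    have "countable (({0..1} - Y) \<union> f ` C \<union> \<tau> ` E)" using cY C E by auto
    then have "countable ((?V - \<tau> ` A) \<union> (\<tau> ` A - ?V))" using sub countable_subset by blast
    moreover have "\<tau> ` A \<subseteq> {0..1}" using maps A01 by blast
    ultimately show ?thesis using unit_sets_countable_change[OF V(1), of "\<tau> ` A"] V(2) by simp
  qed
  have M: "\<tau> \<in> MPT" unfolding MPT_def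
  proof (intro CollectI conjI ballI)
    fix A assume "A \<in> unit_sets"
    note A = pre[OF this] img[OF this]
    show "\<tau> -` A \<inter> {0..1} \<in> sets lebesgue" "\<tau> ` A \<in> sets lebesgue"
      using A by (simp_all only: unit_sets_iff)
    show "measure lebesgue (\<tau> -` A \<inter> {0..1}) = measure lebesgue A" "measure lebesgue (\<tau> ` A) = measure lebesgue A"
      using A by simp_all
  qed (rule \<tau>)
  moreover have "sdm (\<tau> ` cell (q i) a) (cell (q i) (p i a)) = 0" if a: "a < q i" for i a
  proof -
    have q: "q i > 0" by (rule tower_pos[OF T])
    let ?c = "cell (q i) a" and ?d = "cell (q i) (p i a)"
    have c: "?c \<in> unit_sets" and d: "?d \<in> unit_sets" using a tower_less[OF T a] cell_unit_sets by blast+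
    have \<tau>c: "\<tau> ` ?c \<in> unit_sets" "measure lebesgue (\<tau> ` ?c) = measure lebesgue ?c" using img[OF c] by auto
    \<comment> \<open>Image and target cell have equal measure, so it is enough that the image does
      not stick out.\<close>
    have "\<tau> ` ?c - ?d \<subseteq> \<tau> ` E"
    proof
      fix y assume "y \<in> \<tau> ` ?c - ?d"
      then obtain x where x: "x \<in> ?c" "y = \<tau> x" "y \<notin> ?d" by blast
      have x01: "x \<in> {0..<1}" using x(1) cell_subset_unit[OF a] by blast
      have "x \<in> E"
      proof (rule ccontr)
        assume "x \<notin> E"
        then have "x \<in> X - C" using x01 by (auto simp: E_def)
        then have "\<tau> x = f x" "f x \<notin> ?D" using \<tau>f by (auto simp: X_def)
        moreover have "addr (q i) x = a" using x(1) x01 q by (simp add: mem_cell_addr)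
        ultimately have "\<tau> x \<in> ?d"
          using limit_map_off_grid(2)[OF T x01, of i] by (simp add: f_def)
        then show False using x by simp
      qed
      then show "y \<in> \<tau> ` E" using x by blast
    qed
    then have "negligible (\<tau> ` ?c - ?d)" using E by (meson countable_image negligible_countable negligible_subset)
    then have "measure lebesgue (\<tau> ` ?c - ?d) = 0" by (rule negligible_imp_measure0)
    then have "measure lebesgue (\<tau> ` ?c \<inter> ?d) = 1 / real (q i)"
      using measure_unit_Diff_Int[OF \<tau>c(1) d] \<tau>c(2) q by (simp add: measure_cell)
    then show ?thesis using sdm_eq_measure_Diff[OF \<tau>c(1) d] \<tau>c(2) q by (simp add: measure_cell)
  qed
  ultimately show ?thesis by blast
qed

text \<open>Advancing one step along each cycle gives a tower: the cycles share their time index, so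
  successor and predecessor commute with passing to the coarser cell.\<close>

lemma cyc_limit:
  assumes cyc: "\<And>i. cyc (q i) (e i)" and ref: "\<And>i. refines (q i) (e i) (q (Suc i)) (e (Suc i))"
    and grow: "\<And>i. q i < q (Suc i)"
  shows "\<exists>\<tau>\<in>MPT. \<forall>i t. sdm (\<tau> ` cell (q i) (e i t)) (cell (q i) (e i (Suc t))) = 0"
proof -
  have q: "q i > 0" for i using cyc by (simp add: cyc_def)
  define pos where "pos i a = inv_into {..<q i} (e i) a" for i a
  \<comment> \<open>The predecessor is reached by going \<open>q i - 1\<close> steps forward, which
    avoids negative times.\<close>
  define p p' where "p i a = e i (Suc (pos i a))" and "p' i a = e i (pos i a + (q i - 1))" for i a
  have pos: "pos i (e i t) = t mod q i" for i t
  proof -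
    have "inv_into {..<q i} (e i) (e i (t mod q i)) = t mod q i"
      using cyc[of i] q[of i] by (intro inv_into_f_f) (auto simp: cyc_def bij_betw_def)
    then show ?thesis by (simp add: pos_def cyc_mod[OF cyc])
  qed
  have p: "p i (e i t) = e i (Suc t)" for i t
    using cyc_mod[OF cyc, of i "Suc (t mod q i)"] cyc_mod[OF cyc, of i "Suc t"]
    by (simp add: p_def pos mod_Suc_eq)
  have p': "p' i (e i t) = e i (t + (q i - 1))" for i t
    using cyc_mod[OF cyc, of i "t mod q i + (q i - 1)"] cyc_mod[OF cyc, of i "t + (q i - 1)"]
    by (simp add: p'_def pos mod_add_left_eq)
  have wrap: "e i (Suc t + (q i - 1)) = e i t" "e i (Suc (t + (q i - 1))) = e i t" for i t
  proof -
    have "Suc t + (q i - 1) = t + q i" using q[of i] by simp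
    then show "e i (Suc t + (q i - 1)) = e i t" "e i (Suc (t + (q i - 1))) = e i t"
      using cyc[of i] by (simp_all add: cyc_def)
  qed
  have ex: "\<exists>t. a = e i t" if "a < q i" for i a
    using cyc[of i] that unfolding cyc_def bij_betw_def by (metis imageE lessThan_iff)
  have "tower q p p'"
    unfolding tower_def
  proof (intro conjI allI impI)
    fix i a assume "a < q i"
    then obtain t where "a = e i t" using ex by blast
    then show "p i a < q i" "p' i a < q i" "p' i (p i a) = a" "p i (p' i a) = a"
      by (simp_all only: p p' wrap cyc_less[OF cyc])
  next
    fix i
    obtain k where k: "k > 0" "q (Suc i) = q i * k" "\<And>t. e (Suc i) t div k = e i t"
      using ref[of i] unfolding refines_def by blast
    have "p (Suc i) a div k = p i (a div k) \<and> p' (Suc i) a div k = p' i (a div k)" if a: "a < q (Suc i)" for a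
    proof -
      obtain t where t: "a = e (Suc i) t" using ex[OF a] by blast
      have "e i (t + (q (Suc i) - 1)) = e i (t + (q i - 1))"
      proof -
        \<comment> \<open>The two forward moves differ by whole periods of the coarse cycle, so both
          are one step back on it.\<close>
        have "q (Suc i) - 1 = (q i - 1) + (k - 1) * q i"
          using k(1) q[of i] unfolding k(2) by (cases k) (auto simp: algebra_simps)
        then have "(t + (q (Suc i) - 1)) mod q i = (t + (q i - 1)) mod q i"
          by (simp add: add.assoc[symmetric])
        then show ?thesis using cyc_mod[OF cyc, of i "t + (q (Suc i) - 1)"] cyc_mod[OF cyc, of i "t + (q i - 1)"] by simp
      qed
      then show ?thesis unfolding t p p' k(3) by simp
    qed
    then show "\<exists>k>0. q (Suc i) = q i * k \<and>
        (\<forall>a<q (Suc i). p (Suc i) a div k = p i (a div k) \<and> p' (Suc i) a div k = p' i (a div k))"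
      using k by blast
  qed (use q grow in auto)
  then obtain \<tau> where "\<tau> \<in> MPT" "\<And>i a. a < q i \<Longrightarrow> sdm (\<tau> ` cell (q i) a) (cell (q i) (p i a)) = 0"
    using tower_limit by blast
  then show ?thesis using cyc_less[OF cyc] p by metis
qed

section \<open>Density and the theorem\<close>

text \<open>The starting cycle is such that every map following it lies in \<open>U\<close>. Each
  refinement keeps this and adds one \<open>hits\<close> condition, and the limit follows all cycles
  at once, hence lies in \<open>U\<close> and in every stage.\<close>

lemma stages_dense:
  assumes meas: "\<And>n. n \<ge> 1 \<Longrightarrow> B n \<in> unit_sets"
    and decr: "\<And>n. n \<ge> 1 \<Longrightarrow> B (Suc n) \<subseteq> B n"
    and diverge: "\<not> summable (\<lambda>n. measure lebesgue (B (Suc n)))"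
    and U: "openin weak_top U" "U \<noteq> {}"
  shows "U \<inter> (\<Inter>N. stage B N) \<noteq> {}"
proof -
  obtain \<tau>0 where \<tau>0: "\<tau>0 \<in> U" using U(2) by blast
  then have \<tau>0M: "\<tau>0 \<in> MPT" using openin_subset[OF U(1)] topspace_weak_top by blast
  obtain F \<epsilon> where F: "finite F" "F \<subseteq> unit_sets" "\<epsilon> > 0"
    and nbhd: "\<And>\<sigma>. \<sigma> \<in> MPT \<Longrightarrow> (\<forall>A\<in>F. sdm (\<sigma> ` A) (\<tau>0 ` A) < \<epsilon>) \<Longrightarrow> \<sigma> \<in> U"
    using weak_top_nbhd[OF U(1) \<tau>0] by blast
  obtain q0 e0 where e0: "cyc q0 e0"
    and start: "\<And>\<sigma>. \<sigma> \<in> MPT \<Longrightarrow> (\<forall>t. sdm (\<sigma> ` cell q0 (e0 t)) (cell q0 (e0 (Suc t))) = 0) \<Longrightarrow>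
      \<forall>A\<in>F. sdm (\<sigma> ` A) (\<tau>0 ` A) < \<epsilon>"
    using cycles_weakly_dense[OF \<tau>0M F] by blast
  \<comment> \<open>\<open>P\<close> pins the start of the dependent choice to the cycle that leads
    into \<open>U\<close>.\<close>
  define P where "P n s \<longleftrightarrow> cyc (fst s) (snd s) \<and> (n = 0 \<longrightarrow> s = (q0, e0))" for n :: nat and s
  define Q where "Q n s s' \<longleftrightarrow> refines (fst s) (snd s) (fst s') (snd s') \<and> fst s < fst s' \<and>
      (\<exists>M. hits B (Suc n) M (1 / real (Suc n)) (fst s') (snd s'))" for n :: nat and s s' :: "nat \<times> (nat \<Rightarrow> nat)"
  have "\<exists>s. \<forall>n. P n (s n) \<and> Q n (s n) (s (Suc n))"
  proof (rule dependent_nat_choice)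
    show "\<exists>x. P 0 x" using e0 by (simp add: P_def)
  next
    fix x n assume "P n x"
    then have "cyc (fst x) (snd x)" by (simp add: P_def)
    from hits_refinement[OF this meas decr diverge, of "Suc n" "1 / real (Suc n)"]
    obtain q' e' M where "cyc q' e'" "refines (fst x) (snd x) q' e'" "fst x < q'"
      "hits B (Suc n) M (1 / real (Suc n)) q' e'" by auto
    then show "\<exists>y. P (Suc n) y \<and> Q n x y"
      by (intro exI[of _ "(q', e')"]) (auto simp: P_def Q_def)
  qed
  then obtain s where s: "\<And>n. P n (s n)" "\<And>n. Q n (s n) (s (Suc n))" by blast
  define q e where "q n = fst (s n)" and "e n = snd (s n)" for n
  have cyc: "cyc (q n) (e n)" and ref: "refines (q n) (e n) (q (Suc n)) (e (Suc n))"
    and grow: "q n < q (Suc n)" and hit: "\<exists>M. hits B (Suc n) M (1 / real (Suc n)) (q (Suc n)) (e (Suc n))" for n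
    using s[of n] by (simp_all add: P_def Q_def q_def e_def)
  have init: "q 0 = q0" "e 0 = e0" using s(1)[of 0] by (simp_all add: P_def q_def e_def)
  obtain \<tau> where \<tau>: "\<tau> \<in> MPT" and follows: "\<And>i t. sdm (\<tau> ` cell (q i) (e i t)) (cell (q i) (e i (Suc t))) = 0"
    using cyc_limit[of q e] cyc ref grow by blast
  have "\<tau> \<in> U" using follows[of 0] by (intro nbhd \<tau> start) (simp add: init)
  moreover have "\<tau> \<in> stage B N" for N
  proof -
    obtain M where M: "hits B (Suc N) M (1 / real (Suc N)) (q (Suc N)) (e (Suc N))" using hit by blast
    have "n \<le> q n" for n
    proof (induction n)
      case (Suc n)
      then show ?case using grow[of n] by simp
    qed simp
    then have "N \<le> q (Suc N)" using Suc_leD by blast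
    moreover have "q (Suc N) > 0" using cyc by (simp add: cyc_def)
    \<comment> \<open>The differences vanish, so every positive tolerance is met, whatever
      \<open>M\<close> the refinement needed.\<close>
    then have "\<tau> \<in> near (q (Suc N)) (e (Suc N)) (1 / (real (Suc N) * real (q (Suc N)) ^ 2 * real (Suc M)))"
      unfolding near_def using \<tau> follows by (simp del: of_nat_Suc)
    ultimately show ?thesis unfolding stage_def using cyc M by blast
  qed
  ultimately show ?thesis by blast
qed

theorem mainTheorem4:
  fixes B :: "nat \<Rightarrow> real set"
  assumes meas: "\<And>n. n \<ge> 1 \<Longrightarrow> B n \<in> sets (lebesgue_on {0..1})"
    and decr: "\<And>n. n \<ge> 1 \<Longrightarrow> B (Suc n) \<subseteq> B n"
    and pos: "\<And>n. n \<ge> 1 \<Longrightarrow> measure lebesgue (B n) > 0"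
    and diverge: "\<not> summable (\<lambda>n. measure lebesgue (B (Suc n)))"
  shows "\<exists>G. gdelta_in weak_top G \<and> weak_top closure_of G = topspace weak_top \<and>
           (\<forall>\<tau> \<in> G. ergodic \<tau> \<and>
              (AE x in lebesgue_on {0..1}. \<exists>\<^sub>\<infinity>n. n \<ge> 1 \<and> (\<tau> ^^ n) x \<in> B n))"
proof (intro exI conjI ballI)
  let ?G = "\<Inter>N. stage B N"
  show "gdelta_in weak_top ?G"
    using openin_stage by (intro gdelta_in_Inter) (auto intro: open_imp_gdelta_in)
  have "U \<inter> ?G \<noteq> {}" if "openin weak_top U \<and> U \<noteq> {}" for U
    using stages_dense[OF meas decr diverge] that by blast
  then show "weak_top closure_of ?G = topspace weak_top"
    unfolding dense_intersects_open by (metis Int_commute)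
  fix \<tau> assume "\<tau> \<in> ?G"
  then have stages: "\<And>N. \<tau> \<in> stage B N" by blast
  show "ergodic \<tau>" by (rule stages_ergodic[OF stages])
  show "AE x in lebesgue_on {0..1}. \<exists>\<^sub>\<infinity>n. n \<ge> 1 \<and> (\<tau> ^^ n) x \<in> B n"
    by (rule stages_hit_infinitely_often[OF stages meas])
qed

end
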